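(* Let $\Omega$ be any open set in $\mathbb R^n$, $n\geq2$. Assume that $\mu$ is a Borel measure in $\Omega$ such that $\mu(B_r(x)\cap\Omega)\leq C_\mu r^\alpha$ for $x\in\Omega$ and $r>0$, for some exponent $\alpha\in(n-1,n]$ and some constant $C_\mu>0$. If $1<p<n$, then there exists a constant $C=C(n,p,\alpha,C_\mu)$ such that $$\|\mathbf u\|_{L^{\frac{\alpha p}{n-p}}(\Omega,\mu)}\leq C\Big(\|\mathcal E\mathbf u\|_{L^p(\Omega)}+\|\mathbf u\|_{L^{\frac{p(n-1)}{n-p}}(\partial\Omega)}\Big)$$ for every $\mathbf u\in E^{1,p}(\Omega)\cap C_b(\overline\Omega)$.
   Context: Functions $\mathbf u$ are $\mathbb R^n$-valued. $\mathcal E\mathbf u=\tfrac12(\nabla\mathbf u+(\nabla\mathbf u)^T)$ is the symmetric part of the distributional gradient. $E^{1,p}(\Omega)=\{\mathbf u\in L^1_{\rm loc}(\Omega):|\mathcal E\mathbf u|\in L^p(\Omega)\}$. $C_b(\overline\Omega)$ is the set of functions that are continuous in $\overline\Omega$ and have bounded support. $B_r(x)$ is the ball centered at $x$ with radius $r$. Norms over $\Omega$ with no measure indicated are with respect to Lebesgue measure; norms over $\partial\Omega$ are with respect to the $(n-1)$-dimensional Hausdorff measure $\mathcal H^{n-1}$ and are applied to the restriction of $\mathbf u$ to $\partial\Omega$. *)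

theory Defs
  imports "HOL-Analysis.Analysis"
begin

section \<open>Hausdorff measure\<close>

text \<open>
  The normalisation is the usual one, under which the \<open>n\<close>-dimensional Hausdorff measure on
  \<open>\<real>\<^sup>n\<close> is Lebesgue measure. Coverings are by countably many bounded sets, some of which may be
  empty. Since \<open>0 powr 0 = 0\<close> in HOL, the definitions are meaningful for \<open>s > 0\<close> only.
\<close>

definition hausdorff_content :: "real \<Rightarrow> 'a::metric_space set \<Rightarrow> ennreal" where
  "hausdorff_content s C = ennreal (unit_ball_vol s * (diameter C / 2) powr s)"

definition hausdorff_pre :: "real \<Rightarrow> real \<Rightarrow> 'a::metric_space set \<Rightarrow> ennreal" where
  "hausdorff_pre s \<delta> A =
    (INF C \<in> {C :: nat \<Rightarrow> 'a set. A \<subseteq> (\<Union>i. C i) \<and> (\<forall>i. bounded (C i) \<and> diameter (C i) \<le> \<delta>)}.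
      \<Sum>i. hausdorff_content s (C i))"

definition hausdorff_outer :: "real \<Rightarrow> 'a::metric_space set \<Rightarrow> ennreal" where
  "hausdorff_outer s A = (SUP \<delta>\<in>{0<..}. hausdorff_pre s \<delta> A)"

definition hausdorff_measure :: "real \<Rightarrow> 'a::metric_space measure" where
  "hausdorff_measure s = measure_of UNIV (sets borel) (hausdorff_outer s)"

text \<open>
  By Caratheodory's criterion the Hausdorff outer measure is countably additive on Borel sets, so
  that \<^const>\<open>measure_of\<close> above does not degenerate to the null measure; see \<open>emeasure_hausdorff\<close>.
\<close>

lemma space_hausdorff [simp]: "space (hausdorff_measure s) = UNIV"
  by (simp add: hausdorff_measure_def space_measure_of_conv)

lemma sets_hausdorff [simp, measurable_cong]: "sets (hausdorff_measure s) = sets borel"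
proof -
  have "sigma_sets UNIV (sets (borel :: 'a measure)) = sets borel"
    using sets.sigma_sets_eq[of "borel :: 'a measure"] by simp
  then show ?thesis by (simp add: hausdorff_measure_def sets_measure_of_conv)
qed

lemma hausdorff_content_empty [simp]: "hausdorff_content s {} = 0"
  by (simp add: hausdorff_content_def)

lemma hausdorff_content_mono:
  assumes "0 \<le> s" "C \<subseteq> D" "bounded D"
  shows "hausdorff_content s C \<le> hausdorff_content s D"
proof -
  have "bounded C" using assms bounded_subset by blast
  then have "(diameter C / 2) powr s \<le> (diameter D / 2) powr s"
    using assms diameter_subset[of C D] diameter_ge_0[of C] by (intro powr_mono2) auto
  then show ?thesis
    unfolding hausdorff_content_def using assms
    by (intro ennreal_leI mult_left_mono) auto
qed

lemma hausdorff_pre_le: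
  assumes "A \<subseteq> (\<Union>i. C i)" "\<And>i. bounded (C i)" "\<And>i. diameter (C i) \<le> \<delta>"
  shows "hausdorff_pre s \<delta> A \<le> (\<Sum>i. hausdorff_content s (C i))"
  unfolding hausdorff_pre_def by (rule INF_lower) (use assms in auto)

lemma hausdorff_pre_mono: "A \<subseteq> B \<Longrightarrow> hausdorff_pre s \<delta> A \<le> hausdorff_pre s \<delta> B"
  unfolding hausdorff_pre_def by (rule INF_superset_mono) auto

lemma hausdorff_pre_antimono: "\<delta> \<le> \<delta>' \<Longrightarrow> hausdorff_pre s \<delta>' A \<le> hausdorff_pre s \<delta> A"
  unfolding hausdorff_pre_def by (rule INF_superset_mono) (auto intro: order_trans)

lemma hausdorff_pre_close:
  assumes "hausdorff_pre s \<delta> A < e"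
  shows "\<exists>C. A \<subseteq> (\<Union>i. C i) \<and> (\<forall>i. bounded (C i) \<and> diameter (C i) \<le> \<delta>) \<and>
      (\<Sum>i. hausdorff_content s (C i)) < e"
  using assms unfolding hausdorff_pre_def INF_less_iff by auto

lemma hausdorff_pre_empty: "0 < \<delta> \<Longrightarrow> hausdorff_pre s \<delta> {} = 0"
  using hausdorff_pre_le[of "{}" "\<lambda>_. {}" \<delta> s] by simp

lemma hausdorff_outer_mono: "A \<subseteq> B \<Longrightarrow> hausdorff_outer s A \<le> hausdorff_outer s B"
  unfolding hausdorff_outer_def by (rule SUP_mono) (use hausdorff_pre_mono in blast)

lemma hausdorff_outer_empty [simp]: "hausdorff_outer s {} = 0"
proof -
  have "hausdorff_outer s ({} :: 'a set) \<le> 0"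
    unfolding hausdorff_outer_def by (rule SUP_least) (simp add: hausdorff_pre_empty)
  then show ?thesis by simp
qed

lemma hausdorff_pre_UN:
  "hausdorff_pre s \<delta> (\<Union>i. A i) \<le> (\<Sum>i. hausdorff_pre s \<delta> (A i :: 'a::metric_space set))"
proof (rule ennreal_le_epsilon)
  let ?O = "hausdorff_pre s \<delta> :: 'a set \<Rightarrow> ennreal"
  fix e :: real assume e: "0 < e" and "(\<Sum>n. ?O (A n)) < top"
  then have *: "\<And>n. ?O (A n) < ?O (A n) + e * (1/2)^Suc n"
    by (auto simp add: less_top dest!: ennreal_suminf_lessD)
  have "\<exists>C. A n \<subseteq> (\<Union>i. C i) \<and> (\<forall>i. bounded (C i) \<and> diameter (C i) \<le> \<delta>) \<and>
      (\<Sum>i. hausdorff_content s (C i)) < ?O (A n) + e * (1/2)^Suc n" for n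
    by (rule hausdorff_pre_close[OF *])
  then obtain B where
    B: "\<And>n. A n \<subseteq> (\<Union>i. B n i)" "\<And>n i. bounded (B n i)" "\<And>n i. diameter (B n i) \<le> \<delta>"
    and le: "\<And>n. (\<Sum>i. hausdorff_content s (B n i)) < ?O (A n) + e * (1/2)^Suc n"
    by metis
  define C where "C = case_prod B o prod_decode"
  have "(\<Union>i. A i) \<subseteq> (\<Union>i. C i)"
    using B(1) by (auto simp add: C_def subset_eq) (metis prod.case prod_encode_inverse)
  then have "?O (\<Union>i. A i) \<le> (\<Sum>i. hausdorff_content s (C i))"
    by (rule hausdorff_pre_le) (auto simp: C_def B split: prod.splits)
  also have "\<dots> = (\<Sum>n. \<Sum>i. hausdorff_content s (B n i))"
    using suminf_ennreal_2dimen[of "\<lambda>n. \<Sum>i. hausdorff_content s (B n i)"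
        "\<lambda>(n, i). hausdorff_content s (B n i)"]
    by (simp add: C_def comp_def case_prod_beta)
  also have "\<dots> \<le> (\<Sum>n. ?O (A n) + e * (1/2) ^ Suc n)"
    using le by (intro suminf_le summableI less_imp_le)
  also have "\<dots> = (\<Sum>n. ?O (A n)) + (\<Sum>n. ennreal e * ennreal ((1/2) ^ Suc n))"
    using e by (subst suminf_add[symmetric])
      (auto simp del: ennreal_suminf_cmult simp add: ennreal_mult[symmetric])
  also have "\<dots> = (\<Sum>n. ?O (A n)) + e"
    unfolding ennreal_suminf_cmult
    by (subst suminf_ennreal_eq[OF zero_le_power power_half_series]) auto
  finally show "?O (\<Union>i. A i) \<le> (\<Sum>n. ?O (A n)) + e" .
qed

lemma hausdorff_outer_UN:
  "hausdorff_outer s (\<Union>i. A i) \<le> (\<Sum>i. hausdorff_outer s (A i))"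
  unfolding hausdorff_outer_def[of s "\<Union>i. A i"]
proof (rule SUP_least)
  fix \<delta> :: real assume "\<delta> \<in> {0<..}"
  then show "hausdorff_pre s \<delta> (\<Union>i. A i) \<le> (\<Sum>i. hausdorff_outer s (A i))"
    by (intro order_trans[OF hausdorff_pre_UN] suminf_le summableI)
      (auto simp: hausdorff_outer_def intro: SUP_upper)
qed

lemma hausdorff_outer_Un:
  "hausdorff_outer s (A \<union> B) \<le> hausdorff_outer s A + hausdorff_outer s B"
proof -
  have "hausdorff_outer s (\<Union>i. binaryset A B i) \<le> (\<Sum>i. hausdorff_outer s (binaryset A B i))"
    by (rule hausdorff_outer_UN)
  then show ?thesis
    by (simp add: UN_binaryset_eq suminf_binaryset_eq)
qed

lemma hausdorff_pre_separated:
  assumes s: "0 \<le> s" and "\<delta> < d" and sep: "\<And>x y. x \<in> A \<Longrightarrow> y \<in> B \<Longrightarrow> d \<le> dist x y"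
  shows "hausdorff_pre s \<delta> A + hausdorff_pre s \<delta> B \<le> hausdorff_pre s \<delta> (A \<union> B)"
  unfolding hausdorff_pre_def[of s \<delta> "A \<union> B"]
proof (rule INF_greatest, clarify)
  fix C :: "nat \<Rightarrow> 'a set"
  assume cov: "A \<union> B \<subseteq> (\<Union>i. C i)" and C: "\<forall>i. bounded (C i) \<and> diameter (C i) \<le> \<delta>"
  have sub: "bounded (C i \<inter> X) \<and> diameter (C i \<inter> X) \<le> \<delta>" for i X
    using C bounded_subset[of "C i" "C i \<inter> X"] diameter_subset[of "C i \<inter> X" "C i"]
    by (meson Int_lower1 order_trans)
  have "hausdorff_pre s \<delta> A \<le> (\<Sum>i. hausdorff_content s (C i \<inter> A))"
    by (rule hausdorff_pre_le) (use cov sub in auto)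
  moreover have "hausdorff_pre s \<delta> B \<le> (\<Sum>i. hausdorff_content s (C i \<inter> B))"
    by (rule hausdorff_pre_le) (use cov sub in auto)
  ultimately have "hausdorff_pre s \<delta> A + hausdorff_pre s \<delta> B
      \<le> (\<Sum>i. hausdorff_content s (C i \<inter> A)) + (\<Sum>i. hausdorff_content s (C i \<inter> B))"
    by (rule add_mono)
  also have "\<dots> = (\<Sum>i. hausdorff_content s (C i \<inter> A) + hausdorff_content s (C i \<inter> B))"
    by (rule suminf_add) auto
  also have "\<dots> \<le> (\<Sum>i. hausdorff_content s (C i))"
  proof (intro suminf_le summableI)
    fix i
    have "C i \<inter> A = {} \<or> C i \<inter> B = {}"
    proof (rule ccontr)
      assume "\<not> ?thesis"
      then obtain x y where "x \<in> C i" "x \<in> A" "y \<in> C i" "y \<in> B" by auto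
      then have "d \<le> dist x y" "dist x y \<le> \<delta>"
        using sep C diameter_bounded_bound[of "C i" x y] order_trans by blast+
      then show False using assms by linarith
    qed
    moreover have "hausdorff_content s (C i \<inter> X) \<le> hausdorff_content s (C i)" for X
      using C s by (intro hausdorff_content_mono) auto
    ultimately show "hausdorff_content s (C i \<inter> A) + hausdorff_content s (C i \<inter> B)
        \<le> hausdorff_content s (C i)"
      by auto
  qed
  finally show "hausdorff_pre s \<delta> A + hausdorff_pre s \<delta> B \<le> (\<Sum>i. hausdorff_content s (C i))" .
qed

lemma hausdorff_outer_separated:
  assumes s: "0 \<le> s" and d: "0 < d" and sep: "\<And>x y. x \<in> A \<Longrightarrow> y \<in> B \<Longrightarrow> d \<le> dist x y"
  shows "hausdorff_outer s A + hausdorff_outer s B \<le> hausdorff_outer s (A \<union> B)"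
proof -
  have lim: "hausdorff_outer s X = (SUP n. hausdorff_pre s (d / real (n + 2)) X)" for X :: "'a set"
  proof (rule antisym)
    show "hausdorff_outer s X \<le> (SUP n. hausdorff_pre s (d / real (n + 2)) X)"
      unfolding hausdorff_outer_def
    proof (rule SUP_least)
      fix \<delta> :: real assume "\<delta> \<in> {0<..}"
      then have \<delta>: "0 < \<delta>" by simp
      obtain n :: nat where "d / \<delta> < real n" using reals_Archimedean2 by blast
      then have "d < real n * \<delta>" using \<delta> by (simp add: field_simps)
      also have "\<dots> \<le> real (n + 2) * \<delta>" using \<delta> by (intro mult_right_mono) auto
      finally have "d / real (n + 2) \<le> \<delta>" by (simp add: field_simps)
      then show "hausdorff_pre s \<delta> X \<le> (SUP n. hausdorff_pre s (d / real (n + 2)) X)"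
        by (intro SUP_upper2[of n] hausdorff_pre_antimono) auto
    qed
    show "(SUP n. hausdorff_pre s (d / real (n + 2)) X) \<le> hausdorff_outer s X"
      unfolding hausdorff_outer_def by (rule SUP_mono) (use d in \<open>auto intro!: bexI order_refl\<close>)
  qed
  have inc: "incseq (\<lambda>n. hausdorff_pre s (d / real (n + 2)) X)" for X :: "'a set"
    using d by (intro monoI hausdorff_pre_antimono divide_left_mono) auto
  have "hausdorff_outer s A + hausdorff_outer s B =
      (SUP n. hausdorff_pre s (d / real (n + 2)) A + hausdorff_pre s (d / real (n + 2)) B)"
    unfolding lim by (rule ennreal_SUP_add[OF inc inc, symmetric])
  also have "\<dots> \<le> hausdorff_outer s (A \<union> B)"
    unfolding lim
  proof (rule SUP_mono)
    fix n :: nat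
    have "d / real (n + 2) < d" using d by (simp add: field_simps add_pos_nonneg)
    then show "\<exists>m\<in>UNIV. hausdorff_pre s (d / real (n + 2)) A + hausdorff_pre s (d / real (n + 2)) B
        \<le> hausdorff_pre s (d / real (m + 2)) (A \<union> B)"
      using hausdorff_pre_separated[OF s _ sep] by blast
  qed
  finally show ?thesis .
qed

lemma hausdorff_outer_closed:
  assumes s: "0 \<le> s" and K: "closed K"
  shows "hausdorff_outer s (A \<inter> K) + hausdorff_outer s (A - K) \<le> hausdorff_outer s A"
proof (cases "K = {} \<or> hausdorff_outer s A = top")
  case True
  then show ?thesis by auto
next
  case False
  let ?H = "hausdorff_outer s :: 'a set \<Rightarrow> ennreal"
  have ne: "K \<noteq> {}" and fin: "?H A < top" using False by (auto simp: less_top)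
  define An where "An n = {x \<in> A. 1 / real (n + 2) \<le> infdist x K}" for n
  define R where "R k = {x \<in> A. 1 / real (k + 3) \<le> infdist x K \<and> infdist x K < 1 / real (k + 2)}" for k
  have half: "(\<Sum>k<N. ?H (R (2 * k + p))) \<le> ?H (\<Union>k<N. R (2 * k + p))" for N p
  proof (induction N)
    case 0
    show ?case by simp
  next
    case (Suc N)
    let ?d = "1 / real (2 * N + p + 1) - 1 / real (2 * N + p + 2)"
    have d: "0 < ?d"
      using divide_strict_left_mono[of "real (2 * N + p + 1)" "real (2 * N + p + 2)" 1] by simp
    have "?H (\<Union>k<N. R (2 * k + p)) + ?H (R (2 * N + p)) \<le> ?H ((\<Union>k<N. R (2 * k + p)) \<union> R (2 * N + p))"
    proof (rule hausdorff_outer_separated[OF s d])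
      fix x y assume "x \<in> (\<Union>k<N. R (2 * k + p))" and y: "y \<in> R (2 * N + p)"
      then obtain k where k: "k < N" "x \<in> R (2 * k + p)" by auto
      have "1 / real (2 * N + p + 1) \<le> 1 / real (2 * k + p + 3)"
        using k(1) by (intro divide_left_mono) auto
      also have "\<dots> \<le> infdist x K" using k by (simp add: R_def)
      also have "\<dots> \<le> infdist y K + dist x y" by (rule infdist_triangle)
      also have "infdist y K < 1 / real (2 * N + p + 2)" using y by (simp add: R_def)
      finally show "?d \<le> dist x y" by linarith
    qed
    moreover have "(\<Union>k<Suc N. R (2 * k + p)) = (\<Union>k<N. R (2 * k + p)) \<union> R (2 * N + p)"
      by (auto simp: less_Suc_eq)
    ultimately show ?case
      using order_trans[OF add_right_mono[OF Suc.IH, of "?H (R (2 * N + p))"]]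
      by (simp only: sum.lessThan_Suc)
  qed
  have half': "(\<Sum>k<N. ?H (R (2 * k + p))) \<le> ?H A" for N p
    by (rule order_trans[OF half]) (auto intro!: hausdorff_outer_mono simp: R_def)
  have part: "(\<Sum>k<N. ?H (R k)) \<le> ?H A + ?H A" for N
  proof -
    have "(\<Sum>k<N. ?H (R k)) \<le> (\<Sum>k<2*N. ?H (R k))"
      by (rule sum_mono2) auto
    also have "\<dots> = (\<Sum>k<N. ?H (R (2 * k + 0))) + (\<Sum>k<N. ?H (R (2 * k + 1)))"
      by (induction N) (auto simp: algebra_simps)
    also have "\<dots> \<le> ?H A + ?H A"
      by (intro add_mono half')
    finally show ?thesis .
  qed
  define S where "S = (\<Sum>k. ?H (R k))"
  have "S \<le> ?H A + ?H A"
    unfolding S_def by (rule suminf_le_const[OF summableI part])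
  then have S: "S < top" using fin by (simp add: order_le_less_trans)
  have cover: "A - K \<subseteq> An n \<union> (\<Union>k. R (k + n))" for n
  proof
    fix x assume x: "x \<in> A - K"
    then have pos: "0 < infdist x K" using infdist_pos_not_in_closed[OF K ne] by auto
    obtain m0 :: nat where "1 / infdist x K < real m0" using reals_Archimedean2 by blast
    then have "1 / real (m0 + 2) \<le> infdist x K"
      using pos by (simp add: field_simps)
    then have ex: "\<exists>m. 1 / real (m + 2) \<le> infdist x K" by blast
    define m where "m = (LEAST m. 1 / real (m + 2) \<le> infdist x K)"
    have m: "1 / real (m + 2) \<le> infdist x K" unfolding m_def by (rule LeastI_ex[OF ex])
    show "x \<in> An n \<union> (\<Union>k. R (k + n))"
    proof (cases "m \<le> n")
      case True
      then have "1 / real (n + 2) \<le> 1 / real (m + 2)" by (intro divide_left_mono) auto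
      then show ?thesis using m x by (auto simp: An_def)
    next
      case False
      then obtain k where k: "m = Suc (k + n)"
        by (metis add.commute less_natE not_le)
      then have "\<not> 1 / real (k + n + 2) \<le> infdist x K"
        using not_less_Least[of "k + n" "\<lambda>m. 1 / real (m + 2) \<le> infdist x K"] by (simp add: m_def)
      then have "x \<in> R (k + n)" using m x k by (simp add: R_def algebra_simps)
      then show ?thesis by blast
    qed
  qed
  have step: "(\<Sum>k<n. ?H (R k)) + (?H (A \<inter> K) + ?H (A - K)) \<le> ?H A + S" for n
  proof -
    have "?H (A \<inter> K) + ?H (An n) \<le> ?H ((A \<inter> K) \<union> An n)"
    proof (rule hausdorff_outer_separated[OF s, of "1 / real (n + 2)"])
      fix x y assume "x \<in> A \<inter> K" "y \<in> An n"
      then show "1 / real (n + 2) \<le> dist x y"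
        using infdist_le[of x K y] by (auto simp: An_def dist_commute intro: order_trans)
    qed auto
    also have "\<dots> \<le> ?H A" by (rule hausdorff_outer_mono) (auto simp: An_def)
    finally have 1: "?H (A \<inter> K) + ?H (An n) \<le> ?H A" .
    have "?H (A - K) \<le> ?H (An n \<union> (\<Union>k. R (k + n)))"
      by (rule hausdorff_outer_mono[OF cover])
    also have "\<dots> \<le> ?H (An n) + (\<Sum>k. ?H (R (k + n)))"
      by (rule order_trans[OF hausdorff_outer_Un add_left_mono[OF hausdorff_outer_UN]])
    finally have 2: "?H (A - K) \<le> ?H (An n) + (\<Sum>k. ?H (R (k + n)))" .
    have 3: "S = (\<Sum>k. ?H (R (k + n))) + (\<Sum>k<n. ?H (R k))"
      unfolding S_def by (rule suminf_offset[OF summableI])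
    have "(\<Sum>k<n. ?H (R k)) + (?H (A \<inter> K) + ?H (A - K))
        \<le> (\<Sum>k<n. ?H (R k)) + (?H (A \<inter> K) + (?H (An n) + (\<Sum>k. ?H (R (k + n)))))"
      by (intro add_left_mono 2)
    also have "\<dots> = (?H (A \<inter> K) + ?H (An n)) + S"
      unfolding 3 by (simp add: ac_simps)
    also have "\<dots> \<le> ?H A + S" by (intro add_right_mono 1)
    finally show ?thesis .
  qed
  have "S + (?H (A \<inter> K) + ?H (A - K)) \<le> S + ?H A"
    unfolding S_def by (rule ennreal_suminf_bound_add) (use step in \<open>simp add: S_def ac_simps\<close>)
  then show ?thesis
    using S by (auto simp: ennreal_add_left_cancel_le)
qed

lemma measure_space_hausdorff:
  assumes "0 \<le> s"
  shows "measure_space UNIV (sets borel) (hausdorff_outer s :: 'a::metric_space set \<Rightarrow> ennreal)"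
proof -
  let ?H = "hausdorff_outer s :: 'a set \<Rightarrow> ennreal"
  let ?L = "lambda_system UNIV UNIV ?H"
  interpret P: sigma_algebra UNIV "UNIV :: 'a set set"
    using sigma_algebra_Pow[of "UNIV :: 'a set"] by simp
  have "outer_measure_space UNIV ?H"
    unfolding outer_measure_space_def positive_def increasing_def countably_subadditive_def
    using hausdorff_outer_mono hausdorff_outer_UN by auto
  then have L: "measure_space UNIV ?L ?H" by (rule P.caratheodory_lemma)
  then interpret L: sigma_algebra UNIV ?L by (simp add: measure_space_def)
  have "K \<in> ?L" if "closed K" for K
    unfolding P.lambda_system_eq
  proof (clarsimp, rule antisym)
    fix A
    show "?H (A \<inter> K) + ?H (A - K) \<le> ?H A" by (rule hausdorff_outer_closed[OF assms that])
    show "?H A \<le> ?H (A \<inter> K) + ?H (A - K)"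
      using hausdorff_outer_Un[of s "A \<inter> K" "A - K"] by (simp add: Int_Diff_Un)
  qed
  then have "sigma_sets UNIV (Collect closed) \<subseteq> ?L"
    by (intro L.sigma_sets_subset) auto
  then have "sets borel \<subseteq> ?L"
    by (simp add: borel_eq_closed)
  then show ?thesis
    using L sets.sigma_algebra_axioms[of "borel :: 'a measure"]
    by (auto simp: measure_space_def positive_def countably_additive_def subset_eq)
qed

lemma emeasure_hausdorff:
  assumes "0 \<le> s" "A \<in> sets borel"
  shows "emeasure (hausdorff_measure s) A = hausdorff_outer s A"
proof -
  have "A \<in> sets (hausdorff_measure s)" using assms by simp
  moreover have "positive (sets (hausdorff_measure s :: 'a measure)) (hausdorff_outer s)"
    "countably_additive (sets (hausdorff_measure s :: 'a measure)) (hausdorff_outer s)"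
    using measure_space_hausdorff[OF assms(1), where ?'a = 'a] by (simp_all add: measure_space_def)
  ultimately show ?thesis
    by (intro emeasure_measure_of[OF hausdorff_measure_def]) auto
qed


section \<open>Lebesgue norms\<close>

text \<open>Norms take values in \<open>[0,\<infinity>]\<close>, and \<open>\<infinity>\<close> is returned when the integral diverges.\<close>

definition Lp_norm :: "'a measure \<Rightarrow> real \<Rightarrow> ('a \<Rightarrow> 'b::real_normed_vector) \<Rightarrow> ennreal" where
  "Lp_norm M p f =
    (let I = \<integral>\<^sup>+x. ennreal (norm (f x) powr p) \<partial>M
     in if I = \<infinity> then \<infinity> else ennreal (enn2real I powr (1 / p)))"

definition Lp_space :: "'a measure \<Rightarrow> real \<Rightarrow> ('a \<Rightarrow> 'b::real_normed_vector) set" where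
  "Lp_space M p = {f \<in> borel_measurable M. Lp_norm M p f < \<infinity>}"

definition L1_loc :: "'a::euclidean_space set \<Rightarrow> ('a \<Rightarrow> 'b::euclidean_space) set" where
  "L1_loc \<Omega> = {f. \<forall>K. compact K \<and> K \<subseteq> \<Omega> \<longrightarrow> integrable (lebesgue_on K) f}"


section \<open>Distributional symmetric gradient\<close>

definition partial_deriv :: "'n::finite \<Rightarrow> (real^'n \<Rightarrow> real) \<Rightarrow> real^'n \<Rightarrow> real" where
  "partial_deriv j \<phi> x = frechet_derivative \<phi> (at x) (axis j 1)"

primrec Ck :: "nat \<Rightarrow> (real^'n::finite \<Rightarrow> real) \<Rightarrow> bool" where
  "Ck 0 \<phi> \<longleftrightarrow> continuous_on UNIV \<phi>"
| "Ck (Suc k) \<phi> \<longleftrightarrow> \<phi> differentiable_on UNIV \<and> (\<forall>j. Ck k (partial_deriv j \<phi>))"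

definition test_functions :: "(real^'n::finite) set \<Rightarrow> (real^'n \<Rightarrow> real) set" where
  "test_functions \<Omega> = {\<phi>. (\<forall>k. Ck k \<phi>) \<and>
     compact (closure {x. \<phi> x \<noteq> 0}) \<and> closure {x. \<phi> x \<noteq> 0} \<subseteq> \<Omega>}"

text \<open>
  Distributions on \<open>\<Omega>\<close> are regarded as functionals on \<^term>\<open>test_functions \<Omega>\<close>;
  \<open>distr_partial \<Omega> j v\<close> is the \<open>j\<close>-th partial derivative of the distribution given by \<open>v\<close>.
\<close>

definition distr_partial ::
    "(real^'n::finite) set \<Rightarrow> 'n \<Rightarrow> (real^'n \<Rightarrow> real) \<Rightarrow> (real^'n \<Rightarrow> real) \<Rightarrow> real" where
  "distr_partial \<Omega> j v \<phi> = - (\<integral>x. v x * partial_deriv j \<phi> x \<partial>lebesgue_on \<Omega>)"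

definition distr_sym_grad ::
    "(real^'n::finite) set \<Rightarrow> (real^'n \<Rightarrow> real^'n) \<Rightarrow> 'n \<Rightarrow> 'n \<Rightarrow> (real^'n \<Rightarrow> real) \<Rightarrow> real" where
  "distr_sym_grad \<Omega> u i j \<phi> =
    1 / 2 * (distr_partial \<Omega> j (\<lambda>x. u x $ i) \<phi> + distr_partial \<Omega> i (\<lambda>x. u x $ j) \<phi>)"

text \<open>
  The matrix-valued function \<open>G\<close> represents \<open>\<E>u\<close> in \<open>\<Omega>\<close>. It is determined up to null sets.
\<close>

definition is_sym_grad ::
    "(real^'n::finite) set \<Rightarrow> (real^'n \<Rightarrow> real^'n) \<Rightarrow> (real^'n \<Rightarrow> real^'n^'n) \<Rightarrow> bool" where
  "is_sym_grad \<Omega> u G \<longleftrightarrow> G \<in> L1_loc \<Omega> \<and>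
    (\<forall>i j. \<forall>\<phi>\<in>test_functions \<Omega>.
       distr_sym_grad \<Omega> u i j \<phi> = (\<integral>x. G x $ i $ j * \<phi> x \<partial>lebesgue_on \<Omega>))"

text \<open>The norm of \<^typ>\<open>real^'n^'n\<close>, used for \<open>|\<E>u|\<close>, is the Frobenius norm.\<close>

definition E1p :: "real \<Rightarrow> (real^'n::finite) set \<Rightarrow> (real^'n \<Rightarrow> real^'n) set" where
  "E1p p \<Omega> = {u \<in> L1_loc \<Omega>. \<exists>G. is_sym_grad \<Omega> u G \<and> G \<in> Lp_space (lebesgue_on \<Omega>) p}"

definition Cb :: "'a::metric_space set \<Rightarrow> ('a \<Rightarrow> 'b::real_normed_vector) set" where
  "Cb S = {u. continuous_on S u \<and> bounded {x \<in> S. u x \<noteq> 0}}"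

end

theory Submission
  imports Defs "HOL-Computational_Algebra.Polynomial"
begin

text \<open>
  The derivative of \<open>u \<bullet> \<omega>\<close> along a ray in direction \<open>\<omega>\<close> is \<open>\<omega> \<bullet> (\<E>u \<omega>)\<close>. Following the ray from \<open>x\<close> up
  to its first exit from \<open>\<Omega>\<close> bounds \<open>\<bar>u(x) \<bullet> \<omega>\<bar>\<close> by the integral of \<open>\<bar>\<E>u\<bar>\<close> along the ray plus \<open>\<bar>u\<bar>\<close> at the exit
  point. Averaging over \<open>\<omega>\<close> in the unit ball turns the first term into a multiple of the Riesz
  potential of order one of \<open>\<bar>\<E>u\<bar>\<close>. Radial projection from \<open>x\<close> contracts like \<open>1 / \<bar>x - y\<bar>\<close>, so that the second
  term is at most a multiple of the integral of \<open>\<bar>u(y)\<bar> \<bar>x - y\<bar>^(1 - n)\<close> over \<open>\<partial>\<Omega>\<close> with respect to the Hausdorff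
  measure, without any regularity of \<open>\<partial>\<Omega>\<close>. To have this at every \<open>x\<close>, and not only almost everywhere,
  \<open>u\<close> is mollified and the mollified kernels are bounded uniformly by the kernel itself.

  The growth of \<open>\<mu>\<close> makes the kernel \<open>\<bar>x - y\<bar>^(1 - n)\<close> bounded from finite measures into weak
  \<open>L^(\<alpha> / (n - 1))(\<mu>)\<close>. The boundary average moreover preserves bounded functions, and the Riesz
  potential of the truncated \<open>\<bar>\<E>u\<bar>\<close> is bounded; splitting both data at a level depending on \<open>t\<close> and
  integrating \<open>t^(q - 1) \<mu>(\<bar>u\<bar> > t)\<close> gives the inequality, as in the proof of Marcinkiewicz' theorem.
\<close>


section \<open>Potentials of upper regular measures\<close>

text \<open>Only the symmetric part of the gradient is controlled, so truncations of |u| have no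
  usable derivative, and the usual way of improving a weak estimate by truncating \<open>u\<close>
  is blocked. A scalar estimate of |u| by data \<open>F\<close> (for |\<E>u|) and \<open>w\<close>
  (for |u| on the boundary) is derived instead, and the truncation is performed on the data. The
  restrictions on the exponents enter as follows: \<open>n - 1 < \<alpha>\<close> makes the kernel
  integrable near its pole for \<mu>, \<open>p < n\<close> makes the tail of the kernel integrable
  to the conjugate power for Lebesgue measure, and \<open>1 < p\<close> makes the integrals in
  \<open>t\<close> converge at 0. With \<open>s = p * (n - 1) / (n - p)\<close> one has
  \<open>n / (n - p) * (p - 1) = s - 1\<close>; this identity lets levels growing like
  \<open>t powr (n / (n - p))\<close> for \<open>F\<close> and like \<open>t\<close> for
  \<open>w\<close> lead to the same exponent of |u|. On an arbitrary boundary the Hausdorff measure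
  may fail to be \<sigma>-finite. Tonelli's theorem is therefore applied only to finite measures
  having a density with respect to it.\<close>

lemma suminf_ennreal_geometric:
  assumes "0 \<le> c" "0 \<le> q" "q < 1"
  shows "(\<Sum>k. ennreal (c * q ^ k)) = ennreal (c / (1 - q))"
proof -
  have "(\<lambda>k. c * q ^ k) sums (c * (1 / (1 - q)))"
    using assms by (intro sums_mult geometric_sums) auto
  then show ?thesis using assms by (intro suminf_ennreal_eq) auto
qed

section \<open>Dyadic shells and integrals of the kernel\<close>

lemma ball_shell_inner:
  fixes x y :: "'a::real_normed_vector" and r :: real
  assumes "0 < norm (x - y)" "norm (x - y) < r"
  obtains k :: nat where "r / 2 ^ Suc k \<le> norm (x - y)" "norm (x - y) < r / 2 ^ k"
proof -
  let ?P = "\<lambda>k. r / 2 ^ Suc k \<le> norm (x - y)"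
  obtain N :: nat where N: "r / norm (x - y) < 2 ^ N"
    using real_arch_pow[of 2 "r / norm (x - y)"] by auto
  then have "r < 2 ^ N * norm (x - y)" using assms by (simp add: field_simps)
  also have "\<dots> \<le> 2 ^ Suc N * norm (x - y)" using assms by (intro mult_right_mono) auto
  finally have "?P N" by (simp add: field_simps)
  define k where "k = (LEAST k. ?P k)"
  have k: "?P k" unfolding k_def by (rule LeastI[of ?P]) fact
  have "norm (x - y) < r / 2 ^ k"
  proof (cases k)
    case 0 then show ?thesis using assms by simp
  next
    case (Suc j)
    then have "\<not> ?P j" using not_less_Least[of j ?P] by (simp add: k_def)
    then show ?thesis using Suc by simp
  qed
  then show thesis using that k by blast
qed

lemma ball_shell_outer:
  fixes x y :: "'a::real_normed_vector" and r :: real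
  assumes "0 < r" "r \<le> norm (x - y)"
  obtains k :: nat where "r * 2 ^ k \<le> norm (x - y)" "norm (x - y) < r * 2 ^ Suc k"
proof -
  let ?P = "\<lambda>k. norm (x - y) < r * 2 ^ Suc k"
  obtain N :: nat where N: "norm (x - y) / r < 2 ^ N"
    using real_arch_pow[of 2 "norm (x - y) / r"] by auto
  then have "norm (x - y) < r * 2 ^ N" using assms by (simp add: field_simps)
  also have "\<dots> \<le> r * 2 ^ Suc N" using assms by (intro mult_left_mono) auto
  finally have "?P N" .
  define k where "k = (LEAST k. ?P k)"
  have k: "?P k" unfolding k_def by (rule LeastI[of ?P]) fact
  have "r * 2 ^ k \<le> norm (x - y)"
  proof (cases k)
    case 0 then show ?thesis using assms by simp
  next
    case (Suc j)
    then have "\<not> ?P j" using not_less_Least[of j ?P] by (simp add: k_def)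
    then show ?thesis using Suc by simp
  qed
  then show thesis using that k by blast
qed

text \<open>The largest value of the kernel on the k-th shell, taken at the inner radius, times the
  growth bound for the ball of the outer radius. The ratio \<open>2 powr (b - \<alpha>)\<close> is
  below 1 exactly when \<open>b < \<alpha>\<close>; \<open>2 powr b\<close> is the price of passing
  from the outer to the inner radius.\<close>

lemma powr_dyadic_near:
  assumes "0 < (r::real)"
  shows "(r / 2 ^ Suc k) powr - b * (r / 2 ^ k) powr \<alpha> = 2 powr b * r powr (\<alpha> - b) * (2 powr (b - \<alpha>)) ^ k"
  using assms
  by (simp add: powr_def ln_div ln_mult ln_realpow algebra_simps exp_add[symmetric] flip: exp_of_nat_mult)

lemma powr_dyadic_far:
  assumes "0 < (r::real)"
  shows "(r * 2 ^ k) powr - b * (r * 2 ^ Suc k) powr \<alpha> = 2 powr \<alpha> * r powr (\<alpha> - b) * (2 powr (\<alpha> - b)) ^ k"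
  using assms
  by (simp add: powr_def ln_div ln_mult ln_realpow algebra_simps exp_add[symmetric] flip: exp_of_nat_mult)

text \<open>Balls may be centred anywhere and the measure lives on the whole space, because the
  poles \<open>y\<close> of the kernel also lie on the boundary and outside \<Omega>.
  \<open>upper_regular_distr\<close> passes to this form from centres in \<Omega>.\<close>

definition upper_regular :: "real \<Rightarrow> real \<Rightarrow> 'a::euclidean_space measure \<Rightarrow> bool" where
  "upper_regular K \<alpha> M \<longleftrightarrow> sets M = sets borel \<and>
    (\<forall>y r. 0 < r \<longrightarrow> emeasure M (ball y r) \<le> ennreal (K * r powr \<alpha>))"

lemma upper_regularD:
  "upper_regular K \<alpha> M \<Longrightarrow> 0 < r \<Longrightarrow> emeasure M (ball y r) \<le> ennreal (K * r powr \<alpha>)"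
  "upper_regular K \<alpha> M \<Longrightarrow> sets M = sets borel"
  "upper_regular K \<alpha> M \<Longrightarrow> space M = UNIV"
  using sets_eq_imp_space_eq[of M borel] by (auto simp: upper_regular_def)

lemma upper_regular_sigma_finite:
  fixes M :: "'a::euclidean_space measure"
  assumes "upper_regular K \<alpha> M"
  shows "sigma_finite_measure M"
proof
  have "emeasure M (ball 0 (real (Suc n))) \<noteq> \<infinity>" for n
    using upper_regularD(1)[OF assms, of "real (Suc n)" 0] by (auto simp: top_unique)
  moreover have "(\<Union>n. ball 0 (real (Suc n)) :: 'a set) = UNIV"
  proof -
    have "\<exists>n. norm x < real (Suc n)" for x :: 'a
      using reals_Archimedean2[of "norm x"] by (auto intro!: exI[of _ "nat \<lceil>norm x\<rceil>"]) linarith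
    then show ?thesis by auto
  qed
  ultimately show "\<exists>A. countable A \<and> A \<subseteq> sets M \<and> \<Union> A = space M \<and> (\<forall>a\<in>A. emeasure M a \<noteq> \<infinity>)"
    using upper_regularD(2,3)[OF assms]
    by (intro exI[of _ "range (\<lambda>n. ball 0 (real (Suc n)))"]) auto
qed

lemma nn_integral_kernel_near:
  fixes M :: "'a::euclidean_space measure"
  assumes M: "upper_regular K \<alpha> M" and "0 \<le> K" "0 \<le> b" "b < \<alpha>" "0 < r"
  shows "(\<integral>\<^sup>+x. ennreal (norm (x - y) powr - b) * indicator (ball y r) x \<partial>M)
    \<le> ennreal (K * 2 powr b / (1 - 2 powr (b - \<alpha>)) * r powr (\<alpha> - b))"
proof -
  note [measurable_cong] = upper_regularD(2)[OF M]
  let ?t = "\<lambda>k::nat. ennreal ((r / 2 ^ Suc k) powr - b)"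
  have pt: "ennreal (norm (x - y) powr - b) * indicator (ball y r) x
      \<le> (\<Sum>k. ?t k * indicator (ball y (r / 2 ^ k)) x)" for x
  \<comment> \<open>At the pole the kernel has the HOL value \<open>0 powr - b = 0\<close>, so that
    the shells need not cover it.\<close>
  proof (cases "x = y \<or> r \<le> norm (x - y)")
    case True
    then show ?thesis by (auto simp: dist_norm norm_minus_commute)
  next
    case False
    then obtain k where k: "r / 2 ^ Suc k \<le> norm (x - y)" "norm (x - y) < r / 2 ^ k"
      by (metis ball_shell_inner not_le zero_less_norm_iff right_minus_eq)
    have "norm (x - y) powr - b \<le> (r / 2 ^ Suc k) powr - b"
      using k assms by (intro powr_mono2') auto
    then have "ennreal (norm (x - y) powr - b) * indicator (ball y r) x
        \<le> ?t k * indicator (ball y (r / 2 ^ k)) x"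
      using False k(2) by (auto simp: dist_norm norm_minus_commute intro!: ennreal_leI)
    also have "\<dots> \<le> (\<Sum>k. ?t k * indicator (ball y (r / 2 ^ k)) x)"
      using sum_le_suminf[OF summableI, of "{k}"] by simp
    finally show ?thesis .
  qed
  have "(\<integral>\<^sup>+x. ennreal (norm (x - y) powr - b) * indicator (ball y r) x \<partial>M)
      \<le> (\<integral>\<^sup>+x. (\<Sum>k. ?t k * indicator (ball y (r / 2 ^ k)) x) \<partial>M)"
    by (intro nn_integral_mono pt)
  also have "\<dots> = (\<Sum>k. \<integral>\<^sup>+x. ?t k * indicator (ball y (r / 2 ^ k)) x \<partial>M)"
    by (intro nn_integral_suminf borel_measurable_times_ennreal borel_measurable_const borel_measurable_indicator)
      (simp add: upper_regularD(2)[OF M])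
  also have "\<dots> = (\<Sum>k. ?t k * emeasure M (ball y (r / 2 ^ k)))"
    by (intro suminf_cong nn_integral_cmult_indicator) (simp add: upper_regularD(2)[OF M])
  also have "\<dots> \<le> (\<Sum>k. ennreal (K * 2 powr b * r powr (\<alpha> - b) * (2 powr (b - \<alpha>)) ^ k))"
  proof (intro suminf_le summableI)
    fix k
    have "?t k * emeasure M (ball y (r / 2 ^ k)) \<le> ?t k * ennreal (K * (r / 2 ^ k) powr \<alpha>)"
      using assms by (intro mult_left_mono upper_regularD(1)[OF M]) auto
    also have "\<dots> = ennreal ((r / 2 ^ Suc k) powr - b * (K * (r / 2 ^ k) powr \<alpha>))"
      using assms by (simp add: ennreal_mult)
    also have "(r / 2 ^ Suc k) powr - b * (K * (r / 2 ^ k) powr \<alpha>)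
        = K * 2 powr b * r powr (\<alpha> - b) * (2 powr (b - \<alpha>)) ^ k"
      using powr_dyadic_near[OF \<open>0 < r\<close>, of k b \<alpha>] by (simp add: mult_ac del: power_Suc)
    finally show "?t k * emeasure M (ball y (r / 2 ^ k))
        \<le> ennreal (K * 2 powr b * r powr (\<alpha> - b) * (2 powr (b - \<alpha>)) ^ k)" .
  qed
  also have "\<dots> = ennreal (K * 2 powr b * r powr (\<alpha> - b) / (1 - 2 powr (b - \<alpha>)))"
    using assms powr_less_mono[of _ 0 2] by (intro suminf_ennreal_geometric) auto
  finally show ?thesis by simp
qed

text \<open>Here the shells grow outwards, and the series converges because the kernel decays faster
  than the measure of balls grows.\<close>

lemma nn_integral_kernel_far:
  fixes M :: "'a::euclidean_space measure"
  assumes M: "upper_regular K \<alpha> M" and "0 \<le> K" "0 \<le> \<alpha>" "\<alpha> < b" "0 < r"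
  shows "(\<integral>\<^sup>+x. ennreal (norm (x - y) powr - b) * indicator (- ball y r) x \<partial>M)
    \<le> ennreal (K * 2 powr \<alpha> / (1 - 2 powr (\<alpha> - b)) * r powr (\<alpha> - b))"
proof -
  note [measurable_cong] = upper_regularD(2)[OF M]
  let ?t = "\<lambda>k::nat. ennreal ((r * 2 ^ k) powr - b)"
  have pt: "ennreal (norm (x - y) powr - b) * indicator (- ball y r) x
      \<le> (\<Sum>k. ?t k * indicator (ball y (r * 2 ^ Suc k)) x)" for x
  proof (cases "norm (x - y) < r")
    case True
    then show ?thesis by (auto simp: dist_norm norm_minus_commute)
  next
    case False
    then obtain k where k: "r * 2 ^ k \<le> norm (x - y)" "norm (x - y) < r * 2 ^ Suc k"
      using ball_shell_outer[of r x y] assms by auto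
    have "norm (x - y) powr - b \<le> (r * 2 ^ k) powr - b"
      using k assms by (intro powr_mono2') auto
    then have "ennreal (norm (x - y) powr - b) * indicator (- ball y r) x
        \<le> ?t k * indicator (ball y (r * 2 ^ Suc k)) x"
      using False k(2) by (auto simp: dist_norm norm_minus_commute intro!: ennreal_leI)
    also have "\<dots> \<le> (\<Sum>k. ?t k * indicator (ball y (r * 2 ^ Suc k)) x)"
      using sum_le_suminf[OF summableI, of "{k}"] by simp
    finally show ?thesis .
  qed
  have "(\<integral>\<^sup>+x. ennreal (norm (x - y) powr - b) * indicator (- ball y r) x \<partial>M)
      \<le> (\<integral>\<^sup>+x. (\<Sum>k. ?t k * indicator (ball y (r * 2 ^ Suc k)) x) \<partial>M)"
    by (intro nn_integral_mono pt)
  also have "\<dots> = (\<Sum>k. \<integral>\<^sup>+x. ?t k * indicator (ball y (r * 2 ^ Suc k)) x \<partial>M)"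
    by (intro nn_integral_suminf borel_measurable_times_ennreal borel_measurable_const borel_measurable_indicator)
      (simp add: upper_regularD(2)[OF M])
  also have "\<dots> = (\<Sum>k. ?t k * emeasure M (ball y (r * 2 ^ Suc k)))"
    by (intro suminf_cong nn_integral_cmult_indicator) (simp add: upper_regularD(2)[OF M])
  also have "\<dots> \<le> (\<Sum>k. ennreal (K * 2 powr \<alpha> * r powr (\<alpha> - b) * (2 powr (\<alpha> - b)) ^ k))"
  proof (intro suminf_le summableI)
    fix k
    have "?t k * emeasure M (ball y (r * 2 ^ Suc k)) \<le> ?t k * ennreal (K * (r * 2 ^ Suc k) powr \<alpha>)"
      using assms by (intro mult_left_mono upper_regularD(1)[OF M]) auto
    also have "\<dots> = ennreal ((r * 2 ^ k) powr - b * (K * (r * 2 ^ Suc k) powr \<alpha>))"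
      using assms by (simp add: ennreal_mult)
    also have "(r * 2 ^ k) powr - b * (K * (r * 2 ^ Suc k) powr \<alpha>)
        = K * 2 powr \<alpha> * r powr (\<alpha> - b) * (2 powr (\<alpha> - b)) ^ k"
      using powr_dyadic_far[OF \<open>0 < r\<close>, of k b \<alpha>] by (simp add: mult_ac del: power_Suc)
    finally show "?t k * emeasure M (ball y (r * 2 ^ Suc k))
        \<le> ennreal (K * 2 powr \<alpha> * r powr (\<alpha> - b) * (2 powr (\<alpha> - b)) ^ k)" .
  qed
  also have "\<dots> = ennreal (K * 2 powr \<alpha> * r powr (\<alpha> - b) / (1 - 2 powr (\<alpha> - b)))"
    using assms powr_less_mono[of _ 0 2] by (intro suminf_ennreal_geometric) auto
  finally show ?thesis by simp
qed

lemma upper_regular_lborel: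
  "upper_regular (unit_ball_vol (real DIM('a))) (real DIM('a)) (lborel :: 'a::euclidean_space measure)"
  by (simp add: upper_regular_def emeasure_ball powr_realpow)

text \<open>
  Integrate the kernel over \<open>E\<close>, exchange the integrals, and split the inner one at the radius \<open>r\<close>
  for which \<open>r powr \<alpha>\<close> is the measure of \<open>E\<close>, where the near and the far part balance.
\<close>

lemma kernel_weak_type:
  fixes M N :: "'a::euclidean_space measure"
  assumes M: "upper_regular K \<alpha> M" and "0 \<le> K" "0 < d" "d < \<alpha>"
    and N: "sets N = sets borel" "emeasure N UNIV \<le> ennreal \<nu>" "0 \<le> \<nu>"
    and E: "E \<in> sets borel" "emeasure M E < \<infinity>" and "0 < t"
    and le: "\<And>x. x \<in> E \<Longrightarrow> ennreal t \<le> (\<integral>\<^sup>+y. ennreal (norm (x - y) powr - d) \<partial>N)"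
  shows "emeasure M E \<le> ennreal (((K * 2 powr d / (1 - 2 powr (d - \<alpha>)) + 1) * \<nu> / t) powr (\<alpha> / d))"
proof -
  note sM [measurable_cong] = upper_regularD(2)[OF M]
  note N(1) [measurable_cong]
  have spN: "space N = UNIV" using sets_eq_imp_space_eq[OF N(1)] by simp
  have EM [measurable]: "E \<in> sets M" "E \<in> sets borel" using E sM by auto
  have bM: "ball y r \<in> sets M" for y r unfolding sM by (rule borel_open) simp
  interpret M: sigma_finite_measure M by (rule upper_regular_sigma_finite[OF M])
  interpret N: finite_measure N
    using N spN by (intro finite_measureI) (auto simp: top_unique)
  interpret P: pair_sigma_finite M N ..
  \<comment> \<open>This is the constant of the part near \<open>y\<close>. The \<open>1\<close>
    added to it below stands for the rest of \<open>E\<close>: there the kernel is at most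
    \<open>r powr - d\<close>, and \<open>E\<close> has measure
    \<open>r powr \<alpha>\<close>.\<close>
  define C where "C = K * 2 powr d / (1 - 2 powr (d - \<alpha>))"
  have "2 powr (d - \<alpha>) < 1" using powr_less_mono[of "d - \<alpha>" 0 2] assms by simp
  then have C: "0 \<le> C" unfolding C_def using assms by (intro divide_nonneg_pos mult_nonneg_nonneg) auto
  define m where "m = measure M E"
  have m: "emeasure M E = ennreal m" "0 \<le> m"
    using E by (auto simp: m_def emeasure_eq_ennreal_measure)
  show ?thesis
  proof (cases "m = 0")
    case True
    then show ?thesis using m by simp
  next
    case False
    then have m0: "0 < m" using m by simp
    define r where "r = m powr (1 / \<alpha>)"
    have r: "0 < r" using m0 by (simp add: r_def)
    have rm: "r powr \<alpha> = m" using assms m0 by (simp add: r_def powr_powr)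
    let ?k = "\<lambda>x y. ennreal (norm (x - y) powr - d)"
    have inner: "(\<integral>\<^sup>+x. ?k x y * indicator E x \<partial>M) \<le> ennreal ((C + 1) * r powr (\<alpha> - d))" for y
    proof -
      have "?k x y * indicator E x
          \<le> ?k x y * indicator (ball y r) x + ennreal (r powr - d) * indicator E x" for x
      proof (cases "norm (x - y) < r")
        case True
        then show ?thesis by (auto simp: dist_norm norm_minus_commute indicator_def)
      next
        case False
        then have "?k x y \<le> ennreal (r powr - d)"
          using r assms by (intro ennreal_leI powr_mono2') auto
        then show ?thesis by (auto simp: indicator_def intro: add_increasing)
      qed
      then have "(\<integral>\<^sup>+x. ?k x y * indicator E x \<partial>M)
          \<le> (\<integral>\<^sup>+x. ?k x y * indicator (ball y r) x + ennreal (r powr - d) * indicator E x \<partial>M)"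
        by (intro nn_integral_mono)
      also have "\<dots> = (\<integral>\<^sup>+x. ?k x y * indicator (ball y r) x \<partial>M)
          + (\<integral>\<^sup>+x. ennreal (r powr - d) * indicator E x \<partial>M)"
        by (intro nn_integral_add borel_measurable_times_ennreal borel_measurable_const
            borel_measurable_indicator bM EM) measurable
      also have "(\<integral>\<^sup>+x. ennreal (r powr - d) * indicator E x \<partial>M) = ennreal (r powr - d) * emeasure M E"
        by (rule nn_integral_cmult_indicator) measurable
      also have "\<dots> = ennreal (r powr (\<alpha> - d))"
        unfolding m(1) using r m by (simp add: rm[symmetric] ennreal_mult[symmetric] powr_add[symmetric])
      also have "(\<integral>\<^sup>+x. ?k x y * indicator (ball y r) x \<partial>M) \<le> ennreal (C * r powr (\<alpha> - d))"
        unfolding C_def using assms r by (intro nn_integral_kernel_near) auto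
      finally show ?thesis
        using C by (simp add: ennreal_plus[symmetric] algebra_simps add_right_mono del: ennreal_plus)
    qed
    have "ennreal (t * m) = (\<integral>\<^sup>+x. ennreal t * indicator E x \<partial>M)"
      using assms m by (simp add: nn_integral_cmult_indicator ennreal_mult)
    also have "\<dots> \<le> (\<integral>\<^sup>+x. (\<integral>\<^sup>+y. ?k x y * indicator E x \<partial>N) \<partial>M)"
      by (intro nn_integral_mono) (auto simp: indicator_def le)
    also have "\<dots> = (\<integral>\<^sup>+y. (\<integral>\<^sup>+x. ?k x y * indicator E x \<partial>M) \<partial>N)"
      by (rule P.Fubini'[symmetric]) measurable
    also have "\<dots> \<le> (\<integral>\<^sup>+y. ennreal ((C + 1) * r powr (\<alpha> - d)) \<partial>N)"
      by (intro nn_integral_mono inner)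
    also have "\<dots> = ennreal ((C + 1) * r powr (\<alpha> - d)) * emeasure N UNIV"
      by (simp add: spN)
    also have "\<dots> \<le> ennreal ((C + 1) * r powr (\<alpha> - d)) * ennreal \<nu>"
      by (intro mult_left_mono N) auto
    also have "\<dots> = ennreal ((C + 1) * r powr (\<alpha> - d) * \<nu>)"
      using C N by (simp add: ennreal_mult)
    finally have "t * m \<le> (C + 1) * r powr (\<alpha> - d) * \<nu>"
      using C N by (subst (asm) ennreal_le_iff) auto
    \<comment> \<open>Both sides now contain the factor \<open>m\<close>. What is left after
      cancelling it bounds \<open>r powr d\<close>, that is, \<open>m\<close> to the power
      \<open>d / \<alpha>\<close>.\<close>
    also have "r powr (\<alpha> - d) = m / r powr d" using rm by (simp add: powr_diff)
    finally have "t * m * r powr d \<le> (C + 1) * m * \<nu>" using r by (simp add: field_simps)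
    then have "m * (t * r powr d) \<le> m * ((C + 1) * \<nu>)" by (simp add: mult_ac)
    then have "t * r powr d \<le> (C + 1) * \<nu>" using m0 by (rule mult_left_le_imp_le)
    then have "r powr d \<le> (C + 1) * \<nu> / t" using \<open>0 < t\<close> by (simp add: pos_le_divide_eq mult.commute)
    then have "(r powr d) powr (\<alpha> / d) \<le> ((C + 1) * \<nu> / t) powr (\<alpha> / d)"
      using assms by (intro powr_mono2) auto
    then have "m \<le> ((C + 1) * \<nu> / t) powr (\<alpha> / d)"
      using assms by (simp add: powr_powr rm)
    then show ?thesis unfolding m(1) C_def by (rule ennreal_leI)
  qed
qed

section \<open>Truncated data and distribution functions\<close>

lemma nn_integral_powr_Ioo:
  assumes "0 < e" "0 \<le> c"
  shows "(\<integral>\<^sup>+t. ennreal (t powr (e - 1)) * indicator {0<..<c} t \<partial>lborel) = ennreal (c powr e / e)"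
proof -
  have "((\<lambda>x. x powr (e - 1)) has_integral (c powr (e - 1 + 1) / (e - 1 + 1))) {0..c}"
    using assms by (intro has_integral_powr_from_0) auto
  then have "(\<integral>\<^sup>+t. ennreal (t powr (e - 1)) * indicator {0..c} t \<partial>lborel) = ennreal (c powr e / e)"
    by (intro nn_integral_has_integral_lebesgue') auto
  moreover have "(\<integral>\<^sup>+t. ennreal (t powr (e - 1)) * indicator {0<..<c} t \<partial>lborel)
      = (\<integral>\<^sup>+t. ennreal (t powr (e - 1)) * indicator {0..c} t \<partial>lborel)"
  proof (rule nn_integral_cong_AE)
    have "AE t in lborel. t \<noteq> 0 \<and> t \<noteq> c" using AE_lborel_singleton[of 0] AE_lborel_singleton[of c] by auto
    then show "AE t in lborel. ennreal (t powr (e - 1)) * indicator {0<..<c} t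
        = ennreal (t powr (e - 1)) * indicator {0..c} t"
      by eventually_elim (auto simp: indicator_def)
  qed
  ultimately show ?thesis by simp
qed

text \<open>The total mass of the measure with density \<open>w\<close> restricted to
  \<open>w > l\<close>. This measure is the one to which the weak type bound is applied, and its
  mass is what enters there.\<close>

definition excess :: "'a measure \<Rightarrow> ('a \<Rightarrow> real) \<Rightarrow> real \<Rightarrow> ennreal" where
  "excess H w l = (\<integral>\<^sup>+y. ennreal (w y) * indicator {y. l < w y} y \<partial>H)"

text \<open>Chebyshev's argument: since \<open>1 < s\<close>, the factor
  \<open>w powr (1 - s)\<close> in \<open>w = w powr (1 - s) * w powr s\<close> is at most
  \<open>l powr (1 - s)\<close> where \<open>w > l\<close>.\<close>

lemma excess_le:
  assumes [measurable]: "w \<in> borel_measurable H" and "1 < s" "0 < l"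
    and le1: "(\<integral>\<^sup>+y. ennreal (w y powr s) \<partial>H) \<le> 1"
  shows "excess H w l \<le> ennreal (l powr (1 - s))"
proof -
  have "excess H w l \<le> (\<integral>\<^sup>+y. ennreal (l powr (1 - s)) * ennreal (w y powr s) \<partial>H)"
    unfolding excess_def
  proof (intro nn_integral_mono)
    fix y
    have "w y \<le> l powr (1 - s) * w y powr s" if "l < w y"
    proof -
      have "w y = w y powr (1 - s) * w y powr s" using that assms by (simp add: powr_add[symmetric])
      also have "\<dots> \<le> l powr (1 - s) * w y powr s"
        using that assms by (intro mult_right_mono powr_mono2') auto
      finally show ?thesis .
    qed
    then show "ennreal (w y) * indicator {y. l < w y} y \<le> ennreal (l powr (1 - s)) * ennreal (w y powr s)"
      by (auto simp: indicator_def ennreal_mult[symmetric] intro!: ennreal_leI)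
  qed
  also have "\<dots> = ennreal (l powr (1 - s)) * (\<integral>\<^sup>+y. ennreal (w y powr s) \<partial>H)"
    by (rule nn_integral_cmult) measurable
  also have "\<dots> \<le> ennreal (l powr (1 - s)) * 1"
    by (intro mult_left_mono le1) auto
  finally show ?thesis by simp
qed

text \<open>
  The exponent \<open>q\<close> is such that, after bounding all but one factor of the power \<open>\<beta>\<close> by \<open>excess_le\<close>,
  Tonelli's theorem produces exactly the integral of \<open>w powr s\<close>. The measure \<open>H\<close> need not be
  \<open>\<sigma>\<close>-finite, as is the case for the Hausdorff measure on a boundary; the proof therefore works with
  the finite measure of density \<open>w powr s\<close>.
\<close>

lemma excess_integral_le:
  fixes w :: "'a \<Rightarrow> real"
  assumes w [measurable]: "w \<in> borel_measurable H" and w0: "\<And>y. 0 \<le> w y"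
    and le1: "(\<integral>\<^sup>+y. ennreal (w y powr s) \<partial>H) \<le> 1"
    and s: "1 < s" and \<beta>: "1 \<le> \<beta>" and \<kappa>: "0 < \<kappa>" and a: "0 < a" and q: "q = \<beta> + a * \<beta> * (s - 1)"
  shows "(\<integral>\<^sup>+t. ennreal (t powr (q - 1 - \<beta>) * enn2real (excess H w (\<kappa> * t powr a)) powr \<beta>)
      * indicator {0<..} t \<partial>lborel) \<le> ennreal (\<kappa> powr ((1 - s) * \<beta>) / (a * (s - 1)))" (is "?I \<le> _")
    and "(\<lambda>t. excess H w (\<kappa> * t powr a)) \<in> borel_measurable borel"
proof -
  define N where "N = density H (\<lambda>y. ennreal (w y powr s))"
  interpret N: finite_measure N
    by (rule finite_measureI) (use le1 in \<open>auto simp: N_def emeasure_density top_unique cong: nn_integral_cong\<close>)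
  have N1: "emeasure N (space N) \<le> 1"
    using le1 by (auto simp: N_def emeasure_density cong: nn_integral_cong)
  have [measurable]: "w \<in> borel_measurable N" by (simp add: N_def)
  interpret P: pair_sigma_finite lborel N ..
  \<comment> \<open>Where \<open>w > l \<ge> 0\<close> the function \<open>w\<close> is positive and
    factors as \<open>w powr (1 - s)\<close> times the density of \<open>N\<close>.\<close>
  have exc: "excess H w l = (\<integral>\<^sup>+y. ennreal (w y powr (1 - s)) * indicator {y. l < w y} y \<partial>N)"
    if "0 \<le> l" for l
    unfolding N_def excess_def
    by (subst nn_integral_density)
      (use w0 that in \<open>auto simp: ennreal_mult[symmetric] powr_add[symmetric] indicator_def
        intro!: nn_integral_cong\<close>)
  have exc': "excess H w (\<kappa> * t powr a)
      = (\<integral>\<^sup>+y. ennreal (w y powr (1 - s)) * indicator {y. \<kappa> * t powr a < w y} y \<partial>N)" for t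
    using \<kappa> by (intro exc) auto
  show meas [measurable]: "(\<lambda>t. excess H w (\<kappa> * t powr a)) \<in> borel_measurable borel"
    unfolding exc' indicator_def by measurable
  have pt: "ennreal (t powr (q - 1 - \<beta>) * enn2real (excess H w (\<kappa> * t powr a)) powr \<beta>)
      \<le> ennreal (\<kappa> powr ((1 - s) * (\<beta> - 1))) * (ennreal (t powr (a * (s - 1) - 1)) * excess H w (\<kappa> * t powr a))"
    if t: "0 < t" for t
  proof -
    let ?l = "\<kappa> * t powr a"
    have l: "0 < ?l" using t \<kappa> by simp
    have fin: "excess H w ?l \<le> ennreal (?l powr (1 - s))" by (rule excess_le[OF w s l le1])
    define x where "x = enn2real (excess H w ?l)"
    have x: "excess H w ?l = ennreal x" "0 \<le> x"
      using le_less_trans[OF fin ennreal_less_top] by (auto simp: x_def)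
    have xl: "x \<le> ?l powr (1 - s)" using fin x by (simp add: ennreal_le_iff)
    have "x powr \<beta> = x * x powr (\<beta> - 1)" using x(2) by (cases "x = 0") (auto simp: powr_diff)
    also have "\<dots> \<le> x * (?l powr (1 - s)) powr (\<beta> - 1)"
      using x xl \<beta> by (intro mult_left_mono powr_mono2) auto
    also have "(?l powr (1 - s)) powr (\<beta> - 1)
        = \<kappa> powr ((1 - s) * (\<beta> - 1)) * t powr (a * (1 - s) * (\<beta> - 1))"
      using \<kappa> t by (simp add: powr_powr powr_mult mult_ac)
    finally have "t powr (q - 1 - \<beta>) * x powr \<beta>
        \<le> t powr (q - 1 - \<beta>) * (x * (\<kappa> powr ((1 - s) * (\<beta> - 1)) * t powr (a * (1 - s) * (\<beta> - 1))))"
      by (intro mult_left_mono) auto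
    also have "\<dots> = \<kappa> powr ((1 - s) * (\<beta> - 1)) * (t powr (q - 1 - \<beta> + a * (1 - s) * (\<beta> - 1)) * x)"
      by (simp add: powr_add)
    \<comment> \<open>By the choice of \<open>q\<close>, the exponent of \<open>t\<close> no longer
      depends on \<beta>.\<close>
    also have "q - 1 - \<beta> + a * (1 - s) * (\<beta> - 1) = a * (s - 1) - 1"
      unfolding q by (simp add: algebra_simps)
    finally have "ennreal (t powr (q - 1 - \<beta>) * x powr \<beta>)
        \<le> ennreal (\<kappa> powr ((1 - s) * (\<beta> - 1)) * (t powr (a * (s - 1) - 1) * x))"
      by (rule ennreal_leI)
    also have "\<dots> = ennreal (\<kappa> powr ((1 - s) * (\<beta> - 1))) * (ennreal (t powr (a * (s - 1) - 1)) * ennreal x)"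
      using x by (simp add: ennreal_mult)
    finally show ?thesis by (simp only: x(1)[symmetric] flip: x_def)
  qed
  have "?I \<le> (\<integral>\<^sup>+t. ennreal (\<kappa> powr ((1 - s) * (\<beta> - 1))) *
      (ennreal (t powr (a * (s - 1) - 1)) * indicator {0<..} t * excess H w (\<kappa> * t powr a)) \<partial>lborel)"
    by (intro nn_integral_mono) (use pt in \<open>auto simp: indicator_def\<close>)
  also have "\<dots> = ennreal (\<kappa> powr ((1 - s) * (\<beta> - 1))) *
      (\<integral>\<^sup>+t. ennreal (t powr (a * (s - 1) - 1)) * indicator {0<..} t * excess H w (\<kappa> * t powr a) \<partial>lborel)"
    by (rule nn_integral_cmult) measurable
  also have "(\<integral>\<^sup>+t. ennreal (t powr (a * (s - 1) - 1)) * indicator {0<..} t * excess H w (\<kappa> * t powr a) \<partial>lborel)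
      = (\<integral>\<^sup>+t. (\<integral>\<^sup>+y. ennreal (t powr (a * (s - 1) - 1)) * indicator {0<..} t *
          (ennreal (w y powr (1 - s)) * indicator {y. \<kappa> * t powr a < w y} y) \<partial>N) \<partial>lborel)"
    unfolding exc' by (intro nn_integral_cong nn_integral_cmult[symmetric]) measurable
  also have "\<dots> = (\<integral>\<^sup>+y. (\<integral>\<^sup>+t. ennreal (t powr (a * (s - 1) - 1)) * indicator {0<..} t *
          (ennreal (w y powr (1 - s)) * indicator {y. \<kappa> * t powr a < w y} y) \<partial>lborel) \<partial>N)"
    unfolding indicator_def by (rule P.Fubini'[symmetric]) measurable
  also have "\<dots> \<le> (\<integral>\<^sup>+y. ennreal (\<kappa> powr (1 - s) / (a * (s - 1))) \<partial>N)"
  proof (intro nn_integral_mono)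
    fix y
    \<comment> \<open>The time at which the level \<open>\<kappa> * t powr a\<close> reaches
      \<open>w y\<close>. Integrating the power of \<open>t\<close> up to it yields a multiple of
      \<open>(w y / \<kappa>) powr (s - 1)\<close>, which cancels
      \<open>w y powr (1 - s)\<close>.\<close>
    let ?c = "(w y / \<kappa>) powr (1 / a)"
    have iff: "0 < t \<and> \<kappa> * t powr a < w y \<longrightarrow> t \<in> {0<..<?c}" for t
    proof safe
      assume t: "0 < t" "\<kappa> * t powr a < w y"
      then have "t powr a < w y / \<kappa>" using \<kappa> by (simp add: field_simps)
      then have "(t powr a) powr (1 / a) < ?c" using a t by (intro powr_less_mono2) auto
      then show "t \<in> {0<..<?c}" using t a by (simp add: powr_powr)
    qed
    have "(\<integral>\<^sup>+t. ennreal (t powr (a * (s - 1) - 1)) * indicator {0<..} t *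
          (ennreal (w y powr (1 - s)) * indicator {y. \<kappa> * t powr a < w y} y) \<partial>lborel)
        \<le> (\<integral>\<^sup>+t. ennreal (w y powr (1 - s)) * (ennreal (t powr (a * (s - 1) - 1)) * indicator {0<..<?c} t) \<partial>lborel)"
      by (intro nn_integral_mono) (use iff in \<open>auto simp: indicator_def mult_ac\<close>)
    also have "\<dots> = ennreal (w y powr (1 - s)) * (\<integral>\<^sup>+t. ennreal (t powr (a * (s - 1) - 1)) * indicator {0<..<?c} t \<partial>lborel)"
      by (rule nn_integral_cmult) measurable
    also have "\<dots> = ennreal (w y powr (1 - s)) * ennreal (?c powr (a * (s - 1)) / (a * (s - 1)))"
      using a s by (subst nn_integral_powr_Ioo) auto
    also have "\<dots> \<le> ennreal (\<kappa> powr (1 - s) / (a * (s - 1)))"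
    proof (cases "w y = 0")
      case False
      then have "w y powr (1 - s) * (?c powr (a * (s - 1)) / (a * (s - 1))) = \<kappa> powr (1 - s) / (a * (s - 1))"
        using w0[of y] \<kappa> a s by (simp add: powr_powr powr_divide powr_diff powr_minus field_simps)
      then show ?thesis using a s by (simp add: ennreal_mult[symmetric])
    qed simp
    finally show "(\<integral>\<^sup>+t. ennreal (t powr (a * (s - 1) - 1)) * indicator {0<..} t *
          (ennreal (w y powr (1 - s)) * indicator {y. \<kappa> * t powr a < w y} y) \<partial>lborel)
        \<le> ennreal (\<kappa> powr (1 - s) / (a * (s - 1)))" .
  qed
  also have "\<dots> \<le> ennreal (\<kappa> powr (1 - s) / (a * (s - 1))) * 1"
    unfolding nn_integral_const by (intro mult_left_mono N1) auto
  also have "ennreal (\<kappa> powr ((1 - s) * (\<beta> - 1))) * (ennreal (\<kappa> powr (1 - s) / (a * (s - 1))) * 1)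
      = ennreal (\<kappa> powr ((1 - s) * \<beta>) / (a * (s - 1)))"
    using a s \<kappa> by (simp add: ennreal_mult[symmetric] powr_add[symmetric] algebra_simps)
  finally show "?I \<le> ennreal (\<kappa> powr ((1 - s) * \<beta>) / (a * (s - 1)))"
    by (simp add: mult_left_mono)
qed

text \<open>Within distance \<open>R\<close> of \<open>x\<close> the truncation contributes a
  multiple of \<open>l * R\<close>. Beyond it, Young's inequality and the unit bound on the p-th
  power of \<open>f\<close> give a multiple of \<open>R powr (1 - n / p)\<close>; the conjugate
  power of the kernel is integrable there because \<open>p < n\<close> means
  \<open>n < d * p'\<close>. With \<open>R = l powr (- p / n)\<close> both are multiples of
  \<open>l powr (1 - p / n)\<close>.\<close>

lemma nn_integral_kernel_low:
  assumes p: "1 < p" "p < real DIM('a::euclidean_space)"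
  obtains C where "0 < C" and
    "\<And>(f :: 'a \<Rightarrow> real) l x. f \<in> borel_measurable borel \<Longrightarrow> (\<And>y. 0 \<le> f y) \<Longrightarrow>
      (\<integral>\<^sup>+y. ennreal (f y powr p) \<partial>lborel) \<le> 1 \<Longrightarrow> 0 < l \<Longrightarrow>
      (\<integral>\<^sup>+y. ennreal (min (f y) l) * ennreal (norm (y - x) powr - (real DIM('a) - 1)) \<partial>lborel)
        \<le> ennreal (C * l powr (1 - p / real DIM('a)))"
proof -
  define n where "n = real DIM('a)"
  define d where "d = n - 1"
  define V where "V = unit_ball_vol n"
  define p' where "p' = p / (p - 1)"
  have V: "0 \<le> V" by (simp add: V_def n_def)
  have n: "1 < n" "p < n" using p by (auto simp: n_def)
  have d: "0 < d" "d < n" using n by (auto simp: d_def)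
  have dp: "n < d * p'" using p n unfolding p'_def d_def by (simp add: field_simps)
  have p': "1 < p'" "1 / p + 1 / p' = 1" using p by (auto simp: p'_def field_simps)
  have reg: "upper_regular V n (lborel :: 'a measure)"
    unfolding V_def n_def by (rule upper_regular_lborel)
  define C1 where "C1 = V * 2 powr d / (1 - 2 powr (d - n))"
  define C2 where "C2 = V * 2 powr n / (1 - 2 powr (n - d * p'))"
  have "2 powr (d - n) < 1" "2 powr (n - d * p') < 1"
    using powr_less_mono[of _ 0 2] d dp by auto
  then have C: "0 \<le> C1" "0 \<le> C2" unfolding C1_def C2_def using V by auto
  show thesis
  proof
    show "0 < C1 + 1 + C2" using C by simp
    fix f :: "'a \<Rightarrow> real" and l :: real and x :: 'a
    assume f [measurable]: "f \<in> borel_measurable borel" and f0: "\<And>y. 0 \<le> f y"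
      and le1: "(\<integral>\<^sup>+y. ennreal (f y powr p) \<partial>lborel) \<le> 1" and l: "0 < l"
    define R where "R = l powr (- p / n)"
    have R: "0 < R" using l by (simp add: R_def)
    have lR: "l * R powr (n - d) = l powr (1 - p / n)"
      using powr_add[of l 1 "- p / n"] l n by (simp add: R_def powr_powr d_def)
    have lR2: "R powr (1 - n / p) = l powr (1 - p / n)"
    proof -
      have "- p / n * (1 - n / p) = 1 - p / n" using n p by (simp add: field_simps)
      then show ?thesis using l by (simp add: R_def powr_powr)
    qed
    let ?k = "\<lambda>b y. ennreal (norm (y - x) powr - b)"
    have pt: "ennreal (min (f y) l) * ?k d y
        \<le> ennreal l * (?k d y * indicator (ball x R) y) + (ennreal (R powr (1 - n / p)) * ennreal (f y powr p)
          + ennreal (R powr (1 - n / p) * R powr (d * p' - n)) * (?k (d * p') y * indicator (- ball x R) y))" for y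
    proof (cases "norm (y - x) < R")
      case True
      then have "ennreal (min (f y) l) * ?k d y \<le> ennreal l * (?k d y * indicator (ball x R) y)"
        by (auto simp: dist_norm norm_minus_commute intro!: mult_right_mono ennreal_leI)
      then show ?thesis by (simp add: add_increasing2)
    next
      case False
      define k where "k = norm (y - x) powr - d"
      have k: "0 \<le> k" by (simp add: k_def)
      have kp: "k powr p' = norm (y - x) powr - (d * p')" by (simp add: k_def powr_powr)
      \<comment> \<open>The weight in Young's inequality: it makes the integral of
        \<open>(k * ?g) powr p'\<close> outside the ball bounded independently of \<open>R\<close>.
        Its reciprocal is \<open>R powr (1 - n / p)\<close>.\<close>
      let ?g = "R powr ((d * p' - n) / p')"
      have "f y * (k * ?g) \<le> f y powr p / p + (k * ?g) powr p' / p'"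
        using f0 k p p' by (intro Youngs_inequality) auto
      also have "\<dots> \<le> f y powr p + (k * ?g) powr p'"
        using p p' by (intro add_mono) (auto simp: divide_le_eq mult_le_cancel_left1)
      also have "(k * ?g) powr p' = norm (y - x) powr - (d * p') * R powr (d * p' - n)"
        using k p' by (simp add: powr_mult powr_powr kp)
      finally have "R powr (1 - n / p) * (f y * (k * ?g))
          \<le> R powr (1 - n / p) * (f y powr p + norm (y - x) powr - (d * p') * R powr (d * p' - n))"
        by (intro mult_left_mono) auto
      moreover have "(d * p' - n) / p' = - (1 - n / p)"
      proof -
        have "(d * p' - n) / p' = d - n * (1 / p')" using p' by (simp add: field_simps)
        also have "1 / p' = 1 - 1 / p" using p' by simp
        finally show ?thesis by (simp add: d_def algebra_simps)
      qed
      then have "R powr (1 - n / p) * ?g = 1" using R by (simp add: powr_add[symmetric])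
      then have "R powr (1 - n / p) * (f y * (k * ?g)) = f y * k" by (simp add: mult_ac)
      moreover have "min (f y) l * k \<le> f y * k" using k by (intro mult_right_mono) auto
      ultimately have "min (f y) l * k
          \<le> R powr (1 - n / p) * (f y powr p + norm (y - x) powr - (d * p') * R powr (d * p' - n))"
        by linarith
      then have "ennreal (min (f y) l * k) \<le> ennreal (R powr (1 - n / p) * f y powr p
          + R powr (1 - n / p) * R powr (d * p' - n) * norm (y - x) powr - (d * p'))"
        by (intro ennreal_leI) (simp add: algebra_simps)
      also have "\<dots> = ennreal (R powr (1 - n / p)) * ennreal (f y powr p)
          + ennreal (R powr (1 - n / p) * R powr (d * p' - n)) * ?k (d * p') y"
        by (simp add: ennreal_plus ennreal_mult)
      also have "ennreal (min (f y) l * k) = ennreal (min (f y) l) * ?k d y"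
        using f0 l by (simp add: k_def ennreal_mult less_imp_le)
      finally show ?thesis
        using False by (simp add: dist_norm norm_minus_commute)
    qed
    have "(\<integral>\<^sup>+y. ennreal (min (f y) l) * ?k d y \<partial>lborel)
      \<le> (\<integral>\<^sup>+y. ennreal l * (?k d y * indicator (ball x R) y) + (ennreal (R powr (1 - n / p)) * ennreal (f y powr p)
          + ennreal (R powr (1 - n / p) * R powr (d * p' - n)) * (?k (d * p') y * indicator (- ball x R) y)) \<partial>lborel)"
      by (intro nn_integral_mono pt)
    also have "\<dots> = ennreal l * (\<integral>\<^sup>+y. ?k d y * indicator (ball x R) y \<partial>lborel)
        + (ennreal (R powr (1 - n / p)) * (\<integral>\<^sup>+y. ennreal (f y powr p) \<partial>lborel)
        + ennreal (R powr (1 - n / p) * R powr (d * p' - n)) * (\<integral>\<^sup>+y. ?k (d * p') y * indicator (- ball x R) y \<partial>lborel))"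
    proof -
      have [measurable]: "ball x R \<in> sets borel" "- ball x R \<in> sets borel" by auto
      have m1: "(\<lambda>y. ?k d y * indicator (ball x R) y) \<in> borel_measurable lborel"
        by (intro borel_measurable_times_ennreal borel_measurable_indicator) auto
      have m2: "(\<lambda>y. ?k (d * p') y * indicator (- ball x R) y) \<in> borel_measurable lborel"
        by (intro borel_measurable_times_ennreal borel_measurable_indicator) auto
      show ?thesis
        using m1 m2 by (simp add: nn_integral_add nn_integral_cmult)
    qed
    also have "\<dots> \<le> ennreal l * ennreal (C1 * R powr (n - d))
        + (ennreal (R powr (1 - n / p)) * 1
        + ennreal (R powr (1 - n / p) * R powr (d * p' - n)) * ennreal (C2 * R powr (n - d * p')))"
      unfolding C1_def C2_def
      by (intro add_mono mult_left_mono nn_integral_kernel_near nn_integral_kernel_far reg le1)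
        (use V d dp n R in auto)
    also have "\<dots> = ennreal ((C1 + 1 + C2) * l powr (1 - p / n))"
    proof -
      have "R powr (1 - n / p) * R powr (d * p' - n) * (C2 * R powr (n - d * p')) = C2 * l powr (1 - p / n)"
        using R by (simp add: powr_add[symmetric] mult_ac flip: lR2)
      then have "ennreal (R powr (1 - n / p) * R powr (d * p' - n)) * ennreal (C2 * R powr (n - d * p'))
          = ennreal (C2 * l powr (1 - p / n))"
        using C by (subst ennreal_mult[symmetric]) auto
      moreover have "l * (C1 * R powr (n - d)) = C1 * l powr (1 - p / n)" using lR by (simp add: mult_ac)
      then have "ennreal l * ennreal (C1 * R powr (n - d)) = ennreal (C1 * l powr (1 - p / n))"
        using C l by (subst ennreal_mult[symmetric]) auto
      ultimately show ?thesis
        using C by (simp add: ennreal_plus[symmetric] lR2 distrib_right del: ennreal_plus)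
    qed
    finally show "(\<integral>\<^sup>+y. ennreal (min (f y) l) * ennreal (norm (y - x) powr - (real DIM('a) - 1)) \<partial>lborel)
        \<le> ennreal ((C1 + 1 + C2) * l powr (1 - p / real DIM('a)))"
      by (simp add: d_def n_def)
  qed
qed


text \<open>Absorbing the truncated datum into a measure \<open>N\<close>, finite by
  \<open>excess_le\<close>, makes the potential a Borel function of \<open>x\<close> and brings
  \<open>kernel_weak_type\<close> to bear. The set \<open>S\<close> guarantees in advance that the
  level set has finite measure, as that lemma requires.\<close>

lemma emeasure_level_le:
  fixes M N :: "'a::euclidean_space measure"
  assumes M: "upper_regular K \<alpha> M" and "0 \<le> K" "0 < d" "d < \<alpha>"
    and H: "sets H = sets borel" and w [measurable]: "w \<in> borel_measurable borel"
    and "1 < s" "0 < l" and le1: "(\<integral>\<^sup>+y. ennreal (w y powr s) \<partial>H) \<le> 1"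
    and S: "S \<in> sets borel" "emeasure M S < \<infinity>" and "0 < t"
  shows "emeasure M {x \<in> S. ennreal t \<le>
      (\<integral>\<^sup>+y. ennreal (w y) * indicator {y. l < w y} y * ennreal (norm (x - y) powr - d) \<partial>H)}
    \<le> ennreal (((K * 2 powr d / (1 - 2 powr (d - \<alpha>)) + 1) * enn2real (excess H w l) / t) powr (\<alpha> / d))"
    (is "emeasure M ?E \<le> _")
    and "{x \<in> S. ennreal t \<le>
      (\<integral>\<^sup>+y. ennreal (w y) * indicator {y. l < w y} y * ennreal (norm (x - y) powr - d) \<partial>H)} \<in> sets borel"
proof -
  note H [measurable_cong]
  have [measurable]: "w \<in> borel_measurable H" by measurable
  define N where "N = density H (\<lambda>y. ennreal (w y) * indicator {y. l < w y} y)"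
  have sN [measurable_cong]: "sets N = sets borel" by (simp add: N_def H)
  have spN: "space N = UNIV" using sets_eq_imp_space_eq[OF sN] by simp
  have spH: "space H = UNIV" using sets_eq_imp_space_eq[OF H] by simp
  have NU: "emeasure N UNIV = excess H w l"
    using spH by (simp add: N_def excess_def emeasure_density H)
  have fin: "excess H w l \<le> ennreal (l powr (1 - s))"
    by (rule excess_le) (use assms in auto)
  have exc: "excess H w l = ennreal (enn2real (excess H w l))"
    using le_less_trans[OF fin ennreal_less_top] by simp
  interpret N: finite_measure N
    by (rule finite_measureI) (use le_less_trans[OF fin ennreal_less_top] in \<open>simp add: spN NU\<close>)
  have eq: "(\<integral>\<^sup>+y. ennreal (w y) * indicator {y. l < w y} y * ennreal (norm (x - y) powr - d) \<partial>H)
      = (\<integral>\<^sup>+y. ennreal (norm (x - y) powr - d) \<partial>N)" for x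
    unfolding N_def by (subst nn_integral_density) auto
  have "(\<lambda>x. \<integral>\<^sup>+y. ennreal (norm (x - y) powr - d) \<partial>N) \<in> borel_measurable borel"
    by measurable
  then show E: "?E \<in> sets borel"
    unfolding eq using S(1) by measurable
  have "emeasure M ?E \<le> emeasure M S"
    by (rule emeasure_mono) (use S upper_regularD(2)[OF M] in auto)
  then have "emeasure M ?E < \<infinity>" using S(2) by (rule le_less_trans)
  then show "emeasure M ?E \<le> ennreal (((K * 2 powr d / (1 - 2 powr (d - \<alpha>)) + 1) * enn2real (excess H w l) / t) powr (\<alpha> / d))"
    by (intro kernel_weak_type[OF M _ _ _ sN _ _ E]) (use assms exc in \<open>auto simp: NU eq\<close>)
qed

lemma layer_cake_powr:
  fixes v :: "'a \<Rightarrow> real"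
  assumes "sigma_finite_measure M" and [measurable]: "v \<in> borel_measurable M" and v0: "\<And>x. 0 \<le> v x" and q: "0 < q"
  shows "(\<integral>\<^sup>+x. ennreal (v x powr q) \<partial>M)
    = (\<integral>\<^sup>+t. ennreal (q * t powr (q - 1)) * indicator {0<..} t * emeasure M {x \<in> space M. t < v x} \<partial>lborel)"
proof -
  interpret sigma_finite_measure M by fact
  interpret P: pair_sigma_finite lborel M ..
  have "(\<integral>\<^sup>+x. ennreal (v x powr q) \<partial>M)
      = (\<integral>\<^sup>+x. (\<integral>\<^sup>+t. ennreal (q * t powr (q - 1)) * indicator {0<..} t * indicator {x. t < v x} x \<partial>lborel) \<partial>M)"
  proof (intro nn_integral_cong)
    fix x
    have "(\<integral>\<^sup>+t. ennreal (q * t powr (q - 1)) * indicator {0<..} t * indicator {x. t < v x} x \<partial>lborel)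
        = (\<integral>\<^sup>+t. ennreal q * (ennreal (t powr (q - 1)) * indicator {0<..<v x} t) \<partial>lborel)"
      by (intro nn_integral_cong) (use q in \<open>auto simp: indicator_def ennreal_mult\<close>)
    also have "\<dots> = ennreal q * (\<integral>\<^sup>+t. ennreal (t powr (q - 1)) * indicator {0<..<v x} t \<partial>lborel)"
      by (rule nn_integral_cmult) measurable
    also have "\<dots> = ennreal (v x powr q)"
      using q v0 by (subst nn_integral_powr_Ioo) (auto simp: ennreal_mult[symmetric])
    finally show "ennreal (v x powr q) =
        (\<integral>\<^sup>+t. ennreal (q * t powr (q - 1)) * indicator {0<..} t * indicator {x. t < v x} x \<partial>lborel)" ..
  qed
  also have "\<dots> = (\<integral>\<^sup>+t. (\<integral>\<^sup>+x. ennreal (q * t powr (q - 1)) * indicator {0<..} t * indicator {x. t < v x} x \<partial>M) \<partial>lborel)"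
    unfolding indicator_def by (rule P.Fubini') measurable
  also have "\<dots> = (\<integral>\<^sup>+t. ennreal (q * t powr (q - 1)) * indicator {0<..} t * emeasure M {x \<in> space M. t < v x} \<partial>lborel)"
  proof (intro nn_integral_cong)
    fix t
    have "(\<integral>\<^sup>+x. ennreal (q * t powr (q - 1)) * indicator {0<..} t * indicator {x. t < v x} x \<partial>M)
      = (\<integral>\<^sup>+x. ennreal (q * t powr (q - 1)) * indicator {0<..} t * indicator {x \<in> space M. t < v x} x \<partial>M)"
      by (intro nn_integral_cong) (auto simp: indicator_def)
    also have "\<dots> = ennreal (q * t powr (q - 1)) * indicator {0<..} t * emeasure M {x \<in> space M. t < v x}"
      by (rule nn_integral_cmult_indicator) measurable
    finally show "(\<integral>\<^sup>+x. ennreal (q * t powr (q - 1)) * indicator {0<..} t * indicator {x. t < v x} x \<partial>M) = \<dots>" .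
  qed
  finally show ?thesis .
qed

text \<open>
  The operator \<open>F, w \<mapsto> v\<close> is interpolated by hand between its weak bound at exponent \<open>1\<close> and the
  bounds for truncated data. The pointwise hypothesis contains the truncation of the boundary datum
  \<open>w\<close> already, since for it only the average over the unit ball of directions, but not the potential,
  preserves bounded data. For \<open>F\<close> the truncation level at height \<open>t\<close> is proportional to \<open>t powr a\<close>
  with \<open>a = n / (n - p)\<close>, so that by \<open>nn_integral_kernel_low\<close> the truncated part does not exceed a
  fixed fraction of \<open>t\<close>.
\<close>

theorem potential_strong_bound:
  fixes K \<alpha> p C1 :: real
  assumes n2: "2 \<le> DIM('a::euclidean_space)" and \<alpha>: "real DIM('a) - 1 < \<alpha>" and K: "0 \<le> K"
    and p: "1 < p" "p < real DIM('a)" and C1: "0 < C1"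
  obtains C where "0 < C" and
    "\<And>(M :: 'a measure) H F w v. upper_regular K \<alpha> M \<Longrightarrow> sets H = sets borel \<Longrightarrow>
      F \<in> borel_measurable borel \<Longrightarrow> w \<in> borel_measurable borel \<Longrightarrow> v \<in> borel_measurable borel \<Longrightarrow>
      (\<And>y. 0 \<le> F y) \<Longrightarrow> (\<And>y. 0 \<le> w y) \<Longrightarrow> (\<And>y. 0 \<le> v y) \<Longrightarrow>
      (\<integral>\<^sup>+y. ennreal (F y powr p) \<partial>lborel) \<le> 1 \<Longrightarrow>
      (\<integral>\<^sup>+y. ennreal (w y powr (p * (real DIM('a) - 1) / (real DIM('a) - p))) \<partial>H) \<le> 1 \<Longrightarrow>
      bounded {x. v x \<noteq> 0} \<Longrightarrow>
      (\<And>x t. 0 < t \<Longrightarrow> ennreal (v x) \<le> ennreal C1 *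
        ((\<integral>\<^sup>+y. ennreal (F y) * ennreal (norm (x - y) powr - (real DIM('a) - 1)) \<partial>lborel) + ennreal t +
         (\<integral>\<^sup>+y. ennreal (w y) * indicator {y. t < w y} y * ennreal (norm (x - y) powr - (real DIM('a) - 1)) \<partial>H))) \<Longrightarrow>
      (\<integral>\<^sup>+x. ennreal (v x powr (\<alpha> * p / (real DIM('a) - p))) \<partial>M) \<le> ennreal C"
proof -
  define n where "n = real DIM('a)"
  define d where "d = n - 1"
  define \<beta> where "\<beta> = \<alpha> / d"
  define s where "s = p * d / (n - p)"
  define q where "q = \<alpha> * p / (n - p)"
  define a where "a = n / (n - p)"
  have n: "2 \<le> n" "p < n" using n2 p by (auto simp: n_def)
  have d: "0 < d" "d < \<alpha>" using n \<alpha> by (auto simp: d_def n_def)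
  have \<beta>: "1 \<le> \<beta>" using d by (simp add: \<beta>_def)
  have s: "1 < s"
  proof -
    have "1 * n < p * n" using p n by (intro mult_strict_right_mono) auto
    then have "n - p < p * d" by (simp add: d_def algebra_simps)
    then show ?thesis using n by (simp add: s_def)
  qed
  have a: "0 < a" using n p by (simp add: a_def)
  have q: "0 < q" using d n p by (simp add: q_def)
  \<comment> \<open>This identity and \<open>q2\<close> are the exponent condition of
    \<open>excess_integral_le\<close> for \<open>F\<close> (exponent \<open>p\<close>, levels of
    order \<open>t powr a\<close>) and for \<open>w\<close> (exponent \<open>s\<close>, levels of
    order \<open>t\<close>).\<close>
  have q1: "q = \<beta> + a * \<beta> * (p - 1)"
  proof -
    have "\<beta> + a * \<beta> * (p - 1) = \<beta> * (n - p + n * (p - 1)) / (n - p)"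
      using n by (simp add: a_def field_simps)
    also have "n - p + n * (p - 1) = p * d" by (simp add: d_def algebra_simps)
    finally show ?thesis using d by (simp add: q_def \<beta>_def)
  qed
  have q2: "q = \<beta> + 1 * \<beta> * (s - 1)" using d by (simp add: q_def \<beta>_def s_def algebra_simps)
  obtain C0 where C0: "0 < C0" and low:
    "\<And>(f :: 'a \<Rightarrow> real) l x. f \<in> borel_measurable borel \<Longrightarrow> (\<And>y. 0 \<le> f y) \<Longrightarrow>
      (\<integral>\<^sup>+y. ennreal (f y powr p) \<partial>lborel) \<le> 1 \<Longrightarrow> 0 < l \<Longrightarrow>
      (\<integral>\<^sup>+y. ennreal (min (f y) l) * ennreal (norm (y - x) powr - d) \<partial>lborel) \<le> ennreal (C0 * l powr (1 - p / n))"
    unfolding d_def n_def by (rule nn_integral_kernel_low[OF p]) blast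
  define Cw where "Cw = K * 2 powr d / (1 - 2 powr (d - \<alpha>)) + 1"
  have "2 powr (d - \<alpha>) < 1" using powr_less_mono[of _ 0 2] d by auto
  then have Cw: "0 < Cw" unfolding Cw_def using K by (intro add_nonneg_pos divide_nonneg_pos mult_nonneg_nonneg) auto
  \<comment> \<open>Four terms have to be kept below height \<open>t\<close>: the low and the high
    part of the potential, the boundary level, and the high part of the boundary term. Each is
    allotted \<open>t / (4 * C1)\<close>. As \<open>a * (1 - p / n) = 1\<close>, this \<kappa> makes
    the bound for the low part at level \<open>\<kappa> * t powr a\<close> equal to that share;
    \<kappa>2 makes the boundary level equal to it.\<close>
  define \<kappa> where "\<kappa> = (1 / (4 * C1 * C0)) powr a"
  define \<kappa>2 where "\<kappa>2 = 1 / (4 * C1)"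
  have \<kappa>: "0 < \<kappa>" "0 < \<kappa>2" using C0 C1 by (auto simp: \<kappa>_def \<kappa>2_def)
  define B where "B = q * (4 * C1 * Cw) powr \<beta>"
  have B: "0 < B" using q C1 Cw by (simp add: B_def)
  define J1 where "J1 = \<kappa> powr ((1 - p) * \<beta>) / (a * (p - 1))"
  define J2 where "J2 = \<kappa>2 powr ((1 - s) * \<beta>) / (1 * (s - 1))"
  have J: "0 < J1" "0 < J2" using \<kappa> a p s by (auto simp: J1_def J2_def)
  have main: "(\<integral>\<^sup>+x. ennreal (v x powr q) \<partial>M) \<le> ennreal (B * (J1 + J2))"
    if M: "upper_regular K \<alpha> M" and H: "sets H = sets borel"
      and F: "F \<in> borel_measurable borel" and w: "w \<in> borel_measurable borel" and v: "v \<in> borel_measurable borel"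
      and F0: "\<And>y. 0 \<le> F y" and w0: "\<And>y. 0 \<le> w y" and v0: "\<And>y. 0 \<le> v y"
      and F1: "(\<integral>\<^sup>+y. ennreal (F y powr p) \<partial>lborel) \<le> 1"
      and w1: "(\<integral>\<^sup>+y. ennreal (w y powr s) \<partial>H) \<le> 1"
      and bdd: "bounded {x. v x \<noteq> 0}"
      and pt: "\<And>x t. 0 < t \<Longrightarrow> ennreal (v x) \<le> ennreal C1 *
        ((\<integral>\<^sup>+y. ennreal (F y) * ennreal (norm (x - y) powr - d) \<partial>lborel) + ennreal t +
         (\<integral>\<^sup>+y. ennreal (w y) * indicator {y. t < w y} y * ennreal (norm (x - y) powr - d) \<partial>H))"
    for M H :: "'a measure" and F w v
  proof -
    note F [measurable] w [measurable] v [measurable]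
    note sM [measurable_cong] = upper_regularD(2)[OF M]
    note H [measurable_cong]
    have [measurable]: "w \<in> borel_measurable H" "v \<in> borel_measurable M" by measurable
    let ?k = "\<lambda>x y. ennreal (norm (x - y) powr - d)"
    let ?P = "\<lambda>N f l x. \<integral>\<^sup>+y. ennreal (f y) * indicator {y. l < f y} y * ?k x y \<partial>N"
    define S where "S = {x. v x \<noteq> 0}"
    have S: "S \<in> sets borel" unfolding S_def by measurable
    obtain R where R: "0 < R" "S \<subseteq> ball 0 R"
      using bounded_subset_ballD[OF bdd, of 0] by (auto simp: S_def)
    have "emeasure M S \<le> emeasure M (ball 0 R)"
      by (rule emeasure_mono[OF R(2)]) (simp add: sM)
    also have "\<dots> < \<infinity>" using upper_regularD(1)[OF M R(1), of 0] by (simp add: le_less_trans[OF _ ennreal_less_top])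
    finally have S': "emeasure M S < \<infinity>" .
    let ?e1 = "\<lambda>t. enn2real (excess lborel F (\<kappa> * t powr a))"
    \<comment> \<open>The power 1 is kept so that \<open>excess_integral_le\<close> applies
      literally, with \<open>a = 1\<close>.\<close>
    let ?e2 = "\<lambda>t. enn2real (excess H w (\<kappa>2 * t powr 1))"
    have level: "emeasure M {x. t < v x}
        \<le> ennreal ((4 * C1 * Cw) powr \<beta> * (t powr - \<beta> * ?e1 t powr \<beta>))
        + ennreal ((4 * C1 * Cw) powr \<beta> * (t powr - \<beta> * ?e2 t powr \<beta>))" if t: "0 < t" for t
    proof -
      define \<tau> where "\<tau> = t / (4 * C1)"
      define l where "l = \<kappa> * t powr a"
      have \<tau>: "0 < \<tau>" using t C1 by (simp add: \<tau>_def)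
      have \<tau>2: "\<kappa>2 * t powr 1 = \<tau>" using t by (simp add: \<tau>_def \<kappa>2_def)
      have l: "0 < l" using t \<kappa> by (simp add: l_def)
      have "l = (\<tau> / C0) powr a"
        unfolding l_def \<kappa>_def \<tau>_def using t C0 C1 by (subst powr_mult[symmetric]) auto
      moreover have "a * (1 - p / n) = 1" using n by (simp add: a_def field_simps)
      ultimately have "C0 * l powr (1 - p / n) = \<tau>" using \<tau> C0 by (simp add: powr_powr)
      with low[OF F F0 F1 l] have lowt: "(\<integral>\<^sup>+y. ennreal (min (F y) l) * ?k x y \<partial>lborel) \<le> ennreal \<tau>" for x
        by (simp only: norm_minus_commute[of x])
      define E1 where "E1 = {x \<in> S. ennreal \<tau> \<le> ?P lborel F l x}"
      define E2 where "E2 = {x \<in> S. ennreal \<tau> \<le> ?P H w \<tau> x}"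
      \<comment> \<open>Outside both sets each of the four terms is at most \<tau>, and
        \<open>C1 * (4 * \<tau>) = t\<close>.\<close>
      have sub: "{x. t < v x} \<subseteq> E1 \<union> E2"
      proof safe
        fix x assume x: "t < v x" and "x \<notin> E2"
        have xS: "x \<in> S" using x t by (simp add: S_def)
        have b2: "?P H w \<tau> x < ennreal \<tau>" using xS \<open>x \<notin> E2\<close> by (auto simp: E2_def not_le)
        show "x \<in> E1"
        proof (rule ccontr)
          assume "x \<notin> E1"
          then have b1: "?P lborel F l x < ennreal \<tau>" using xS by (auto simp: E1_def not_le)
          have "(\<integral>\<^sup>+y. ennreal (F y) * ?k x y \<partial>lborel)
              \<le> (\<integral>\<^sup>+y. ennreal (min (F y) l) * ?k x y + ennreal (F y) * indicator {y. l < F y} y * ?k x y \<partial>lborel)"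
            by (intro nn_integral_mono) (auto simp: indicator_def min_def)
          also have "\<dots> = (\<integral>\<^sup>+y. ennreal (min (F y) l) * ?k x y \<partial>lborel) + ?P lborel F l x"
            by (rule nn_integral_add) measurable
          also have "\<dots> \<le> ennreal \<tau> + ?P lborel F l x" by (intro add_right_mono lowt)
          finally have "(\<integral>\<^sup>+y. ennreal (F y) * ?k x y \<partial>lborel) + ennreal \<tau> + ?P H w \<tau> x
              \<le> ennreal \<tau> + ?P lborel F l x + ennreal \<tau> + ?P H w \<tau> x"
            by (intro add_right_mono)
          also have "\<dots> = ennreal (2 * \<tau>) + (?P lborel F l x + ?P H w \<tau> x)"
            using \<tau> by (simp add: ennreal_plus[symmetric] ac_simps del: ennreal_plus)
          also have "\<dots> \<le> ennreal (2 * \<tau>) + (ennreal \<tau> + ennreal \<tau>)"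
            using b1 b2 by (intro add_left_mono add_mono) auto
          also have "\<dots> = ennreal (4 * \<tau>)" using \<tau> by (simp add: ennreal_plus[symmetric] del: ennreal_plus)
          finally have "ennreal C1 * ((\<integral>\<^sup>+y. ennreal (F y) * ?k x y \<partial>lborel) + ennreal \<tau> + ?P H w \<tau> x)
              \<le> ennreal C1 * ennreal (4 * \<tau>)" by (rule mult_left_mono) auto
          also have "\<dots> = ennreal t" using C1 \<tau> by (simp add: ennreal_mult[symmetric] \<tau>_def)
          finally have "ennreal (v x) \<le> ennreal t" using pt[OF \<tau>, of x] by (rule order_trans[rotated])
          then show False using x t by (simp add: ennreal_le_iff)
        qed
      qed
      note lev1 = emeasure_level_le[OF M K d sets_lborel F p(1) l F1 S S' \<tau>]
      note lev2 = emeasure_level_le[OF M K d H w s \<tau> w1 S S' \<tau>]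
      have E1: "emeasure M E1 \<le> ennreal ((Cw * ?e1 t / \<tau>) powr \<beta>)"
        unfolding E1_def Cw_def \<beta>_def l_def[symmetric] by (rule lev1(1))
      have E2: "emeasure M E2 \<le> ennreal ((Cw * ?e2 t / \<tau>) powr \<beta>)"
        unfolding E2_def Cw_def \<beta>_def \<tau>2 by (rule lev2(1))
      have Es: "E1 \<in> sets M" "E2 \<in> sets M"
        unfolding E1_def E2_def sM by (rule lev1(2), rule lev2(2))
      have c: "(Cw * e / \<tau>) powr \<beta> = (4 * C1 * Cw) powr \<beta> * (t powr - \<beta> * e powr \<beta>)" if "0 \<le> e" for e
        using that C1 Cw t by (simp add: \<tau>_def powr_mult powr_divide powr_minus field_simps)
      have "emeasure M {x. t < v x} \<le> emeasure M (E1 \<union> E2)"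
        by (rule emeasure_mono[OF sub]) (use Es in auto)
      also have "\<dots> \<le> emeasure M E1 + emeasure M E2"
        by (rule emeasure_subadditive) (use Es in auto)
      also have "\<dots> \<le> ennreal ((Cw * ?e1 t / \<tau>) powr \<beta>) + ennreal ((Cw * ?e2 t / \<tau>) powr \<beta>)"
        by (intro add_mono E1 E2)
      finally show ?thesis by (simp add: c)
    qed
    have "(\<integral>\<^sup>+x. ennreal (v x powr q) \<partial>M)
        = (\<integral>\<^sup>+t. ennreal (q * t powr (q - 1)) * indicator {0<..} t * emeasure M {x \<in> space M. t < v x} \<partial>lborel)"
      by (rule layer_cake_powr[OF upper_regular_sigma_finite[OF M]]) (use v0 q in auto)
    also have "\<dots> \<le> (\<integral>\<^sup>+t. ennreal B * (ennreal (t powr (q - 1 - \<beta>) * ?e1 t powr \<beta>) * indicator {0<..} t)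
        + ennreal B * (ennreal (t powr (q - 1 - \<beta>) * ?e2 t powr \<beta>) * indicator {0<..} t) \<partial>lborel)"
    proof (intro nn_integral_mono)
      fix t :: real
      have sp: "space M = UNIV" by (rule upper_regularD(3)[OF M])
      have e: "ennreal (q * t powr (q - 1)) * ennreal ((4 * C1 * Cw) powr \<beta> * (t powr - \<beta> * e powr \<beta>))
          = ennreal B * ennreal (t powr (q - 1 - \<beta>) * e powr \<beta>)" if "0 < t" "0 \<le> e" for e
        using that q C1 Cw by (simp add: B_def ennreal_mult[symmetric] powr_diff powr_minus powr_add field_simps)
      show "ennreal (q * t powr (q - 1)) * indicator {0<..} t * emeasure M {x \<in> space M. t < v x}
        \<le> ennreal B * (ennreal (t powr (q - 1 - \<beta>) * ?e1 t powr \<beta>) * indicator {0<..} t)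
        + ennreal B * (ennreal (t powr (q - 1 - \<beta>) * ?e2 t powr \<beta>) * indicator {0<..} t)"
      proof (cases "0 < t")
        case True
        have "ennreal (q * t powr (q - 1)) * emeasure M {x. t < v x} \<le> ennreal (q * t powr (q - 1)) *
          (ennreal ((4 * C1 * Cw) powr \<beta> * (t powr - \<beta> * ?e1 t powr \<beta>))
        + ennreal ((4 * C1 * Cw) powr \<beta> * (t powr - \<beta> * ?e2 t powr \<beta>)))"
          by (intro mult_left_mono level True) auto
        then show ?thesis using True unfolding distrib_left by (subst (asm) (1 2) e) (auto simp: sp)
      qed simp
    qed
    also have "\<dots> = ennreal B * (\<integral>\<^sup>+t. ennreal (t powr (q - 1 - \<beta>) * ?e1 t powr \<beta>) * indicator {0<..} t \<partial>lborel)
        + ennreal B * (\<integral>\<^sup>+t. ennreal (t powr (q - 1 - \<beta>) * ?e2 t powr \<beta>) * indicator {0<..} t \<partial>lborel)"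
    proof -
      have [measurable]: "(\<lambda>t. excess lborel F (\<kappa> * t powr a)) \<in> borel_measurable borel"
        "(\<lambda>t. excess H w (\<kappa>2 * t powr 1)) \<in> borel_measurable borel"
        using excess_integral_le(2)[of F lborel p \<beta> \<kappa> a] excess_integral_le(2)[of w H s \<beta> \<kappa>2 1]
          F0 w0 F1 w1 p s \<beta> \<kappa> a by auto
      have "(\<integral>\<^sup>+t. c * f t + c * g t \<partial>lborel) = c * (\<integral>\<^sup>+t. f t \<partial>lborel) + c * (\<integral>\<^sup>+t. g t \<partial>lborel)"
        if "f \<in> borel_measurable lborel" "g \<in> borel_measurable lborel" for f g :: "real \<Rightarrow> ennreal" and c
        using that by (simp add: nn_integral_add nn_integral_cmult)
      then show ?thesis by this measurable
    qed
    also have "\<dots> \<le> ennreal B * ennreal J1 + ennreal B * ennreal J2"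
      unfolding J1_def J2_def
      by (intro add_mono mult_left_mono excess_integral_le(1) F0 w0 F1 w1 p s \<beta> \<kappa> a q1 q2) auto
    also have "\<dots> = ennreal (B * (J1 + J2))"
      using B J by (simp add: ennreal_mult[symmetric] ennreal_plus[symmetric] distrib_left del: ennreal_plus)
    finally show ?thesis .
  qed
  show thesis
    by (rule that[of "B * (J1 + J2)"]) (use B J main in \<open>auto simp: n_def d_def s_def q_def\<close>)
qed

section \<open>Exit points of rays and Hausdorff measure\<close>

definition tube :: "'a::euclidean_space \<Rightarrow> real \<Rightarrow> 'a set" where
  "tube e \<delta> = (\<lambda>(s, z). s *\<^sub>R e + z) ` ({0..1} \<times> cball 0 \<delta>)"

lemma compact_tube: "compact (tube e \<delta>)"
  unfolding tube_def
  by (intro compact_continuous_image compact_Times compact_cball compact_Icc)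
    (auto simp: case_prod_unfold intro!: continuous_intros)

lemma tube_mono: "\<delta> \<le> \<delta>' \<Longrightarrow> tube e \<delta> \<subseteq> tube e \<delta>'"
  unfolding tube_def by (intro image_mono Sigma_mono) auto

text \<open>Balls of radius \<open>2 * \<delta>\<close> centred at points of the axis at most
  \<delta> apart cover the tube, and \<open>4 / \<delta>\<close> of them are enough for an axis of
  length at most 2. One power of \<delta> is thereby lost from the volume of a ball.\<close>

lemma emeasure_tube_pos:
  fixes e :: "'a::euclidean_space"
  assumes e: "norm e \<le> 2" and \<delta>: "0 < \<delta>" "\<delta> \<le> 1"
  shows "emeasure lborel (tube e \<delta>)
    \<le> ennreal (4 * unit_ball_vol (real DIM('a)) * 2 ^ DIM('a) * \<delta> powr (real DIM('a) - 1))"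
proof -
  define N where "N = nat \<lceil>2 / \<delta>\<rceil>"
  have N: "2 / \<delta> \<le> real N" "real N \<le> 2 / \<delta> + 1" unfolding N_def using \<delta> by (auto simp: of_nat_ceiling)
  have N0: "0 < real N" using N \<delta> by (meson divide_pos_pos less_le_trans zero_less_numeral)
  have sub: "tube e \<delta> \<subseteq> (\<Union>j\<le>N. cball ((real j / real N) *\<^sub>R e) (2 * \<delta>))"
  proof
    fix \<omega> assume "\<omega> \<in> tube e \<delta>"
    then obtain s z where s: "0 \<le> s" "s \<le> 1" and z: "norm z \<le> \<delta>" and \<omega>: "\<omega> = s *\<^sub>R e + z"
      by (auto simp: tube_def)
    define j where "j = nat \<lfloor>s * real N\<rfloor>"
    have j: "real j \<le> s * real N" "s * real N < real j + 1"
      unfolding j_def using s N0 by (auto simp: of_nat_floor)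
    have "s * real N \<le> real N" using s N0 by (simp add: mult_left_le_one_le)
    then have jN: "j \<le> N" using j(1) by linarith
    have "\<bar>real j / real N - s\<bar> \<le> 1 / real N"
    proof -
      have "\<bar>real j / real N - s\<bar> = \<bar>real j - s * real N\<bar> / real N"
        using N0 by (simp add: field_simps abs_divide[symmetric])
      also have "\<dots> \<le> 1 / real N" using j N0 by (intro divide_right_mono) auto
      finally show ?thesis .
    qed
    then have "\<bar>real j / real N - s\<bar> * norm e \<le> 1 / real N * 2"
      using e N0 by (intro mult_mono) auto
    also have "\<dots> \<le> \<delta>" using N(1) N0 \<delta> by (simp add: field_simps)
    finally have "norm ((real j / real N) *\<^sub>R e - s *\<^sub>R e) \<le> \<delta>"
      by (simp add: scaleR_left_diff_distrib[symmetric])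
    then have "dist ((real j / real N) *\<^sub>R e) \<omega> \<le> 2 * \<delta>"
      unfolding \<omega> dist_norm using z norm_triangle_ineq4[of "(real j / real N) *\<^sub>R e - s *\<^sub>R e" z]
      by (simp add: algebra_simps)
    then show "\<omega> \<in> (\<Union>j\<le>N. cball ((real j / real N) *\<^sub>R e) (2 * \<delta>))"
      using jN by auto
  qed
  have "emeasure lborel (tube e \<delta>) \<le> emeasure lborel (\<Union>j\<le>N. cball ((real j / real N) *\<^sub>R e) (2 * \<delta>))"
    by (intro emeasure_mono sub) auto
  also have "\<dots> \<le> (\<Sum>j\<le>N. emeasure lborel (cball ((real j / real N) *\<^sub>R e) (2 * \<delta>)))"
    by (intro emeasure_subadditive_finite) auto
  also have "\<dots> = (\<Sum>j\<le>N. ennreal (unit_ball_vol (real DIM('a)) * (2 * \<delta>) ^ DIM('a)))"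
    using \<delta> by (simp add: emeasure_cball)
  also have "\<dots> = ennreal (real (N + 1) * (unit_ball_vol (real DIM('a)) * (2 * \<delta>) ^ DIM('a)))"
    by (subst sum_ennreal) (use \<delta> in \<open>auto simp: algebra_simps\<close>)
  also have "\<dots> \<le> ennreal (4 / \<delta> * (unit_ball_vol (real DIM('a)) * (2 * \<delta>) ^ DIM('a)))"
  proof (intro ennreal_leI mult_right_mono)
    have "2 \<le> 2 / \<delta>" using \<delta> by (simp add: field_simps)
    then show "real (N + 1) \<le> 4 / \<delta>" using N(2) by simp
  qed (use \<delta> in auto)
  also have "4 / \<delta> * (unit_ball_vol (real DIM('a)) * (2 * \<delta>) ^ DIM('a))
      = 4 * unit_ball_vol (real DIM('a)) * 2 ^ DIM('a) * \<delta> powr (real DIM('a) - 1)"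
    using \<delta> by (simp add: powr_diff powr_realpow power_mult_distrib)
  finally show ?thesis .
qed

lemma emeasure_tube:
  fixes e :: "'a::euclidean_space"
  assumes n: "2 \<le> DIM('a)" and e: "norm e \<le> 2" and \<delta>: "0 \<le> \<delta>" "\<delta> \<le> 1"
  shows "emeasure lborel (tube e \<delta>)
    \<le> ennreal (4 * unit_ball_vol (real DIM('a)) * 2 ^ DIM('a) * \<delta> powr (real DIM('a) - 1))"
proof (cases "\<delta> = 0")
  case False
  then show ?thesis using emeasure_tube_pos[OF e] \<delta> by simp
next
  case True
  define C where "C = 4 * unit_ball_vol (real DIM('a)) * 2 ^ DIM('a)"
  have C: "0 < C" by (simp add: C_def)
  have le: "emeasure lborel (tube e 0) \<le> ennreal (C * \<epsilon>)" if \<epsilon>: "0 < \<epsilon>" "\<epsilon> \<le> 1" for \<epsilon>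
  proof -
    have "emeasure lborel (tube e 0) \<le> emeasure lborel (tube e \<epsilon>)"
      using \<epsilon> by (intro emeasure_mono tube_mono) (auto intro: borel_compact compact_tube)
    also have "\<dots> \<le> ennreal (C * \<epsilon> powr (real DIM('a) - 1))"
      unfolding C_def by (rule emeasure_tube_pos[OF e \<epsilon>])
    also have "\<dots> \<le> ennreal (C * \<epsilon>)"
      using C \<epsilon> n powr_mono'[of 1 "real DIM('a) - 1" \<epsilon>] by (intro ennreal_leI mult_left_mono) auto
    finally show ?thesis .
  qed
  have small: "emeasure lborel (tube e 0) \<le> ennreal \<eta>" if \<eta>: "0 < \<eta>" for \<eta>
  proof -
    have "emeasure lborel (tube e 0) \<le> ennreal (C * min 1 (\<eta> / C))" using C \<eta> by (intro le) auto
    also have "\<dots> \<le> ennreal \<eta>" using C by (intro ennreal_leI) (simp add: min_def field_simps)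
    finally show ?thesis .
  qed
  have "emeasure lborel (tube e 0) \<le> 0"
    by (rule ennreal_le_epsilon) (unfold add_0, rule small)
  then show ?thesis using True by simp
qed

text \<open>The cone over \<open>A\<close> with apex \<open>x\<close>, moved to the origin and cut
  by the open unit ball. Directions are not normalised, so Lebesgue measure on the ball takes the
  place of surface measure on the sphere.\<close>

definition unit_cone :: "'a::real_normed_vector \<Rightarrow> 'a set \<Rightarrow> 'a set" where
  "unit_cone x A = {\<omega>. norm \<omega> < 1 \<and> (\<exists>r\<ge>0. \<exists>y\<in>A. \<omega> = r *\<^sub>R (y - x))}"

text \<open>From \<open>norm \<omega> < 1\<close> the scaling factor \<open>r\<close> is at most
  \<open>1 / \<rho>\<close>, so replacing \<open>y\<close> by the fixed point \<open>e\<close> moves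
  \<open>\<omega>\<close> by at most \<open>diameter A / \<rho>\<close>.\<close>

lemma unit_cone_subset_tube:
  fixes x :: "'a::euclidean_space"
  assumes \<rho>: "0 < \<rho>" and A: "\<And>y. y \<in> A \<Longrightarrow> \<rho> \<le> norm (y - x)" and b: "bounded A" and e: "e \<in> A"
  shows "unit_cone x A \<subseteq> tube ((1 / \<rho>) *\<^sub>R (e - x)) (diameter A / \<rho>)"
proof
  fix \<omega> assume "\<omega> \<in> unit_cone x A"
  then obtain r y where \<omega>: "norm \<omega> < 1" "\<omega> = r *\<^sub>R (y - x)" and r: "0 \<le> r" and y: "y \<in> A"
    by (auto simp: unit_cone_def)
  have "r * \<rho> \<le> r * norm (y - x)" using r A[OF y] by (intro mult_left_mono) auto
  also have "\<dots> < 1" using \<omega> r by simp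
  finally have r1: "r * \<rho> \<le> 1" by simp
  have "norm (r *\<^sub>R (y - e)) = r * dist y e" using r by (simp add: dist_norm)
  also have "\<dots> \<le> (1 / \<rho>) * diameter A"
    using r r1 \<rho> diameter_bounded_bound[OF b y e] by (intro mult_mono) (auto simp: field_simps)
  finally have "norm (r *\<^sub>R (y - e)) \<le> diameter A / \<rho>" by simp
  moreover have "\<omega> = (r * \<rho>) *\<^sub>R ((1 / \<rho>) *\<^sub>R (e - x)) + r *\<^sub>R (y - e)"
    using \<rho> \<omega> by (simp add: algebra_simps)
  ultimately show "\<omega> \<in> tube ((1 / \<rho>) *\<^sub>R (e - x)) (diameter A / \<rho>)"
    unfolding tube_def using r r1 \<rho> by (intro image_eqI[of _ _ "(r * \<rho>, r *\<^sub>R (y - e))"]) auto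
qed

text \<open>
  Seen from \<open>x\<close> at distance about \<open>\<rho>\<close>, a set of diameter \<open>\<delta>\<close> lies in a tube of relative width
  \<open>\<delta> / \<rho>\<close>, whose volume is of order \<open>(\<delta> / \<rho>)^(n - 1)\<close>.
\<close>

lemma emeasure_unit_cone_le_hausdorff:
  assumes n: "2 \<le> DIM('a::euclidean_space)"
  obtains C where "0 < C" and
    "\<And>(x::'a) \<rho> A Z. 0 < \<rho> \<Longrightarrow> (\<And>y. y \<in> A \<Longrightarrow> \<rho> \<le> norm (y - x) \<and> norm (y - x) \<le> 2 * \<rho>) \<Longrightarrow>
      Z \<in> sets borel \<Longrightarrow> Z \<subseteq> unit_cone x A \<Longrightarrow>
      emeasure lborel Z \<le> ennreal (C * \<rho> powr - (real DIM('a) - 1)) * hausdorff_outer (real DIM('a) - 1) A"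
proof -
  define s where "s = real DIM('a) - 1"
  have s: "0 < s" using n by (simp add: s_def)
  define C0 where "C0 = 4 * unit_ball_vol (real DIM('a)) * 2 ^ DIM('a)"
  have C0: "0 < C0" by (simp add: C0_def)
  \<comment> \<open>The last two factors undo the normalisation of
    \<open>hausdorff_content\<close>.\<close>
  define C where "C = C0 * 2 powr s / unit_ball_vol s"
  have C: "0 < C" unfolding C_def using C0 s by simp
  have main: "emeasure lborel Z \<le> ennreal (C * \<rho> powr - s) * hausdorff_outer s A"
    if \<rho>: "0 < \<rho>" and A: "\<And>y. y \<in> A \<Longrightarrow> \<rho> \<le> norm (y - x) \<and> norm (y - x) \<le> 2 * \<rho>"
      and Z: "Z \<in> sets borel" "Z \<subseteq> unit_cone x A" for x :: 'a and \<rho> A Z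
  proof -
    define c where "c = C * \<rho> powr - s"
    have c: "0 < c" using C \<rho> by (simp add: c_def)
    \<comment> \<open>Coverings at the single scale \<rho> suffice: they give tubes of relative
      width at most 1, as \<open>emeasure_tube\<close> demands, and the outer measure dominates
      every scale.\<close>
    have "ennreal (1 / c) * emeasure lborel Z \<le> hausdorff_pre s \<rho> A"
      unfolding hausdorff_pre_def
    proof (rule INF_greatest, clarify)
      fix D :: "nat \<Rightarrow> 'a set"
      assume cov: "A \<subseteq> (\<Union>i. D i)" and D: "\<forall>i. bounded (D i) \<and> diameter (D i) \<le> \<rho>"
      \<comment> \<open>Intersecting with \<open>A\<close> forces all points, in particular the one
        on the axis of the tube, to have distance between \<open>\<rho>\<close> and
        \<open>2 * \<rho>\<close> from \<open>x\<close>. Hence the bound 2 on the length of the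
        axis.\<close>
      define E where "E i = A \<inter> D i" for i
      have E: "bounded (E i)" "diameter (E i) \<le> diameter (D i)" for i
        unfolding E_def using D by (auto intro!: diameter_subset bounded_Int)
      define T where "T i = (if E i = {} then {} else
        tube ((1 / \<rho>) *\<^sub>R ((SOME e. e \<in> E i) - x)) (diameter (E i) / \<rho>))" for i
      have cone: "unit_cone x (E i) \<subseteq> T i" for i
      proof (cases "E i = {}")
        case True
        then show ?thesis by (simp add: unit_cone_def)
      next
        case False
        have "(SOME e. e \<in> E i) \<in> E i" using False by (simp add: some_in_eq)
        then have "unit_cone x (E i) \<subseteq> tube ((1 / \<rho>) *\<^sub>R ((SOME e. e \<in> E i) - x)) (diameter (E i) / \<rho>)"
          using A E(1) by (intro unit_cone_subset_tube \<rho>) (auto simp: E_def)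
        then show ?thesis using False by (simp add: T_def)
      qed
      have Tm: "T i \<in> sets lborel" for i
        by (auto simp: T_def intro: borel_compact compact_tube)
      have Tle: "emeasure lborel (T i) \<le> ennreal c * hausdorff_content s (D i)" for i
      proof (cases "E i = {}")
        case True
        then show ?thesis by (simp add: T_def)
      next
        case False
        then have "(SOME e. e \<in> E i) \<in> E i" by (simp add: some_in_eq)
        then have "norm ((SOME e. e \<in> E i) - x) \<le> 2 * \<rho>" using A by (auto simp: E_def)
        then have "norm ((1 / \<rho>) *\<^sub>R ((SOME e. e \<in> E i) - x)) \<le> 2"
          using \<rho> unfolding norm_scaleR by (simp add: field_simps)
        moreover have d: "0 \<le> diameter (E i)" "diameter (E i) \<le> \<rho>"
          using diameter_ge_0[OF E(1)] E(2)[of i] D by (auto intro: order_trans)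
        ultimately have "emeasure lborel (T i) \<le> ennreal (C0 * (diameter (E i) / \<rho>) powr s)"
          using False \<rho> unfolding T_def C0_def s_def by (simp only: if_False) (intro emeasure_tube n, auto)
        also have "\<dots> \<le> ennreal (C0 * (diameter (D i) / \<rho>) powr s)"
          using C0 \<rho> d E(2)[of i] s by (intro ennreal_leI mult_left_mono powr_mono2 divide_right_mono) auto
        also have "C0 * (diameter (D i) / \<rho>) powr s = c * (unit_ball_vol s * (diameter (D i) / 2) powr s)"
        proof -
          have "0 < unit_ball_vol s" using s by simp
          moreover have "0 \<le> diameter (D i)" using d E(2)[of i] by linarith
          ultimately show ?thesis
            unfolding c_def C_def using \<rho> by (simp add: powr_divide powr_minus field_simps)
        qed
        also have "ennreal \<dots> = ennreal c * hausdorff_content s (D i)"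
          using c s by (simp add: hausdorff_content_def ennreal_mult)
        finally show ?thesis .
      qed
      have "Z \<subseteq> (\<Union>i. T i)"
      proof -
        have "\<omega> \<in> (\<Union>i. T i)" if \<omega>: "\<omega> \<in> Z" for \<omega>
        proof -
          obtain r y where r: "norm \<omega> < 1" "0 \<le> r" "y \<in> A" "\<omega> = r *\<^sub>R (y - x)"
            using Z(2) \<omega> by (auto simp: unit_cone_def)
          obtain i where "y \<in> E i" using cov r(3) by (auto simp: E_def)
          then have "\<omega> \<in> unit_cone x (E i)" using r unfolding unit_cone_def by blast
          then show ?thesis using cone by blast
        qed
        then show ?thesis by blast
      qed
      then have "emeasure lborel Z \<le> emeasure lborel (\<Union>i. T i)"
        using Tm by (intro emeasure_mono) auto
      also have "\<dots> \<le> (\<Sum>i. emeasure lborel (T i))"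
        by (intro emeasure_subadditive_countably) (use Tm in auto)
      also have "\<dots> \<le> (\<Sum>i. ennreal c * hausdorff_content s (D i))"
        by (intro suminf_le Tle summableI)
      also have "\<dots> = ennreal c * (\<Sum>i. hausdorff_content s (D i))" by simp
      finally have "ennreal (1 / c) * emeasure lborel Z \<le> ennreal (1 / c) * (ennreal c * (\<Sum>i. hausdorff_content s (D i)))"
        by (rule mult_left_mono) auto
      also have "\<dots> = (\<Sum>i. hausdorff_content s (D i))"
        using c by (simp add: mult.assoc[symmetric] ennreal_mult[symmetric])
      finally show "ennreal (1 / c) * emeasure lborel Z \<le> (\<Sum>i. hausdorff_content s (D i))" .
    qed
    also have "\<dots> \<le> hausdorff_outer s A"
      unfolding hausdorff_outer_def using \<rho> by (intro SUP_upper) auto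
    finally have "ennreal c * (ennreal (1 / c) * emeasure lborel Z) \<le> ennreal c * hausdorff_outer s A"
      by (rule mult_left_mono) auto
    then show ?thesis using c unfolding c_def[symmetric]
      by (simp add: mult.assoc[symmetric] ennreal_mult[symmetric])
  qed
  show thesis
    by (rule that[OF C]) (rule main[unfolded s_def], blast+)
qed

section \<open>First exit from an open set and its push-forward of Lebesgue measure\<close>

definition escapes :: "'a::euclidean_space set \<Rightarrow> 'a \<Rightarrow> 'a set" where
  "escapes \<Omega> x = {\<omega>. \<exists>t\<ge>0. x + t *\<^sub>R \<omega> \<notin> \<Omega>}"

text \<open>The exit time is given the value \<open>0\<close> along rays that stay in \<open>\<Omega>\<close>.\<close>

definition exit_time :: "'a::euclidean_space set \<Rightarrow> 'a \<Rightarrow> 'a \<Rightarrow> real" where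
  "exit_time \<Omega> x \<omega> = (if \<omega> \<in> escapes \<Omega> x then Inf {t. 0 \<le> t \<and> x + t *\<^sub>R \<omega> \<notin> \<Omega>} else 0)"

definition exit_point :: "'a::euclidean_space set \<Rightarrow> 'a \<Rightarrow> 'a \<Rightarrow> 'a" where
  "exit_point \<Omega> x \<omega> = x + exit_time \<Omega> x \<omega> *\<^sub>R \<omega>"

text \<open>Because \<Omega> is open, the parameters at which the ray is outside \<Omega> form a
  closed set, so their infimum is attained. The exit point is then outside \<Omega>, yet a limit of
  earlier points inside.\<close>

lemma exit_time_props:
  fixes \<Omega> :: "'a::euclidean_space set"
  assumes \<Omega>: "open \<Omega>" and x: "x \<in> \<Omega>" and \<omega>: "\<omega> \<in> escapes \<Omega> x"
  shows "0 < exit_time \<Omega> x \<omega>"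
    and "exit_point \<Omega> x \<omega> \<notin> \<Omega>"
    and "\<And>t. 0 \<le> t \<Longrightarrow> t < exit_time \<Omega> x \<omega> \<Longrightarrow> x + t *\<^sub>R \<omega> \<in> \<Omega>"
    and "\<And>t. 0 \<le> t \<Longrightarrow> x + t *\<^sub>R \<omega> \<notin> \<Omega> \<Longrightarrow> exit_time \<Omega> x \<omega> \<le> t"
    and "exit_point \<Omega> x \<omega> \<in> frontier \<Omega>"
proof -
  define T where "T = {t. 0 \<le> t \<and> x + t *\<^sub>R \<omega> \<notin> \<Omega>}"
  have "T = {0..} \<inter> (\<lambda>t. x + t *\<^sub>R \<omega>) -` (- \<Omega>)" by (auto simp: T_def)
  moreover have "closed ({0..} \<inter> (\<lambda>t. x + t *\<^sub>R \<omega>) -` (- \<Omega>))"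
    by (intro continuous_closed_preimage continuous_intros) (use \<Omega> in auto)
  ultimately have cl: "closed T" by simp
  have ne: "T \<noteq> {}" using \<omega> by (auto simp: T_def escapes_def)
  have bd: "bdd_below T" by (auto simp: T_def intro!: bdd_belowI[of _ 0])
  have \<tau>: "exit_time \<Omega> x \<omega> = Inf T" using \<omega> by (simp add: exit_time_def T_def)
  have inT: "exit_time \<Omega> x \<omega> \<in> T" unfolding \<tau> by (rule closed_contains_Inf[OF ne bd cl])
  then show out: "exit_point \<Omega> x \<omega> \<notin> \<Omega>" by (simp add: T_def exit_point_def)
  have "exit_time \<Omega> x \<omega> \<noteq> 0" using inT x by (auto simp: T_def)
  then show pos: "0 < exit_time \<Omega> x \<omega>" using inT by (simp add: T_def)
  show le: "exit_time \<Omega> x \<omega> \<le> t" if "0 \<le> t" "x + t *\<^sub>R \<omega> \<notin> \<Omega>" for t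
    unfolding \<tau> by (rule cInf_lower[OF _ bd]) (use that in \<open>simp add: T_def\<close>)
  show ins: "x + t *\<^sub>R \<omega> \<in> \<Omega>" if "0 \<le> t" "t < exit_time \<Omega> x \<omega>" for t
    using le[of t] that by fastforce
  have lim: "((\<lambda>t. x + t *\<^sub>R \<omega>) \<longlongrightarrow> exit_point \<Omega> x \<omega>) (at_left (exit_time \<Omega> x \<omega>))"
    unfolding exit_point_def by (intro tendsto_intros)
  have "eventually (\<lambda>t. t \<in> {0<..<exit_time \<Omega> x \<omega>}) (at_left (exit_time \<Omega> x \<omega>))"
    by (rule eventually_at_left_real[OF pos])
  then have ev: "eventually (\<lambda>t. x + t *\<^sub>R \<omega> \<in> closure \<Omega>) (at_left (exit_time \<Omega> x \<omega>))"
    by eventually_elim (use ins closure_subset in force)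
  have "exit_point \<Omega> x \<omega> \<in> closure \<Omega>"
    by (rule Lim_in_closed_set[OF closed_closure ev _ lim]) simp
  then show "exit_point \<Omega> x \<omega> \<in> frontier \<Omega>"
    using out \<Omega> by (simp add: frontier_def interior_open)
qed

text \<open>A closed subset of \<open>{0..c} \<times> UNIV\<close> has a closed projection along the
  compact factor. All measurability of exit times and exit points rests on this.\<close>

lemma closed_escapes_before:
  fixes \<Omega> :: "'a::euclidean_space set"
  assumes \<Omega>: "open \<Omega>"
  shows "closed {\<omega>. \<exists>t\<in>{0..c}. x + t *\<^sub>R \<omega> \<notin> \<Omega>}"
proof -
  have "closed ({0..c} \<times> UNIV \<inter> (\<lambda>(t, \<omega>). x + t *\<^sub>R \<omega>) -` (- \<Omega>))"
    by (intro continuous_closed_preimage closed_Times)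
      (use \<Omega> in \<open>auto simp: case_prod_unfold intro!: continuous_intros\<close>)
  then have "closed {\<omega>. \<exists>t. t \<in> {0..c} \<and> (t, \<omega>) \<in> {0..c} \<times> UNIV \<inter> (\<lambda>(t, \<omega>). x + t *\<^sub>R \<omega>) -` (- \<Omega>)}"
    by (intro closed_compact_projection) auto
  then show ?thesis by (simp add: Bex_def cong: conj_cong)
qed

lemma borel_escapes:
  fixes \<Omega> :: "'a::euclidean_space set"
  assumes \<Omega>: "open \<Omega>"
  shows "escapes \<Omega> x \<in> sets borel"
proof -
  have "escapes \<Omega> x = (\<Union>N. {\<omega>. \<exists>t\<in>{0..real N}. x + t *\<^sub>R \<omega> \<notin> \<Omega>})"
    unfolding escapes_def using real_arch_simple by fastforce
  then show ?thesis using closed_escapes_before[OF \<Omega>] by (auto intro!: sets.countable_UN borel_closed)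
qed

lemma borel_exit_point:
  fixes \<Omega> :: "'a::euclidean_space set"
  assumes \<Omega>: "open \<Omega>" and x: "x \<in> \<Omega>"
  shows "exit_point \<Omega> x \<in> borel_measurable borel"
proof -
  have "{\<omega>. exit_time \<Omega> x \<omega> \<le> c} \<in> sets borel" for c
  proof (cases "0 \<le> c")
    case True
    \<comment> \<open>Rays that never leave \<Omega> have exit time 0 by convention and so belong to
      every sublevel set with \<open>c \<ge> 0\<close>.\<close>
    have "{\<omega>. exit_time \<Omega> x \<omega> \<le> c} = {\<omega>. \<exists>t\<in>{0..c}. x + t *\<^sub>R \<omega> \<notin> \<Omega>} \<union> - escapes \<Omega> x"
    proof (intro set_eqI iffI)
      fix \<omega> assume \<omega>: "\<omega> \<in> {\<omega>. exit_time \<Omega> x \<omega> \<le> c}"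
      show "\<omega> \<in> {\<omega>. \<exists>t\<in>{0..c}. x + t *\<^sub>R \<omega> \<notin> \<Omega>} \<union> - escapes \<Omega> x"
      proof (cases "\<omega> \<in> escapes \<Omega> x")
        case esc: True
        then show ?thesis
          using exit_time_props(1,2)[OF \<Omega> x esc] \<omega> by (auto simp: exit_point_def intro!: bexI[of _ "exit_time \<Omega> x \<omega>"])
      qed simp
    next
      fix \<omega> assume "\<omega> \<in> {\<omega>. \<exists>t\<in>{0..c}. x + t *\<^sub>R \<omega> \<notin> \<Omega>} \<union> - escapes \<Omega> x"
      then show "\<omega> \<in> {\<omega>. exit_time \<Omega> x \<omega> \<le> c}"
      proof
        assume "\<omega> \<in> {\<omega>. \<exists>t\<in>{0..c}. x + t *\<^sub>R \<omega> \<notin> \<Omega>}"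
        then obtain t where t: "0 \<le> t" "t \<le> c" "x + t *\<^sub>R \<omega> \<notin> \<Omega>" by auto
        then have "\<omega> \<in> escapes \<Omega> x" by (auto simp: escapes_def)
        then show ?thesis using exit_time_props(4)[OF \<Omega> x _ t(1,3)] t(2) by simp
      next
        assume "\<omega> \<in> - escapes \<Omega> x"
        then show ?thesis using True by (simp add: exit_time_def)
      qed
    qed
    then show ?thesis using closed_escapes_before[OF \<Omega>, of c x] borel_escapes[OF \<Omega>, of x] by auto
  next
    case False
    have "0 \<le> exit_time \<Omega> x \<omega>" for \<omega>
      using exit_time_props(1)[OF \<Omega> x, of \<omega>] by (cases "\<omega> \<in> escapes \<Omega> x") (auto simp: exit_time_def)
    then have "{\<omega>. exit_time \<Omega> x \<omega> \<le> c} = {}" using False by (auto simp: not_le intro: less_le_trans)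
    then show ?thesis by simp
  qed
  then have [measurable]: "exit_time \<Omega> x \<in> borel_measurable borel"
    by (subst borel_measurable_iff_le) simp
  show ?thesis unfolding exit_point_def by measurable
qed

text \<open>The push-forward of Lebesgue measure under \<open>exit_point\<close> is dominated, as a
  measure, by the weighted Hausdorff measure on the frontier. For measures it is enough to compare
  Borel sets, and cutting these into dyadic shells about \<open>x\<close> makes the weight constant
  up to a factor, so that the cone bound applies shell by shell.\<close>

lemma nn_integral_exit_le_hausdorff:
  assumes n: "2 \<le> DIM('a::euclidean_space)"
  obtains C where "0 < C" and
    "\<And>(\<Omega>::'a set) x w. open \<Omega> \<Longrightarrow> x \<in> \<Omega> \<Longrightarrow> w \<in> borel_measurable borel \<Longrightarrow>
      (\<integral>\<^sup>+\<omega>. w (exit_point \<Omega> x \<omega>) * indicator (ball 0 1 \<inter> escapes \<Omega> x) \<omega> \<partial>lborel) \<le>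
      ennreal C * (\<integral>\<^sup>+y. w y * indicator (frontier \<Omega>) y * ennreal (norm (x - y) powr - (real DIM('a) - 1))
        \<partial>hausdorff_measure (real DIM('a) - 1))"
proof -
  define s where "s = real DIM('a) - 1"
  have s: "0 < s" using n by (simp add: s_def)
  obtain C0 where C0: "0 < C0" and cone:
    "\<And>(x::'a) \<rho> A Z. 0 < \<rho> \<Longrightarrow> (\<And>y. y \<in> A \<Longrightarrow> \<rho> \<le> norm (y - x) \<and> norm (y - x) \<le> 2 * \<rho>) \<Longrightarrow>
      Z \<in> sets borel \<Longrightarrow> Z \<subseteq> unit_cone x A \<Longrightarrow>
      emeasure lborel Z \<le> ennreal (C0 * \<rho> powr - s) * hausdorff_outer s A"
    unfolding s_def by (rule emeasure_unit_cone_le_hausdorff[OF n]) blast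
  \<comment> \<open>The factor \<open>2 powr s\<close> is the variation of the weight across one
    dyadic shell.\<close>
  define C where "C = C0 * 2 powr s"
  have C: "0 < C" using C0 by (simp add: C_def)
  let ?H = "hausdorff_measure s :: 'a measure"
  have main: "(\<integral>\<^sup>+\<omega>. w (exit_point \<Omega> x \<omega>) * indicator (ball 0 1 \<inter> escapes \<Omega> x) \<omega> \<partial>lborel) \<le>
      ennreal C * (\<integral>\<^sup>+y. w y * indicator (frontier \<Omega>) y * ennreal (norm (x - y) powr - s) \<partial>?H)"
    if \<Omega>: "open \<Omega>" and x: "x \<in> \<Omega>" and w: "w \<in> borel_measurable borel" for \<Omega> :: "'a set" and x w
  proof -
    note w [measurable]
    have e [measurable]: "exit_point \<Omega> x \<in> borel_measurable borel" by (rule borel_exit_point[OF \<Omega> x])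
    define B where "B = ball 0 1 \<inter> escapes \<Omega> x"
    have B [measurable]: "B \<in> sets borel" unfolding B_def using borel_escapes[OF \<Omega>] by auto
    have Fr [measurable]: "frontier \<Omega> \<in> sets borel" by (intro borel_closed frontier_closed)
    define m where "m = distr (density lborel (indicator B)) borel (exit_point \<Omega> x)"
    define \<nu> where "\<nu> = density ?H (\<lambda>y. indicator (frontier \<Omega>) y * ennreal (C * norm (x - y) powr - s))"
    \<comment> \<open>No exit point is closer to \<open>x\<close> than this, so the shells can start
      at radius \<rho> and only go outwards.\<close>
    obtain \<rho> where \<rho>: "0 < \<rho>" "ball x \<rho> \<subseteq> \<Omega>" using \<Omega> x openE by blast
    have le: "emeasure m A \<le> emeasure \<nu> A" if A: "A \<in> sets borel" for A
    proof -
      define Y where "Y k = A \<inter> frontier \<Omega> \<inter> {y. \<rho> * 2 ^ k \<le> norm (y - x) \<and> norm (y - x) < \<rho> * 2 ^ Suc k}" for k :: nat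
      have Y [measurable]: "Y k \<in> sets borel" for k unfolding Y_def using A by measurable
      define Z where "Z k = B \<inter> exit_point \<Omega> x -` Y k" for k
      have Z: "Z k \<in> sets borel" for k
        using measurable_sets[OF e Y[of k]] unfolding Z_def by (simp add: sets.Int)
      have "emeasure m A = emeasure (density lborel (indicator B)) (exit_point \<Omega> x -` A)"
        unfolding m_def using A by (subst emeasure_distr) auto
      also have "\<dots> = emeasure lborel (B \<inter> exit_point \<Omega> x -` A)"
        using measurable_sets[OF e A] by (subst emeasure_density) (auto simp: indicator_inter_arith[symmetric])
      also have "\<dots> \<le> emeasure lborel (\<Union>k. Z k)"
      proof (rule emeasure_mono)
        show "B \<inter> exit_point \<Omega> x -` A \<subseteq> (\<Union>k. Z k)"
        proof
          fix \<omega> assume \<omega>: "\<omega> \<in> B \<inter> exit_point \<Omega> x -` A"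
          then have esc: "\<omega> \<in> escapes \<Omega> x" by (simp add: B_def)
          have "exit_point \<Omega> x \<omega> \<notin> ball x \<rho>" using exit_time_props(2)[OF \<Omega> x esc] \<rho> by blast
          then have "\<rho> \<le> norm (exit_point \<Omega> x \<omega> - x)" by (simp add: dist_norm norm_minus_commute)
          then obtain k where "\<rho> * 2 ^ k \<le> norm (exit_point \<Omega> x \<omega> - x)" "norm (exit_point \<Omega> x \<omega> - x) < \<rho> * 2 ^ Suc k"
            using ball_shell_outer[OF \<rho>(1)] by blast
          then have "\<omega> \<in> Z k" using \<omega> exit_time_props(5)[OF \<Omega> x esc] by (simp add: Z_def Y_def)
          then show "\<omega> \<in> (\<Union>k. Z k)" by blast
        qed
      qed (use Z in auto)
      also have "\<dots> \<le> (\<Sum>k. emeasure lborel (Z k))"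
        by (intro emeasure_subadditive_countably) (use Z in auto)
      also have "\<dots> \<le> (\<Sum>k. emeasure \<nu> (Y k))"
      proof (intro suminf_le summableI)
        fix k
        have \<rho>k: "0 < \<rho> * 2 ^ k" using \<rho> by simp
        have "Z k \<subseteq> unit_cone x (Y k)"
        proof
          fix \<omega> assume \<omega>: "\<omega> \<in> Z k"
          then have esc: "\<omega> \<in> escapes \<Omega> x" and "norm \<omega> < 1" and y: "exit_point \<Omega> x \<omega> \<in> Y k"
            by (auto simp: Z_def B_def)
          moreover have "\<omega> = (1 / exit_time \<Omega> x \<omega>) *\<^sub>R (exit_point \<Omega> x \<omega> - x)"
            using exit_time_props(1)[OF \<Omega> x esc] by (simp add: exit_point_def)
          moreover have "0 \<le> 1 / exit_time \<Omega> x \<omega>" using exit_time_props(1)[OF \<Omega> x esc] by simp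
          ultimately show "\<omega> \<in> unit_cone x (Y k)" unfolding unit_cone_def by blast
        qed
        then have "emeasure lborel (Z k) \<le> ennreal (C0 * (\<rho> * 2 ^ k) powr - s) * hausdorff_outer s (Y k)"
          by (intro cone[OF \<rho>k _ Z]) (auto simp: Y_def)
        also have "hausdorff_outer s (Y k) = emeasure ?H (Y k)"
          using s by (intro emeasure_hausdorff[symmetric]) auto
        also have "ennreal (C0 * (\<rho> * 2 ^ k) powr - s) * emeasure ?H (Y k)
            = (\<integral>\<^sup>+y. ennreal (C0 * (\<rho> * 2 ^ k) powr - s) * indicator (Y k) y \<partial>?H)"
          by (intro nn_integral_cmult_indicator[symmetric]) simp
        also have "\<dots> \<le> (\<integral>\<^sup>+y. indicator (frontier \<Omega>) y * ennreal (C * norm (x - y) powr - s) * indicator (Y k) y \<partial>?H)"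
        proof (intro nn_integral_mono)
          fix y
          have "C0 * (\<rho> * 2 ^ k) powr - s \<le> C * norm (x - y) powr - s" if y: "y \<in> Y k"
          proof -
            have ny: "0 < norm (x - y)" "norm (x - y) \<le> 2 * (\<rho> * 2 ^ k)"
              using y \<rho>k by (auto simp: Y_def norm_minus_commute)
            have "(\<rho> * 2 ^ k) powr - s = 2 powr s * (2 * (\<rho> * 2 ^ k)) powr - s"
              using \<rho>k by (simp add: powr_mult powr_minus)
            also have "\<dots> \<le> 2 powr s * norm (x - y) powr - s"
              using ny s by (intro mult_left_mono powr_mono2') auto
            finally have "C0 * (\<rho> * 2 ^ k) powr - s \<le> C0 * (2 powr s * norm (x - y) powr - s)"
              using C0 by (intro mult_left_mono) auto
            then show ?thesis by (simp add: C_def mult.assoc)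
          qed
          moreover have "y \<in> frontier \<Omega>" if "y \<in> Y k" using that by (simp add: Y_def)
          ultimately show "ennreal (C0 * (\<rho> * 2 ^ k) powr - s) * indicator (Y k) y
              \<le> indicator (frontier \<Omega>) y * ennreal (C * norm (x - y) powr - s) * indicator (Y k) y"
            by (auto simp: indicator_def intro!: ennreal_leI)
        qed
        also have "\<dots> = emeasure \<nu> (Y k)"
          unfolding \<nu>_def by (rule emeasure_density[symmetric]) simp_all
        finally show "emeasure lborel (Z k) \<le> emeasure \<nu> (Y k)" .
      qed
      also have "\<dots> = emeasure \<nu> (\<Union>k. Y k)"
      proof (rule suminf_emeasure)
        show "range Y \<subseteq> sets \<nu>" by (auto simp: \<nu>_def)
        have "Y i \<inter> Y j = {}" if "i < j" for i j
        proof -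
          have "\<rho> * 2 ^ Suc i \<le> \<rho> * 2 ^ j" using \<rho> that by (intro mult_left_mono power_increasing) auto
          then show ?thesis by (auto simp: Y_def)
        qed
        then show "disjoint_family Y"
          unfolding disjoint_family_on_def by (metis Int_commute linorder_neqE_nat)
      qed
      also have "\<dots> \<le> emeasure \<nu> A"
        by (rule emeasure_mono) (use A in \<open>auto simp: \<nu>_def Y_def\<close>)
      finally show ?thesis .
    qed
    have sets: "sets m = sets \<nu>" by (simp add: m_def \<nu>_def)
    have "m \<le> \<nu>"
      using le by (subst le_measure[OF sets]) (auto simp: m_def)
    have "(\<integral>\<^sup>+\<omega>. w (exit_point \<Omega> x \<omega>) * indicator B \<omega> \<partial>lborel) = (\<integral>\<^sup>+y. w y \<partial>m)"
      unfolding m_def by (simp add: nn_integral_distr nn_integral_density mult.commute)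
    also have "\<dots> \<le> (\<integral>\<^sup>+y. w y \<partial>\<nu>)"
      by (rule nn_integral_mono_measure[OF sets \<open>m \<le> \<nu>\<close>])
    also have "\<dots> = (\<integral>\<^sup>+y. ennreal C * (w y * indicator (frontier \<Omega>) y * ennreal (norm (x - y) powr - s)) \<partial>?H)"
      unfolding \<nu>_def using C
      by (subst nn_integral_density) (auto simp: ennreal_mult ac_simps intro!: nn_integral_cong)
    also have "\<dots> = ennreal C * (\<integral>\<^sup>+y. w y * indicator (frontier \<Omega>) y * ennreal (norm (x - y) powr - s) \<partial>?H)"
      by (rule nn_integral_cmult) measurable
    finally show ?thesis by (simp add: B_def)
  qed
  show thesis
    by (rule that[OF C]) (rule main[unfolded s_def], blast+)
qed

section \<open>Smooth bump functions\<close>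

lemma poly_times_exp_minus_tendsto_0:
  fixes p :: "real poly"
  shows "((\<lambda>y. poly p y * exp (- y)) \<longlongrightarrow> 0) at_top"
proof -
  have "((\<lambda>y. \<Sum>i\<le>degree p. coeff p i * (y ^ i / exp y)) \<longlongrightarrow> (\<Sum>i\<le>degree p. coeff p i * 0)) at_top"
    by (intro tendsto_intros tendsto_power_div_exp_0)
  moreover have "(\<Sum>i\<le>degree p. coeff p i * (y ^ i / exp y)) = poly p y * exp (- y)" for y
    by (simp add: poly_altdef sum_distrib_right exp_minus divide_inverse mult.assoc)
  ultimately show ?thesis by simp
qed

text \<open>
  Differentiation maps this family into itself, which gives all derivatives of \<open>exp (- 1 / s)\<close>, also at \<open>0\<close>.
\<close>

definition flat :: "real poly \<Rightarrow> real \<Rightarrow> real" where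
  "flat p s = (if s \<le> 0 then 0 else poly p (1 / s) * exp (- (1 / s)))"

text \<open>With \<open>y = 1 / s\<close>, differentiating \<open>p(y) exp (- y)\<close> in
  \<open>s\<close> gives \<open>y^2 (p(y) - p'(y)) exp (- y)\<close>. At 0 the exponential beats
  every polynomial in \<open>y\<close>.\<close>

lemma has_real_derivative_flat:
  "(flat p has_real_derivative flat (monom 1 2 * (p - pderiv p)) s) (at s)"
proof -
  consider "s < 0" | "s > 0" | "s = 0" by linarith
  then show ?thesis
  proof cases
    case 1
    have "((\<lambda>_. 0) has_real_derivative 0) (at s)" by simp
    then have "(flat p has_real_derivative 0) (at s)"
      by (rule has_field_derivative_transform_within_open[of _ _ _ "{..<0}"]) (use 1 in \<open>auto simp: flat_def\<close>)
    then show ?thesis using 1 by (simp add: flat_def)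
  next
    case 2
    have "((\<lambda>s. poly p (1 / s) * exp (- (1 / s))) has_real_derivative
        poly (monom 1 2 * (p - pderiv p)) (1 / s) * exp (- (1 / s))) (at s)"
      using 2 by (auto intro!: derivative_eq_intros simp: poly_monom field_simps power2_eq_square)
    then have "(flat p has_real_derivative poly (monom 1 2 * (p - pderiv p)) (1 / s) * exp (- (1 / s))) (at s)"
      by (rule has_field_derivative_transform_within_open[of _ _ _ "{0<..}"]) (use 2 in \<open>auto simp: flat_def\<close>)
    then show ?thesis using 2 by (simp add: flat_def)
  next
    case 3
    have "((\<lambda>h. (flat p h - flat p 0) / (h - 0)) \<longlongrightarrow> 0) (at_right 0)"
    proof (rule Lim_transform_eventually)
      \<comment> \<open>\<open>pCons 0 p\<close> is \<open>y p(y)\<close>; the extra factor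
        \<open>y = 1 / h\<close> comes from the difference quotient.\<close>
      have "((\<lambda>h. poly (pCons 0 p) (inverse h) * exp (- inverse h)) \<longlongrightarrow> 0) (at_right 0)"
        by (rule filterlim_compose[OF poly_times_exp_minus_tendsto_0 filterlim_inverse_at_top_right])
      then show "((\<lambda>h. poly (pCons 0 p) (inverse h) * exp (- inverse h)) \<longlongrightarrow> 0) (at_right 0)" .
      show "eventually (\<lambda>h. poly (pCons 0 p) (inverse h) * exp (- inverse h) = (flat p h - flat p 0) / (h - 0)) (at_right (0::real))"
        using eventually_at_right_less[of 0] by eventually_elim (simp add: flat_def divide_inverse)
    qed
    moreover have "((\<lambda>h. (flat p h - flat p 0) / (h - 0)) \<longlongrightarrow> 0) (at_left 0)"
    proof (rule Lim_transform_eventually[OF tendsto_const])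
      show "eventually (\<lambda>h. 0 = (flat p h - flat p 0) / (h - 0)) (at_left (0::real))"
        by (rule eventually_at_leftI[of "-1"]) (auto simp: flat_def)
    qed
    ultimately have "((\<lambda>h. (flat p h - flat p 0) / (h - 0)) \<longlongrightarrow> 0) (at 0)"
      by (simp add: filterlim_split_at)
    then have "(flat p has_real_derivative 0) (at 0)" by (simp add: has_field_derivative_iff)
    then show ?thesis using 3 by (simp add: flat_def)
  qed
qed

section \<open>Closure properties of the classes \<open>Ck\<close>\<close>

lemma partial_derivI:
  "(\<phi> has_derivative D) (at x) \<Longrightarrow> partial_deriv j \<phi> x = D (axis j 1)"
  unfolding partial_deriv_def by (simp add: frechet_derivative_at[symmetric])

lemma Ck_continuous: "Ck k \<phi> \<Longrightarrow> continuous_on UNIV \<phi>"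
  by (cases k) (auto intro: differentiable_imp_continuous_on)

lemma Ck_SucD: "Ck (Suc k) \<phi> \<Longrightarrow> Ck k \<phi>"
proof (induction k arbitrary: \<phi>)
  case 0
  then show ?case by (auto intro: differentiable_imp_continuous_on)
qed auto

lemma Ck_differentiable:
  assumes "Ck (Suc k) \<phi>"
  shows "(\<phi> has_derivative frechet_derivative \<phi> (at x)) (at x)"
  using assms by (auto simp: differentiable_on_def frechet_derivative_works[symmetric])

lemma Ck_SucI:
  assumes "\<And>x. (\<phi> has_derivative D x) (at x)" "\<And>j. Ck k (\<lambda>x. D x (axis j 1))"
  shows "Ck (Suc k) \<phi>"
proof -
  have "partial_deriv j \<phi> = (\<lambda>x. D x (axis j 1))" for j
    using partial_derivI[OF assms(1)] by (intro ext)
  moreover have "\<phi> differentiable_on UNIV"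
    using assms(1) by (auto simp: differentiable_on_def differentiable_def)
  ultimately show ?thesis using assms(2) by simp
qed

lemma Ck_const: "Ck k (\<lambda>x. c)"
proof (induction k arbitrary: c)
  case (Suc k)
  show ?case by (rule Ck_SucI[where D="\<lambda>x h. 0"]) (use Suc in auto)
qed auto

lemma Ck_add: "Ck k f \<Longrightarrow> Ck k g \<Longrightarrow> Ck k (\<lambda>x. f x + g x)"
proof (induction k arbitrary: f g)
  case 0
  then show ?case by (auto intro: continuous_intros)
next
  case (Suc k)
  show ?case
  proof (rule Ck_SucI)
    show "((\<lambda>x. f x + g x) has_derivative (\<lambda>h. frechet_derivative f (at x) h + frechet_derivative g (at x) h)) (at x)" for x
      by (intro has_derivative_add Ck_differentiable) (rule Suc.prems)+
    show "Ck k (\<lambda>x. frechet_derivative f (at x) (axis j 1) + frechet_derivative g (at x) (axis j 1))" for j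
      using Suc.IH[of "partial_deriv j f" "partial_deriv j g"] Suc.prems by (simp add: partial_deriv_def[abs_def])
  qed
qed

lemma Ck_mult: "Ck k f \<Longrightarrow> Ck k g \<Longrightarrow> Ck k (\<lambda>x. f x * g x)"
proof (induction k arbitrary: f g)
  case 0
  then show ?case by (auto intro: continuous_intros)
next
  case (Suc k)
  show ?case
  proof (rule Ck_SucI)
    show "((\<lambda>x. f x * g x) has_derivative
        (\<lambda>h. f x * frechet_derivative g (at x) h + frechet_derivative f (at x) h * g x)) (at x)" for x
      by (intro has_derivative_mult Ck_differentiable) (rule Suc.prems)+
    show "Ck k (\<lambda>x. f x * frechet_derivative g (at x) (axis j 1) + frechet_derivative f (at x) (axis j 1) * g x)" for j
      using Ck_add[OF Suc.IH[of f "partial_deriv j g"] Suc.IH[of "partial_deriv j f" g]] Suc.prems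
        Ck_SucD[OF Suc.prems(1)] Ck_SucD[OF Suc.prems(2)]
      by (simp add: partial_deriv_def[abs_def])
  qed
qed

lemma Ck_prod: "finite I \<Longrightarrow> (\<And>i. i \<in> I \<Longrightarrow> Ck k (f i)) \<Longrightarrow> Ck k (\<lambda>x. \<Prod>i\<in>I. f i x)"
  by (induction I rule: finite_induct) (auto intro: Ck_const Ck_mult)

text \<open>The whole sequence of successive derivatives is part of the data, so that the induction
  on \<open>k\<close> may replace \<open>m\<close> by \<open>Suc m\<close>.\<close>

lemma Ck_coordinate:
  assumes "\<And>m s. (D m has_real_derivative D (Suc m) s) (at s)"
  shows "Ck k (\<lambda>x :: real^'n. D m (a + c * x $ i))"
proof (induction k arbitrary: m)
  case 0
  have "continuous_on UNIV (D m)" using assms DERIV_isCont by (blast intro: continuous_at_imp_continuous_on)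
  then have "continuous_on UNIV (\<lambda>x :: real^'n. D m (a + c * x $ i))"
    by (rule continuous_on_compose2) (auto intro!: continuous_intros)
  then show ?case by simp
next
  case (Suc k)
  show ?case
  proof (rule Ck_SucI)
    show "((\<lambda>x :: real^'n. D m (a + c * x $ i)) has_derivative (\<lambda>h. D (Suc m) (a + c * x $ i) * (c * h $ i))) (at x)" for x
      by (rule has_derivative_compose[OF _ assms[THEN has_field_derivative_imp_has_derivative], unfolded o_def])
        (auto intro!: derivative_eq_intros bounded_linear_imp_has_derivative bounded_linear_vec_nth)
    show "Ck k (\<lambda>x :: real^'n. D (Suc m) (a + c * x $ i) * (c * axis j 1 $ i))" for j
      by (intro Ck_mult Ck_const Suc.IH)
  qed
qed

lemma Ck_affine: "Ck k \<phi> \<Longrightarrow> Ck k (\<lambda>x. \<phi> (c *\<^sub>R x + b))"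
proof (induction k arbitrary: \<phi>)
  case 0
  then have "continuous_on UNIV \<phi>" by simp
  then have "continuous_on UNIV (\<lambda>x. \<phi> (c *\<^sub>R x + b))"
    by (rule continuous_on_compose2) (auto intro!: continuous_intros)
  then show ?case by simp
next
  case (Suc k)
  show ?case
  proof (rule Ck_SucI)
    show "((\<lambda>x. \<phi> (c *\<^sub>R x + b)) has_derivative (\<lambda>h. frechet_derivative \<phi> (at (c *\<^sub>R x + b)) (c *\<^sub>R h))) (at x)" for x
      by (rule has_derivative_compose[OF _ Ck_differentiable[OF Suc.prems]]) (auto intro!: derivative_eq_intros)
    have "frechet_derivative \<phi> (at y) (c *\<^sub>R axis j 1) = c * partial_deriv j \<phi> y" for y j
      using linear_scale[OF has_derivative_linear[OF Ck_differentiable[OF Suc.prems]]]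
      by (simp add: partial_deriv_def)
    then show "Ck k (\<lambda>x. frechet_derivative \<phi> (at (c *\<^sub>R x + b)) (c *\<^sub>R axis j 1))" for j
      using Ck_mult[OF Ck_const[of k c] Suc.IH[of "partial_deriv j \<phi>"]] Suc.prems by simp
  qed
qed

text \<open>A product of one-variable factors, positive exactly on the open cube of half side
  \<open>1 / N\<close> with \<open>N\<close> the dimension. The sum norm shows that this cube lies
  in the unit ball, and dividing by the integral \<open>J\<close> normalises the product.\<close>

lemma smooth_bump_exists:
  obtains \<phi> :: "real^'n::finite \<Rightarrow> real" and M :: real
  where "\<And>k. Ck k \<phi>" "\<And>x. 0 \<le> \<phi> x" "\<And>x. \<phi> x \<noteq> 0 \<Longrightarrow> norm x < 1" "\<And>x. \<phi> x \<le> M" "0 < M"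
    "(\<integral>\<^sup>+x. ennreal (\<phi> x) \<partial>lborel) = 1"
proof -
  define N where "N = real CARD('n)"
  have N: "0 < N" by (simp add: N_def)
  define D where "D m = ((\<lambda>p. monom 1 2 * (p - pderiv p)) ^^ m) (1 :: real poly)" for m :: nat
  have der: "(flat (D m) has_real_derivative flat (D (Suc m)) s) (at s)" for m s
    using has_real_derivative_flat[of "D m" s] by (simp add: D_def)
  have g: "0 \<le> flat (D 0) s" "flat (D 0) s \<noteq> 0 \<longleftrightarrow> 0 < s" "flat (D 0) s \<le> 1" for s
    by (auto simp: D_def flat_def)
  define \<psi> :: "real^'n \<Rightarrow> real" where
    "\<psi> x = (\<Prod>i\<in>UNIV. flat (D 0) (1 + N * x $ i) * flat (D 0) (1 + (- N) * x $ i))" for x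
  have Ck: "Ck k \<psi>" for k
    unfolding \<psi>_def by (intro Ck_prod Ck_mult Ck_coordinate der) auto
  have \<psi>0: "0 \<le> \<psi> x" for x unfolding \<psi>_def by (intro prod_nonneg mult_nonneg_nonneg g)
  have \<psi>1: "\<psi> x \<le> 1" for x
    unfolding \<psi>_def by (intro prod_le_1) (auto intro!: mult_nonneg_nonneg mult_le_one g)
  have supp: "norm x < 1" if "\<psi> x \<noteq> 0" for x
  proof -
    have c: "\<bar>x $ i\<bar> < 1 / N" for i
    proof -
      have "0 < 1 + N * x $ i" "0 < 1 + (- N) * x $ i"
        using that g(2) unfolding \<psi>_def by auto
      then have "\<bar>N * x $ i\<bar> < 1" by linarith
      then show ?thesis using N by (simp add: abs_mult field_simps)
    qed
    have "norm x \<le> (\<Sum>i\<in>UNIV. \<bar>x $ i\<bar>)" by (rule norm_le_l1_cart)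
    also have "\<dots> < (\<Sum>i\<in>(UNIV :: 'n set). 1 / N)" by (intro sum_strict_mono c) auto
    also have "\<dots> = 1" using N by (simp add: N_def)
    finally show ?thesis .
  qed
  have cont: "continuous_on UNIV \<psi>" by (rule Ck_continuous[OF Ck[of 0]])
  then have [measurable]: "\<psi> \<in> borel_measurable borel" by (rule borel_measurable_continuous_onI)
  have pos0: "0 < \<psi> 0" unfolding \<psi>_def using g(1,2) by (intro prod_pos) (auto simp: less_le)
  define I where "I = (\<integral>\<^sup>+x. ennreal (\<psi> x) \<partial>lborel)"
  have "I \<le> (\<integral>\<^sup>+x. indicator (ball 0 1) x \<partial>(lborel :: (real^'n) measure))"
    unfolding I_def
  proof (intro nn_integral_mono)
    show "ennreal (\<psi> x) \<le> indicator (ball 0 1) x" for x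
      using supp[of x] \<psi>1[of x] by (cases "\<psi> x = 0") auto
  qed
  also have "\<dots> < \<infinity>" by (simp add: emeasure_ball)
  finally have Ifin: "I < \<infinity>" .
  have "isCont \<psi> 0" using cont by (simp add: continuous_on_eq_continuous_at)
  then have "eventually (\<lambda>x. \<psi> 0 / 2 < \<psi> x) (nhds 0)"
    using pos0 order_tendstoD(1)[of \<psi> "\<psi> 0" "nhds 0" "\<psi> 0 / 2"] by (simp add: isCont_def continuous_at tendsto_at_iff_tendsto_nhds)
  then obtain e where e: "0 < e" "\<And>x. dist x 0 < e \<Longrightarrow> \<psi> 0 / 2 < \<psi> x"
    unfolding eventually_nhds_metric by blast
  have "0 < ennreal (\<psi> 0 / 2) * emeasure lborel (ball (0::real^'n) e)"
    using pos0 e(1) by (simp add: emeasure_ball ennreal_zero_less_mult_iff)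
  also have "\<dots> = (\<integral>\<^sup>+x. ennreal (\<psi> 0 / 2) * indicator (ball (0 :: real^'n) e) x \<partial>lborel)"
    by (rule nn_integral_cmult_indicator[symmetric]) simp
  also have "\<dots> \<le> I"
    unfolding I_def using e(2) by (intro nn_integral_mono) (auto simp: indicator_def dist_commute less_imp_le intro!: ennreal_leI)
  finally have Ipos: "0 < I" .
  define J where "J = enn2real I"
  have J: "I = ennreal J" "0 < J" using Ifin Ipos by (auto simp: J_def enn2real_positive_iff)
  show thesis
  proof (rule that[of "\<lambda>x. (1 / J) * \<psi> x" "1 / J"])
    show "Ck k (\<lambda>x. (1 / J) * \<psi> x)" for k by (intro Ck_mult Ck_const Ck)
    show "0 \<le> (1 / J) * \<psi> x" for x using J \<psi>0 by simp
    show "norm x < 1" if "(1 / J) * \<psi> x \<noteq> 0" for x using that supp by auto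
    show "(1 / J) * \<psi> x \<le> 1 / J" for x using J \<psi>1[of x] \<psi>0[of x] by (simp add: divide_right_mono)
    show "0 < 1 / J" using J by simp
    have "(\<integral>\<^sup>+x. ennreal ((1 / J) * \<psi> x) \<partial>lborel) = (\<integral>\<^sup>+x. ennreal (1 / J) * ennreal (\<psi> x) \<partial>lborel)"
      using J \<psi>0 by (subst ennreal_mult[symmetric]) auto
    also have "\<dots> = ennreal (1 / J) * I" unfolding I_def by (rule nn_integral_cmult) measurable
    also have "\<dots> = 1" using J by (simp add: ennreal_mult[symmetric])
    finally show "(\<integral>\<^sup>+x. ennreal ((1 / J) * \<psi> x) \<partial>lborel) = 1" .
  qed
qed

section \<open>The symmetric gradient along segments\<close>

text \<open>The weak formulation uses Lebesgue integrals over \<Omega>, whereas differentiation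
  under the integral sign is carried out for gauge integrals over a box. For compactly supported
  continuous integrands the two agree.\<close>

lemma integral_compact_support:
  fixes f :: "'a::euclidean_space \<Rightarrow> real"
  assumes f: "continuous_on UNIV f" and supp: "\<And>y. f y \<noteq> 0 \<Longrightarrow> y \<in> cbox a b \<and> y \<in> S" and S: "S \<in> sets lebesgue"
  shows "integrable (lebesgue_on S) f" "integral\<^sup>L (lebesgue_on S) f = integral (cbox a b) f"
proof -
  have i: "integrable (lebesgue_on (cbox a b)) f"
    by (rule continuous_imp_integrable) (use f continuous_on_subset in blast)
  have eq: "(\<lambda>x. if x \<in> cbox a b then f x else 0) = f" "(\<lambda>x. if x \<in> S then f x else 0) = f"
    using supp by fastforce+
  have "integrable lebesgue (\<lambda>x. if x \<in> cbox a b then f x else 0)"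
    using i by (subst Lebesgue_Measure.integrable_restrict_UNIV) auto
  then have "integrable lebesgue (\<lambda>x. if x \<in> S then f x else 0)" unfolding eq .
  then show iS: "integrable (lebesgue_on S) f"
    using S by (subst (asm) Lebesgue_Measure.integrable_restrict_UNIV) auto
  have "integral\<^sup>L (lebesgue_on S) f = integral S f"
    by (rule lebesgue_integral_eq_integral[OF iS S])
  also have "\<dots> = integral UNIV (\<lambda>x. if x \<in> S then f x else 0)" by (simp add: integral_restrict_UNIV)
  also have "\<dots> = integral UNIV (\<lambda>x. if x \<in> cbox a b then f x else 0)" by (simp add: eq)
  also have "\<dots> = integral (cbox a b) f" by (simp only: integral_restrict_UNIV)
  finally show "integral\<^sup>L (lebesgue_on S) f = integral (cbox a b) f" .
qed

text \<open>The Cauchy-Schwarz inequality for the Frobenius inner product of \<open>A\<close> with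
  the rank-one matrix \<open>W\<close>, whose norm is the square of
  \<open>norm \<omega>\<close>.\<close>

lemma abs_quadratic_form_le:
  fixes A :: "real^'n::finite^'n" and \<omega> :: "real^'n"
  shows "\<bar>\<Sum>i\<in>UNIV. \<Sum>j\<in>UNIV. \<omega> $ i * \<omega> $ j * A $ i $ j\<bar> \<le> (norm \<omega>)\<^sup>2 * norm A"
proof -
  define W :: "real^'n^'n" where "W = (\<chi> i. (\<omega> $ i) *\<^sub>R \<omega>)"
  have "A \<bullet> W = (\<Sum>i\<in>UNIV. \<Sum>j\<in>UNIV. \<omega> $ i * \<omega> $ j * A $ i $ j)"
    by (simp add: W_def inner_vec_def mult_ac sum_distrib_left)
  moreover have "norm W = (norm \<omega>)\<^sup>2"
  proof -
    have "W \<bullet> W = (\<omega> \<bullet> \<omega>) * (\<omega> \<bullet> \<omega>)"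
      by (simp add: W_def inner_vec_def[of W] inner_vec_def[of "\<chi> i. _"] sum_distrib_right mult_ac)
        (simp add: inner_vec_def sum_distrib_right sum_distrib_left mult_ac)
    then show ?thesis by (simp add: norm_eq_sqrt_inner power2_eq_square[symmetric])
  qed
  ultimately show ?thesis using Cauchy_Schwarz_ineq2[of A W] by (simp add: mult.commute)
qed

text \<open>The weights \<open>w i * w j\<close> are symmetric, so the antisymmetric part of
  \<open>a\<close> cancels.\<close>

lemma sum_sym_part:
  fixes a :: "'n::finite \<Rightarrow> 'n \<Rightarrow> real"
  shows "(\<Sum>i\<in>UNIV. \<Sum>j\<in>UNIV. w i * w j * (1 / 2 * (a i j + a j i))) = (\<Sum>i\<in>UNIV. \<Sum>j\<in>UNIV. w i * w j * a i j)"
proof -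
  have "(\<Sum>i\<in>UNIV. \<Sum>j\<in>UNIV. w i * w j * a j i) = (\<Sum>i\<in>UNIV. \<Sum>j\<in>UNIV. w i * w j * a i j)"
    by (subst sum.swap) (simp add: mult_ac)
  moreover have "(\<Sum>i\<in>UNIV. \<Sum>j\<in>UNIV. w i * w j * (1 / 2 * (a i j + a j i)))
      = 1 / 2 * (\<Sum>i\<in>UNIV. \<Sum>j\<in>UNIV. w i * w j * a i j) + 1 / 2 * (\<Sum>i\<in>UNIV. \<Sum>j\<in>UNIV. w i * w j * a j i)"
    by (simp add: sum_distrib_left sum.distrib[symmetric] algebra_simps)
  ultimately show ?thesis by simp
qed

text \<open>
  With \<open>h t\<close> the mollification of \<open>u \<bullet> \<omega>\<close> at the point \<open>x + t *\<^sub>R \<omega>\<close>, the derivative of \<open>h\<close> is the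
  mollification of \<open>\<omega> \<bullet> (G \<omega>)\<close>: only the symmetric part of the gradient enters because \<open>u\<close> is
  tested against the direction in which it is differentiated.
\<close>

lemma sym_grad_segment_estimate:
  fixes u :: "real^'n::finite \<Rightarrow> real^'n" and \<phi> :: "real^'n \<Rightarrow> real"
  assumes \<Omega>: "open \<Omega>" and cu: "continuous_on \<Omega> u" and G: "is_sym_grad \<Omega> u G"
    and \<phi>: "\<And>k. Ck k \<phi>" "\<And>z. 0 \<le> \<phi> z" "\<And>z. \<phi> z \<le> M"
    and supp: "\<And>z. \<phi> z \<noteq> 0 \<Longrightarrow> norm z \<le> \<epsilon>"
    and T: "0 \<le> T" and seg: "\<And>t. 0 \<le> t \<Longrightarrow> t \<le> T \<Longrightarrow> cball (x + t *\<^sub>R \<omega>) \<epsilon> \<subseteq> \<Omega>"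
    and F [measurable]: "F \<in> borel_measurable borel" and FG: "AE y in lebesgue_on \<Omega>. F y = norm (G y)"
  defines "h t \<equiv> \<integral>y. (u y \<bullet> \<omega>) * \<phi> (y - (x + t *\<^sub>R \<omega>)) \<partial>lebesgue_on \<Omega>"
  shows "ennreal \<bar>h 0\<bar> \<le> ennreal \<bar>h T\<bar> + ennreal ((norm \<omega>)\<^sup>2) *
    (\<integral>\<^sup>+t. indicator {0..T} t * (\<integral>\<^sup>+y. ennreal (F y * \<phi> (y - (x + t *\<^sub>R \<omega>))) \<partial>lborel) \<partial>lborel)"
proof -
  have \<Omega>m: "\<Omega> \<in> sets lebesgue" using \<Omega> by auto
  have c\<phi>: "continuous_on UNIV \<phi>" by (rule Ck_continuous[OF \<phi>(1)[of 0]])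
  have [measurable]: "\<phi> \<in> borel_measurable borel" by (rule borel_measurable_continuous_onI[OF c\<phi>])
  have cpd: "continuous_on UNIV (partial_deriv j \<phi>)" for j
    using Ck_continuous[of 0 "partial_deriv j \<phi>"] \<phi>(1)[of "Suc 0"] by simp
  have d\<phi>: "(\<phi> has_derivative frechet_derivative \<phi> (at z)) (at z)" for z
    by (rule Ck_differentiable[OF \<phi>(1)])
  define D where "D z = (\<Sum>j\<in>UNIV. \<omega> $ j * partial_deriv j \<phi> z)" for z
  have D: "frechet_derivative \<phi> (at z) \<omega> = D z" for z
  proof -
    interpret L: linear "frechet_derivative \<phi> (at z)" by (rule has_derivative_linear[OF d\<phi>])
    have "frechet_derivative \<phi> (at z) (\<Sum>j\<in>UNIV. \<omega> $ j *\<^sub>R axis j 1) = D z"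
      unfolding L.sum L.scale D_def partial_deriv_def by simp
    moreover have "(\<Sum>j\<in>UNIV. \<omega> $ j *\<^sub>R axis j 1) = \<omega>"
      using basis_expansion[of \<omega>] by (simp add: scalar_mult_eq_scaleR)
    ultimately show ?thesis by simp
  qed
  have cD: "continuous_on UNIV D" unfolding D_def by (intro continuous_intros cpd)
  have pd0: "partial_deriv j \<phi> z = 0" if "\<epsilon> < norm z" for j z
  proof -
    have "((\<lambda>_. 0) has_derivative (\<lambda>_. 0)) (at z)" by simp
    moreover have "open (- cball 0 \<epsilon> :: (real^'n) set)" by auto
    ultimately have "(\<phi> has_derivative (\<lambda>_. 0)) (at z)"
      by (rule has_derivative_transform_within_open) (use that supp in force)+
    then show ?thesis by (rule partial_derivI)
  qed
  have D0: "D z = 0" if "\<epsilon> < norm z" for z unfolding D_def using pd0[OF that] by simp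
  have \<phi>0: "\<phi> z = 0" if "\<epsilon> < norm z" for z using supp[of z] that by force
  \<comment> \<open>All points seen by a mollifier centred on the segment. This set is compact and
    inside \<Omega>.\<close>
  define K where "K = (\<lambda>(t, z). x + t *\<^sub>R \<omega> + z) ` ({0..T} \<times> cball 0 \<epsilon>)"
  have K: "compact K"
    unfolding K_def
    by (intro compact_continuous_image compact_Times compact_cball compact_Icc)
      (auto simp: case_prod_unfold intro!: continuous_intros)
  have inK: "y \<in> K" if "0 \<le> t" "t \<le> T" "norm (y - (x + t *\<^sub>R \<omega>)) \<le> \<epsilon>" for y t
    unfolding K_def using that by (intro image_eqI[of _ _ "(t, y - (x + t *\<^sub>R \<omega>))"]) auto
  have K\<Omega>: "K \<subseteq> \<Omega>" unfolding K_def using seg by (fastforce simp: dist_norm)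
  \<comment> \<open>Outside \<Omega> nothing is known about \<open>u\<close>. A continuous extension
    from \<open>K\<close> changes none of the integrals and gives integrands that are continuous on
    a whole box.\<close>
  obtain U where U: "continuous_on UNIV U" "\<And>y. y \<in> K \<Longrightarrow> U y = u y"
    using Tietze_unbounded[of K u UNIV] continuous_on_subset[OF cu K\<Omega>] compact_imp_closed[OF K] by auto
  obtain a b where ab: "K \<subseteq> cbox a b"
    using bounded_subset_cbox_symmetric[OF compact_imp_bounded[OF K]] by blast
  have gen: "integrable (lebesgue_on \<Omega>) (\<lambda>y. l (u y) * f (y - (x + t *\<^sub>R \<omega>)))"
    "(\<integral>y. l (u y) * f (y - (x + t *\<^sub>R \<omega>)) \<partial>lebesgue_on \<Omega>) = integral (cbox a b) (\<lambda>y. l (U y) * f (y - (x + t *\<^sub>R \<omega>)))"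
    if t: "0 \<le> t" "t \<le> T" and l: "bounded_linear l" and f: "continuous_on UNIV f" "\<And>z. \<epsilon> < norm z \<Longrightarrow> f z = 0"
    for t and l :: "real^'n \<Rightarrow> real" and f
  proof -
    have eq: "(\<lambda>y. l (u y) * f (y - (x + t *\<^sub>R \<omega>))) = (\<lambda>y. l (U y) * f (y - (x + t *\<^sub>R \<omega>)))"
    proof
      fix y show "l (u y) * f (y - (x + t *\<^sub>R \<omega>)) = l (U y) * f (y - (x + t *\<^sub>R \<omega>))"
        using inK[OF t, of y] U(2)[of y] f(2)[of "y - (x + t *\<^sub>R \<omega>)"] by (cases "\<epsilon> < norm (y - (x + t *\<^sub>R \<omega>))") auto
    qed
    have c: "continuous_on UNIV (\<lambda>y. l (U y) * f (y - (x + t *\<^sub>R \<omega>)))"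
      by (intro continuous_intros bounded_linear.continuous_on[OF l] U(1) continuous_on_compose2[OF f(1)]) auto
    have s: "y \<in> cbox a b \<and> y \<in> \<Omega>" if "l (U y) * f (y - (x + t *\<^sub>R \<omega>)) \<noteq> 0" for y
      using that inK[OF t, of y] f(2)[of "y - (x + t *\<^sub>R \<omega>)"] ab K\<Omega> by (cases "\<epsilon> < norm (y - (x + t *\<^sub>R \<omega>))") auto
    show "integrable (lebesgue_on \<Omega>) (\<lambda>y. l (u y) * f (y - (x + t *\<^sub>R \<omega>)))"
      unfolding eq by (rule integral_compact_support(1)[OF c s \<Omega>m])
    show "(\<integral>y. l (u y) * f (y - (x + t *\<^sub>R \<omega>)) \<partial>lebesgue_on \<Omega>) = integral (cbox a b) (\<lambda>y. l (U y) * f (y - (x + t *\<^sub>R \<omega>)))"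
      unfolding eq by (rule integral_compact_support(2)[OF c s \<Omega>m])
  qed
  have bl: "bounded_linear (\<lambda>v. v \<bullet> \<omega>)" by (rule bounded_linear_inner_left)
  define h' where "h' t = integral (cbox a b) (\<lambda>y. - ((U y \<bullet> \<omega>) * D (y - (x + t *\<^sub>R \<omega>))))" for t
  have hU: "h t = integral (cbox a b) (\<lambda>y. (U y \<bullet> \<omega>) * \<phi> (y - (x + t *\<^sub>R \<omega>)))" if "t \<in> {0..T}" for t
    unfolding h_def using that by (intro gen(2) bl c\<phi> \<phi>0) auto
  have ch': "continuous_on ({0..T} \<times> cbox a b) (\<lambda>(t, y). - ((U y \<bullet> \<omega>) * D (y - (x + t *\<^sub>R \<omega>))))"
    unfolding case_prod_unfold
    by (intro continuous_intros continuous_on_compose2[OF U(1)] continuous_on_compose2[OF cD]) auto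
  have dh: "(h has_real_derivative h' t) (at t within {0..T})" if t: "t \<in> {0..T}" for t
  proof -
    have "((\<lambda>t. integral (cbox a b) (\<lambda>y. (U y \<bullet> \<omega>) * \<phi> (y - (x + t *\<^sub>R \<omega>)))) has_field_derivative
        integral (cbox a b) (\<lambda>y. - ((U y \<bullet> \<omega>) * D (y - (x + t *\<^sub>R \<omega>))))) (at t within {0..T})"
    proof (rule leibniz_rule_field_derivative[OF _ _ ch' t convex_real_interval(5)])
      fix t y
      have A: "((\<lambda>t. \<phi> (y - (x + t *\<^sub>R \<omega>))) has_derivative (\<lambda>s. frechet_derivative \<phi> (at (y - (x + t *\<^sub>R \<omega>))) (- (s *\<^sub>R \<omega>)))) (at t within {0..T})"
        by (rule has_derivative_compose[OF _ d\<phi>]) (auto intro!: derivative_eq_intros)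
      have B: "frechet_derivative \<phi> (at z) (- (s *\<^sub>R \<omega>)) = - D z * s" for s z
      proof -
        interpret L: linear "frechet_derivative \<phi> (at z)" by (rule has_derivative_linear[OF d\<phi>])
        show ?thesis unfolding L.neg L.scale D by simp
      qed
      have "((\<lambda>t. \<phi> (y - (x + t *\<^sub>R \<omega>))) has_real_derivative - D (y - (x + t *\<^sub>R \<omega>))) (at t within {0..T})"
        unfolding has_field_derivative_def by (rule has_derivative_eq_rhs[OF A]) (simp add: B fun_eq_iff)
      then show "((\<lambda>t. (U y \<bullet> \<omega>) * \<phi> (y - (x + t *\<^sub>R \<omega>))) has_field_derivative - ((U y \<bullet> \<omega>) * D (y - (x + t *\<^sub>R \<omega>)))) (at t within {0..T})"
        by (auto intro!: derivative_eq_intros)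
    next
      fix t
      show "(\<lambda>y. (U y \<bullet> \<omega>) * \<phi> (y - (x + t *\<^sub>R \<omega>))) integrable_on cbox a b"
        by (intro integrable_continuous continuous_intros continuous_on_compose2[OF U(1)] continuous_on_compose2[OF c\<phi>]) auto
    qed
    then have "((\<lambda>t. integral (cbox a b) (\<lambda>y. (U y \<bullet> \<omega>) * \<phi> (y - (x + t *\<^sub>R \<omega>)))) has_field_derivative h' t) (at t within {0..T})"
      by (simp add: h'_def)
    then show ?thesis
      by (rule has_field_derivative_transform_within[of _ _ _ _ 1]) (use t hU in auto)
  qed
  have h'le: "ennreal \<bar>h' t\<bar> \<le> ennreal ((norm \<omega>)\<^sup>2) * (\<integral>\<^sup>+y. ennreal (F y * \<phi> (y - (x + t *\<^sub>R \<omega>))) \<partial>lborel)"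
    if t: "0 \<le> t" "t \<le> T" for t
  proof -
    let ?p = "\<lambda>y. \<phi> (y - (x + t *\<^sub>R \<omega>))"
    have Ckp: "Ck k ?p" for k
      using Ck_affine[OF \<phi>(1), of k 1 "- (x + t *\<^sub>R \<omega>)"] by (simp del: minus_add_distrib)
    have sub: "{y. ?p y \<noteq> 0} \<subseteq> cball (x + t *\<^sub>R \<omega>) \<epsilon>"
      using supp by (auto simp: dist_norm norm_minus_commute)
    then have clos: "closure {y. ?p y \<noteq> 0} \<subseteq> cball (x + t *\<^sub>R \<omega>) \<epsilon>" by (rule closure_minimal) auto
    have "compact (closure {y. ?p y \<noteq> 0})"
      using bounded_subset[OF bounded_cball clos] by (simp add: compact_eq_bounded_closed)
    then have test: "?p \<in> test_functions \<Omega>"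
      using Ckp clos seg[OF t] by (auto simp: test_functions_def)
    have pp: "partial_deriv j ?p y = partial_deriv j \<phi> (y - (x + t *\<^sub>R \<omega>))" for j y
    proof -
      have "(?p has_derivative frechet_derivative \<phi> (at (y - (x + t *\<^sub>R \<omega>)))) (at y)"
        by (rule has_derivative_compose[OF _ d\<phi>]) (auto intro!: derivative_eq_intros)
      then show ?thesis by (subst partial_derivI) (auto simp: partial_deriv_def)
    qed
    let ?a = "\<lambda>i j. \<integral>y. u y $ i * partial_deriv j \<phi> (y - (x + t *\<^sub>R \<omega>)) \<partial>lebesgue_on \<Omega>"
    have ia: "integrable (lebesgue_on \<Omega>) (\<lambda>y. u y $ i * partial_deriv j \<phi> (y - (x + t *\<^sub>R \<omega>)))" for i j
      by (intro gen(1) t bounded_linear_vec_nth cpd pd0)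
    have weak: "- (1 / 2 * (?a i j + ?a j i)) = (\<integral>y. G y $ i $ j * ?p y \<partial>lebesgue_on \<Omega>)" for i j
    proof -
      have "distr_sym_grad \<Omega> u i j ?p = (\<integral>y. G y $ i $ j * ?p y \<partial>lebesgue_on \<Omega>)"
        using G test unfolding is_sym_grad_def by blast
      then show ?thesis unfolding distr_sym_grad_def distr_partial_def pp by argo
    qed
    \<comment> \<open>\<open>G\<close> is only locally integrable; the bounded mollifier is
      supported in a closed ball contained in \<Omega>, on which \<open>G\<close> is
      integrable.\<close>
    have iG: "integrable (lebesgue_on \<Omega>) (\<lambda>y. G y $ i $ j * ?p y)" for i j
    proof -
      let ?C = "cball (x + t *\<^sub>R \<omega>) \<epsilon>"
      have "integrable (lebesgue_on ?C) G"
        using G seg[OF t] by (auto simp: is_sym_grad_def L1_loc_def)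
      then have g: "integrable (lebesgue_on ?C) (\<lambda>y. G y $ i $ j)"
        by (rule integrable_bounded_linear[OF bounded_linear_compose[OF bounded_linear_vec_nth bounded_linear_vec_nth]])
      have "?p \<in> borel_measurable (lebesgue_on ?C)"
        by (intro measurable_restrict_space1 measurable_completion) measurable
      then have "integrable (lebesgue_on ?C) (\<lambda>y. G y $ i $ j * ?p y)"
        by (intro Bochner_Integration.integrable_bound[OF integrable_mult_right[OF g, of M]])
          (use g \<phi> order_trans[OF \<phi>(2) \<phi>(3)] in \<open>auto simp: abs_mult mult.commute[of M] intro!: mult_left_mono\<close>)
      then have "integrable lebesgue (\<lambda>y. if y \<in> ?C then G y $ i $ j * ?p y else 0)"
        by (subst Lebesgue_Measure.integrable_restrict_UNIV) auto
      moreover have "(\<lambda>y. if y \<in> ?C then G y $ i $ j * ?p y else 0) = (\<lambda>y. if y \<in> \<Omega> then G y $ i $ j * ?p y else 0)"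
        using sub seg[OF t] by (auto simp: fun_eq_iff)
      ultimately show ?thesis using \<Omega>m by (simp add: Lebesgue_Measure.integrable_restrict_UNIV)
    qed
    let ?Q = "\<lambda>y. \<Sum>i\<in>UNIV. \<Sum>j\<in>UNIV. \<omega> $ i * \<omega> $ j * (G y $ i $ j * ?p y)"
    have iQ: "integrable (lebesgue_on \<Omega>) ?Q"
      by (intro Bochner_Integration.integrable_sum integrable_mult_right iG)
    have "h' t = - integral (cbox a b) (\<lambda>y. (U y \<bullet> \<omega>) * D (y - (x + t *\<^sub>R \<omega>)))"
      by (simp add: h'_def)
    also have "\<dots> = - (\<integral>y. (u y \<bullet> \<omega>) * D (y - (x + t *\<^sub>R \<omega>)) \<partial>lebesgue_on \<Omega>)"
      using gen(2)[OF t bl cD D0] by simp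
    also have "(\<integral>y. (u y \<bullet> \<omega>) * D (y - (x + t *\<^sub>R \<omega>)) \<partial>lebesgue_on \<Omega>)
        = (\<integral>y. (\<Sum>i\<in>UNIV. \<Sum>j\<in>UNIV. \<omega> $ i * \<omega> $ j * (u y $ i * partial_deriv j \<phi> (y - (x + t *\<^sub>R \<omega>)))) \<partial>lebesgue_on \<Omega>)"
      by (simp add: D_def inner_vec_def sum_product mult_ac)
    also have "\<dots> = (\<Sum>i\<in>UNIV. \<Sum>j\<in>UNIV. \<omega> $ i * \<omega> $ j * ?a i j)"
      by (simp add: Bochner_Integration.integral_sum ia)
    \<comment> \<open>Single partial derivatives of \<open>u\<close> need not be functions.
      Symmetrised, they become \<open>distr_sym_grad\<close>, which \<open>G\<close>
      represents.\<close>
    also have "\<dots> = (\<Sum>i\<in>UNIV. \<Sum>j\<in>UNIV. \<omega> $ i * \<omega> $ j * (1 / 2 * (?a i j + ?a j i)))"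
      by (rule sum_sym_part[symmetric])
    also have "- \<dots> = (\<Sum>i\<in>UNIV. \<Sum>j\<in>UNIV. \<omega> $ i * \<omega> $ j * (- (1 / 2 * (?a i j + ?a j i))))"
      by (simp add: sum_negf[symmetric] del: minus_add_distrib)
    also have "\<dots> = (\<integral>y. ?Q y \<partial>lebesgue_on \<Omega>)"
      unfolding weak by (simp add: Bochner_Integration.integral_sum iG)
    finally have "ennreal \<bar>h' t\<bar> = ennreal (norm (\<integral>y. ?Q y \<partial>lebesgue_on \<Omega>))" by simp
    also have "\<dots> \<le> (\<integral>\<^sup>+y. ennreal (norm (?Q y)) \<partial>lebesgue_on \<Omega>)"
      by (rule integral_norm_bound_ennreal[OF iQ])
    also have "\<dots> \<le> (\<integral>\<^sup>+y. ennreal ((norm \<omega>)\<^sup>2) * ennreal (F y * ?p y) \<partial>lebesgue_on \<Omega>)"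
    proof (rule nn_integral_mono_AE)
      show "AE y in lebesgue_on \<Omega>. ennreal (norm (?Q y)) \<le> ennreal ((norm \<omega>)\<^sup>2) * ennreal (F y * ?p y)"
        using FG
      proof eventually_elim
        case (elim y)
        have "?Q y = (\<Sum>i\<in>UNIV. \<Sum>j\<in>UNIV. \<omega> $ i * \<omega> $ j * G y $ i $ j) * ?p y"
          by (simp add: sum_distrib_right mult.assoc)
        then have "norm (?Q y) \<le> (norm \<omega>)\<^sup>2 * norm (G y) * ?p y"
          using abs_quadratic_form_le[of \<omega> "G y"] \<phi>(2) by (simp add: abs_mult mult_right_mono)
        then have "norm (?Q y) \<le> (norm \<omega>)\<^sup>2 * (F y * ?p y)" using elim by (simp add: mult_ac)
        moreover have "0 \<le> F y * ?p y" using elim \<phi>(2) by simp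
        ultimately show ?case by (simp add: ennreal_mult[symmetric] ennreal_leI)
      qed
    qed
    also have "\<dots> \<le> (\<integral>\<^sup>+y. ennreal ((norm \<omega>)\<^sup>2) * ennreal (F y * ?p y) \<partial>lebesgue)"
      using \<Omega>m by (subst nn_integral_restrict_space) (auto intro!: nn_integral_mono simp: indicator_def)
    also have "\<dots> = (\<integral>\<^sup>+y. ennreal ((norm \<omega>)\<^sup>2) * ennreal (F y * ?p y) \<partial>lborel)"
      by (rule nn_integral_completion)
    also have "\<dots> = ennreal ((norm \<omega>)\<^sup>2) * (\<integral>\<^sup>+y. ennreal (F y * ?p y) \<partial>lborel)"
      by (rule nn_integral_cmult) measurable
    finally show ?thesis .
  qed
  have hi: "(h' has_integral (h T - h 0)) {0..T}"
    using dh by (intro fundamental_theorem_of_calculus T) (auto simp: has_real_derivative_iff_has_vector_derivative)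
  have "continuous_on {0..T} h'"
    unfolding h'_def by (rule integral_continuous_on_param[OF ch'])
  then have si: "set_integrable lborel {0..T} h'" by (rule borel_integrable_atLeastAtMost')
  have "ennreal \<bar>h T - h 0\<bar> = ennreal (norm (LINT t:{0..T}|lborel. h' t))"
    using set_borel_integral_eq_integral(2)[OF si] integral_unique[OF hi] by simp
  also have "\<dots> \<le> (\<integral>\<^sup>+t. ennreal (norm (indicator {0..T} t *\<^sub>R h' t)) \<partial>lborel)"
    unfolding set_lebesgue_integral_def
    by (rule integral_norm_bound_ennreal) (use si in \<open>simp add: set_integrable_def\<close>)
  also have "\<dots> \<le> (\<integral>\<^sup>+t. ennreal ((norm \<omega>)\<^sup>2) * (indicator {0..T} t * (\<integral>\<^sup>+y. ennreal (F y * \<phi> (y - (x + t *\<^sub>R \<omega>))) \<partial>lborel)) \<partial>lborel)"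
    by (intro nn_integral_mono) (use h'le in \<open>auto simp: indicator_def\<close>)
  also have "\<dots> = ennreal ((norm \<omega>)\<^sup>2) * (\<integral>\<^sup>+t. indicator {0..T} t * (\<integral>\<^sup>+y. ennreal (F y * \<phi> (y - (x + t *\<^sub>R \<omega>))) \<partial>lborel) \<partial>lborel)"
    by (rule nn_integral_cmult) measurable
  finally have "ennreal \<bar>h T - h 0\<bar> \<le> \<dots>" .
  moreover have "ennreal \<bar>h 0\<bar> \<le> ennreal \<bar>h T\<bar> + ennreal \<bar>h T - h 0\<bar>"
  proof -
    have "\<bar>h 0\<bar> \<le> \<bar>h T\<bar> + \<bar>h T - h 0\<bar>" by linarith
    then have "ennreal \<bar>h 0\<bar> \<le> ennreal (\<bar>h T\<bar> + \<bar>h T - h 0\<bar>)" by (rule ennreal_leI)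
    then show ?thesis by simp
  qed
  ultimately show ?thesis by (meson add_left_mono order_trans)
qed

section \<open>Mollification and the pointwise estimate\<close>

lemma nn_integral_lborel_affine:
  fixes t :: "'a::euclidean_space"
  assumes [measurable]: "f \<in> borel_measurable borel" and c: "c \<noteq> 0"
  shows "(\<integral>\<^sup>+x. f x \<partial>lborel) = ennreal (\<bar>c\<bar> ^ DIM('a)) * (\<integral>\<^sup>+x. f (t + c *\<^sub>R x) \<partial>lborel)"
  by (subst lborel_affine[OF c, of t]) (simp add: nn_integral_density nn_integral_distr nn_integral_cmult)

lemma nn_integral_powr_tail:
  assumes "1 < e" "0 < r"
  shows "(\<integral>\<^sup>+t. ennreal (t powr - e) * indicator {r..} t \<partial>lborel) = ennreal (r powr (1 - e) / (e - 1))"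
proof -
  have "(\<integral>\<^sup>+t. ennreal (t powr - e) * indicator {r..} t \<partial>lborel)
      = ennreal (0 - (- (r powr (1 - e) / (e - 1))))"
  proof (rule nn_integral_FTC_atLeast)
    show "((\<lambda>t. - (t powr (1 - e) / (e - 1))) has_real_derivative t powr - e) (at t)" if "r \<le> t" for t
    proof -
      have "((\<lambda>t. - (t powr (1 - e) / (e - 1))) has_real_derivative - ((1 - e) * t powr (1 - e - 1) / (e - 1))) (at t)"
        using assms that by (intro DERIV_minus DERIV_cdivide has_real_derivative_powr) auto
      moreover have "- ((1 - e) * t powr (1 - e - 1) / (e - 1)) = t powr - e"
        using assms by (simp add: minus_divide_left mult_minus_left[symmetric])
      ultimately show ?thesis by simp
    qed
    have "((\<lambda>t. - (t powr (1 - e) / (e - 1))) \<longlongrightarrow> - (0 / (e - 1))) at_top"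
      using assms by (intro tendsto_intros tendsto_neg_powr filterlim_ident) auto
    then show "((\<lambda>t. - (t powr (1 - e) / (e - 1))) \<longlongrightarrow> 0) at_top" by simp
  qed auto
  then show ?thesis by simp
qed

text \<open>\<open>C\<close> does not depend on the scale \<open>1 / N\<close>. If
  \<open>norm z \<ge> 2 / N\<close>, then \<open>norm w \<ge> norm z / 2\<close> on the support and
  the kernel is comparable to its value at \<open>z\<close>. Otherwise the support lies in the ball
  of radius \<open>3 / N\<close>, over which the kernel integrates to a multiple of
  \<open>1 / N\<close>; together with the height of the mollifier this gives a multiple of
  \<open>N powr d\<close>, and \<open>N \<le> 2 / norm z\<close>.\<close>

lemma mollified_kernel_le:
  assumes n: "2 \<le> DIM('a::euclidean_space)" and M: "0 < M"
  obtains C where "0 < C" and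
    "\<And>(\<phi> :: 'a \<Rightarrow> real) N z. \<phi> \<in> borel_measurable borel \<Longrightarrow> (\<And>x. 0 \<le> \<phi> x) \<Longrightarrow> (\<And>x. \<phi> x \<le> M * N ^ DIM('a)) \<Longrightarrow>
      0 < N \<Longrightarrow> (\<And>x. \<phi> x \<noteq> 0 \<Longrightarrow> norm x < 1 / N) \<Longrightarrow> (\<integral>\<^sup>+x. ennreal (\<phi> x) \<partial>lborel) = 1 \<Longrightarrow> z \<noteq> 0 \<Longrightarrow>
      (\<integral>\<^sup>+w. ennreal (norm w powr - (real DIM('a) - 1)) * ennreal (\<phi> (z - w)) \<partial>lborel)
        \<le> ennreal (C * norm z powr - (real DIM('a) - 1))"
proof -
  define n where "n = real DIM('a)"
  define d where "d = n - 1"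
  have d: "0 < d" "d < n" using assms by (auto simp: d_def n_def)
  have reg: "upper_regular (unit_ball_vol n) n (lborel :: 'a measure)"
    unfolding n_def by (rule upper_regular_lborel)
  define C1 where "C1 = unit_ball_vol n * 2 powr d / (1 - 2 powr (d - n))"
  have "2 powr (d - n) < 1" using powr_less_mono[of _ 0 2] d by auto
  then have C1: "0 \<le> C1" unfolding C1_def n_def by auto
  define C where "C = 2 powr d + 3 * M * C1 * 2 powr d"
  have main: "(\<integral>\<^sup>+w. ennreal (norm w powr - d) * ennreal (\<phi> (z - w)) \<partial>lborel) \<le> ennreal (C * norm z powr - d)"
    if \<phi>: "\<phi> \<in> borel_measurable borel" "\<And>x. 0 \<le> \<phi> x" "\<And>x. \<phi> x \<le> M * N ^ DIM('a)" and N: "0 < N"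
      and supp: "\<And>x. \<phi> x \<noteq> 0 \<Longrightarrow> norm x < 1 / N" and I: "(\<integral>\<^sup>+x. ennreal (\<phi> x) \<partial>lborel) = 1" and z: "z \<noteq> 0"
    for \<phi> :: "'a \<Rightarrow> real" and N z
  proof (cases "2 / N \<le> norm z")
    case True
    note \<phi>(1)[measurable]
    have "(\<integral>\<^sup>+w. ennreal (norm w powr - d) * ennreal (\<phi> (z - w)) \<partial>lborel)
        \<le> (\<integral>\<^sup>+w. ennreal (2 powr d * norm z powr - d) * ennreal (\<phi> (z - w)) \<partial>lborel)"
    proof (intro nn_integral_mono)
      fix w
      show "ennreal (norm w powr - d) * ennreal (\<phi> (z - w)) \<le> ennreal (2 powr d * norm z powr - d) * ennreal (\<phi> (z - w))"
      proof (cases "\<phi> (z - w) = 0")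
        case False
        have "norm (z - w) < 1 / N" by (rule supp[OF False])
        then have "norm z / 2 \<le> norm w" using True norm_triangle_ineq2[of z w] by simp
        then have "norm w powr - d \<le> (norm z / 2) powr - d" using z d by (intro powr_mono2') auto
        also have "\<dots> = 2 powr d * norm z powr - d" by (simp add: powr_divide powr_minus field_simps)
        finally show ?thesis by (intro mult_right_mono ennreal_leI) auto
      qed simp
    qed
    also have "\<dots> = ennreal (2 powr d * norm z powr - d) * (\<integral>\<^sup>+w. ennreal (\<phi> (z - w)) \<partial>lborel)"
      by (rule nn_integral_cmult) measurable
    also have "(\<integral>\<^sup>+w. ennreal (\<phi> (z - w)) \<partial>lborel) = 1"
      using nn_integral_lborel_affine[of "\<lambda>x. ennreal (\<phi> x)" "-1" z] I by simp
    finally have "(\<integral>\<^sup>+w. ennreal (norm w powr - d) * ennreal (\<phi> (z - w)) \<partial>lborel) \<le> ennreal (2 powr d * norm z powr - d)"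
      by simp
    also have "\<dots> \<le> ennreal (C * norm z powr - d)"
      unfolding C_def using C1 M by (intro ennreal_leI mult_right_mono) auto
    finally show ?thesis .
  next
    case False
    note \<phi>(1)[measurable]
    have "(\<integral>\<^sup>+w. ennreal (norm w powr - d) * ennreal (\<phi> (z - w)) \<partial>lborel)
        \<le> (\<integral>\<^sup>+w. ennreal (M * N ^ DIM('a)) * (ennreal (norm (w - 0) powr - d) * indicator (ball (0::'a) (3 / N)) w) \<partial>lborel)"
    proof (intro nn_integral_mono)
      fix w
      show "ennreal (norm w powr - d) * ennreal (\<phi> (z - w))
          \<le> ennreal (M * N ^ DIM('a)) * (ennreal (norm (w - 0) powr - d) * indicator (ball (0::'a) (3 / N)) w)"
      proof (cases "\<phi> (z - w) = 0")
        case nz: False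
        have "norm (z - w) < 1 / N" by (rule supp[OF nz])
        then have "norm w < 3 / N" using False norm_triangle_ineq2[of w z] by (simp add: norm_minus_commute)
        moreover have "ennreal (\<phi> (z - w)) \<le> ennreal (M * N ^ DIM('a))" by (intro ennreal_leI \<phi>)
        ultimately show ?thesis
          using mult_left_mono[of "ennreal (\<phi> (z - w))" "ennreal (M * N ^ DIM('a))" "ennreal (norm w powr - d)"]
          by (simp add: mult.commute)
      qed simp
    qed
    also have "\<dots> = ennreal (M * N ^ DIM('a)) * (\<integral>\<^sup>+w. ennreal (norm (w - 0) powr - d) * indicator (ball (0::'a) (3 / N)) w \<partial>lborel)"
      by (intro nn_integral_cmult borel_measurable_times_ennreal borel_measurable_indicator) auto
    also have "\<dots> \<le> ennreal (M * N ^ DIM('a)) * ennreal (C1 * (3 / N) powr (n - d))"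
      unfolding C1_def by (intro mult_left_mono nn_integral_kernel_near[OF reg]) (use d N in \<open>auto simp: n_def\<close>)
    also have "\<dots> = ennreal (M * N ^ DIM('a) * (C1 * (3 / N) powr (n - d)))"
      using M N C1 by (subst ennreal_mult[symmetric]) auto
    also have "\<dots> \<le> ennreal (C * norm z powr - d)"
    proof (rule ennreal_leI)
      have "N ^ DIM('a) = N powr d * N" using N by (simp add: d_def n_def powr_diff powr_realpow)
      then have "M * N ^ DIM('a) * (C1 * (3 / N) powr (n - d)) = 3 * M * C1 * N powr d"
        using N by (simp add: d_def)
      also have "N \<le> 2 / norm z" using False N z by (simp add: field_simps)
      then have "N powr d \<le> (2 / norm z) powr d" using N d by (intro powr_mono2) auto
      then have "3 * M * C1 * N powr d \<le> 3 * M * C1 * (2 / norm z) powr d" using M C1 by (intro mult_left_mono) auto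
      also have "\<dots> = 3 * M * C1 * 2 powr d * norm z powr - d" by (simp add: powr_divide powr_minus field_simps)
      also have "\<dots> \<le> C * norm z powr - d" unfolding C_def by (intro mult_right_mono) auto
      finally show "M * N ^ DIM('a) * (C1 * (3 / N) powr (n - d)) \<le> C * norm z powr - d" .
    qed
    finally show ?thesis .
  qed
  have C: "0 < C" unfolding C_def using C1 M by (intro add_pos_nonneg) auto
  show thesis
    by (rule that[OF C]) (rule main[unfolded d_def n_def], blast+)
qed

text \<open>Polar coordinates without the sphere. At fixed \<open>t\<close> the substitution of
  \<open>w\<close> for the point of parameter \<open>t\<close> on the ray produces
  \<open>t powr - (n + 2)\<close> times the square of \<open>norm w\<close>, on
  \<open>t > norm w\<close>; integrating in \<open>t\<close> leaves
  \<open>norm w powr - (n - 1)\<close> over \<open>n + 1\<close>, and this divisor is discarded. The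
  squared norm on the left is the one from the quadratic form.\<close>

lemma nn_integral_cone_rays:
  fixes g :: "'a::euclidean_space \<Rightarrow> ennreal"
  assumes g [measurable]: "g \<in> borel_measurable borel"
  shows "(\<integral>\<^sup>+\<omega>. indicator (ball 0 1) \<omega> * ennreal ((norm \<omega>)\<^sup>2) * (\<integral>\<^sup>+t. indicator {0..} t * g (t *\<^sub>R \<omega>) \<partial>lborel) \<partial>lborel)
    \<le> (\<integral>\<^sup>+w. ennreal (norm w powr - (real DIM('a) - 1)) * g w \<partial>lborel)"
proof -
  define n where "n = real DIM('a)"
  have n: "1 \<le> n" by (simp add: n_def Suc_le_eq)
  have B [measurable]: "ball (0::'a) 1 \<in> sets borel" by simp
  have "(\<integral>\<^sup>+\<omega>. indicator (ball 0 1) \<omega> * ennreal ((norm \<omega>)\<^sup>2) * (\<integral>\<^sup>+t. indicator {0..} t * g (t *\<^sub>R \<omega>) \<partial>lborel) \<partial>lborel)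
      = (\<integral>\<^sup>+\<omega>. (\<integral>\<^sup>+t. indicator {0..} t * (indicator (ball 0 1) \<omega> * ennreal ((norm \<omega>)\<^sup>2) * g (t *\<^sub>R \<omega>)) \<partial>lborel) \<partial>lborel)"
    by (intro nn_integral_cong) (subst nn_integral_cmult[symmetric], measurable, simp add: mult_ac)
  also have "\<dots> = (\<integral>\<^sup>+t. (\<integral>\<^sup>+\<omega>. indicator {0..} t * (indicator (ball 0 1) \<omega> * ennreal ((norm \<omega>)\<^sup>2) * g (t *\<^sub>R \<omega>)) \<partial>lborel) \<partial>lborel)"
    unfolding indicator_def by (rule lborel_pair.Fubini') measurable
  also have "\<dots> = (\<integral>\<^sup>+t. (\<integral>\<^sup>+w. ennreal (t powr - (n + 2)) * (indicator {t. norm w < t} t * (ennreal ((norm w)\<^sup>2) * g w)) \<partial>lborel) \<partial>lborel)"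
  proof (rule nn_integral_cong_AE)
    have "AE t in lborel. t \<noteq> (0::real)" by (rule AE_lborel_singleton)
    then show "AE t in lborel. (\<integral>\<^sup>+\<omega>. indicator {0..} t * (indicator (ball 0 1) \<omega> * ennreal ((norm \<omega>)\<^sup>2) * g (t *\<^sub>R \<omega>)) \<partial>lborel)
      = (\<integral>\<^sup>+w. ennreal (t powr - (n + 2)) * (indicator {t. norm w < t} t * (ennreal ((norm w)\<^sup>2) * g w)) \<partial>lborel)"
    proof eventually_elim
      case (elim t)
      show ?case
      proof (cases "0 < t")
        case t: True
        have "(\<integral>\<^sup>+\<omega>. indicator {0..} t * (indicator (ball 0 1) \<omega> * ennreal ((norm \<omega>)\<^sup>2) * g (t *\<^sub>R \<omega>)) \<partial>lborel)
            = (\<integral>\<^sup>+\<omega>. indicator (ball 0 1) \<omega> * ennreal ((norm \<omega>)\<^sup>2) * g (t *\<^sub>R \<omega>) \<partial>lborel)"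
          using t by simp
        also have "\<dots> = ennreal (\<bar>1 / t\<bar> ^ DIM('a)) *
            (\<integral>\<^sup>+w. indicator (ball 0 1) (0 + (1 / t) *\<^sub>R w) * ennreal ((norm (0 + (1 / t) *\<^sub>R w))\<^sup>2) * g (t *\<^sub>R (0 + (1 / t) *\<^sub>R w)) \<partial>lborel)"
          using t by (intro nn_integral_lborel_affine) auto
        also have "\<dots> = (\<integral>\<^sup>+w. ennreal (\<bar>1 / t\<bar> ^ DIM('a)) * (indicator (ball 0 1) (0 + (1 / t) *\<^sub>R w) * ennreal ((norm (0 + (1 / t) *\<^sub>R w))\<^sup>2) * g (t *\<^sub>R (0 + (1 / t) *\<^sub>R w))) \<partial>lborel)"
          by (rule nn_integral_cmult[symmetric]) measurable
        also have "\<dots> = (\<integral>\<^sup>+w. ennreal (t powr - (n + 2)) * (indicator {t. norm w < t} t * (ennreal ((norm w)\<^sup>2) * g w)) \<partial>lborel)"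
        proof (intro nn_integral_cong)
          fix w :: 'a
          have e: "\<bar>1 / t\<bar> ^ DIM('a) * (norm ((1 / t) *\<^sub>R w))\<^sup>2 = t powr - (n + 2) * (norm w)\<^sup>2"
          proof -
            have "t powr - (n + 2) = 1 / (t ^ DIM('a) * t\<^sup>2)"
              using t powr_minus[of t "n + 2"]
              by (simp add: n_def powr_add powr_realpow divide_inverse del: minus_add_distrib)
            then show ?thesis using t by (simp add: power_divide field_simps)
          qed
          have i: "indicator (ball 0 1) (0 + (1 / t) *\<^sub>R w) = (indicator {t. norm w < t} t :: ennreal)"
            using t by (auto simp: indicator_def field_simps)
          have "ennreal (\<bar>1 / t\<bar> ^ DIM('a)) * (indicator {t. norm w < t} t * ennreal ((norm ((1 / t) *\<^sub>R w))\<^sup>2) * g w)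
              = ennreal (\<bar>1 / t\<bar> ^ DIM('a) * (norm ((1 / t) *\<^sub>R w))\<^sup>2) * (indicator {t. norm w < t} t * g w)"
            using t by (subst ennreal_mult) (auto simp: mult_ac)
          also have "\<dots> = ennreal (t powr - (n + 2)) * (indicator {t. norm w < t} t * (ennreal ((norm w)\<^sup>2) * g w))"
            unfolding e using t by (subst ennreal_mult) (auto simp: mult_ac)
          finally show "ennreal (\<bar>1 / t\<bar> ^ DIM('a)) * (indicator (ball 0 1) (0 + (1 / t) *\<^sub>R w) * ennreal ((norm (0 + (1 / t) *\<^sub>R w))\<^sup>2) * g (t *\<^sub>R (0 + (1 / t) *\<^sub>R w)))
              = ennreal (t powr - (n + 2)) * (indicator {t. norm w < t} t * (ennreal ((norm w)\<^sup>2) * g w))"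
            unfolding i using t by simp
        qed
        finally show ?thesis .
      next
        case False
        then have "t < 0" using elim by simp
        moreover have "\<not> norm w < t" for w :: 'a using \<open>t < 0\<close> norm_ge_zero[of w] by linarith
        ultimately show ?thesis by simp
      qed
    qed
  qed
  also have "\<dots> = (\<integral>\<^sup>+w. (\<integral>\<^sup>+t. ennreal (t powr - (n + 2)) * (indicator {t. norm w < t} t * (ennreal ((norm w)\<^sup>2) * g w)) \<partial>lborel) \<partial>lborel)"
    unfolding indicator_def by (rule lborel_pair.Fubini') measurable
  also have "\<dots> \<le> (\<integral>\<^sup>+w. ennreal (norm w powr - (n - 1)) * g w \<partial>lborel)"
  proof (intro nn_integral_mono)
    fix w :: 'a
    show "(\<integral>\<^sup>+t. ennreal (t powr - (n + 2)) * (indicator {t. norm w < t} t * (ennreal ((norm w)\<^sup>2) * g w)) \<partial>lborel)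
        \<le> ennreal (norm w powr - (n - 1)) * g w"
    proof (cases "w = 0")
      case False
      have "(\<integral>\<^sup>+t. ennreal (t powr - (n + 2)) * (indicator {t. norm w < t} t * (ennreal ((norm w)\<^sup>2) * g w)) \<partial>lborel)
          \<le> (\<integral>\<^sup>+t. (ennreal ((norm w)\<^sup>2) * g w) * (ennreal (t powr - (n + 2)) * indicator {norm w..} t) \<partial>lborel)"
        by (intro nn_integral_mono) (auto simp: indicator_def mult_ac)
      also have "\<dots> = (ennreal ((norm w)\<^sup>2) * g w) * (\<integral>\<^sup>+t. ennreal (t powr - (n + 2)) * indicator {norm w..} t \<partial>lborel)"
        by (rule nn_integral_cmult) measurable
      also have "\<dots> = (ennreal ((norm w)\<^sup>2) * g w) * ennreal (norm w powr (1 - (n + 2)) / (n + 2 - 1))"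
        using False n by (subst nn_integral_powr_tail) auto
      also have "\<dots> = ennreal ((norm w)\<^sup>2 * (norm w powr (1 - (n + 2)) / (n + 2 - 1))) * g w"
        using n by (subst ennreal_mult) (auto simp: mult_ac)
      also have "\<dots> \<le> ennreal (norm w powr - (n - 1)) * g w"
      proof (intro mult_right_mono ennreal_leI)
        have "(norm w)\<^sup>2 * norm w powr (1 - (n + 2)) = norm w powr - (n - 1)"
        proof -
          have "(norm w)\<^sup>2 = norm w powr 2" using False by simp
          then have "(norm w)\<^sup>2 * norm w powr (1 - (n + 2)) = norm w powr (2 + (1 - (n + 2)))"
            by (simp only: powr_add)
          then show ?thesis by simp
        qed
        then have "(norm w)\<^sup>2 * (norm w powr (1 - (n + 2)) / (n + 2 - 1)) = norm w powr - (n - 1) / (n + 1)"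
          by (simp add: add.commute)
        also have "\<dots> \<le> norm w powr - (n - 1)" using n by (simp add: divide_le_eq mult_le_cancel_left1)
        finally show "(norm w)\<^sup>2 * (norm w powr (1 - (n + 2)) / (n + 2 - 1)) \<le> norm w powr - (n - 1)" .
      qed auto
      finally show ?thesis .
    qed simp
  qed
  finally show ?thesis by (simp add: n_def)
qed

text \<open>Recovers the full length of a vector from its components along all directions: on the
  ball of radius 1/4 about half the unit vector of \<open>v\<close>, which lies in the unit ball,
  the component is at least \<open>norm v / 4\<close>.\<close>

lemma nn_integral_abs_inner_ge:
  fixes v :: "'a::euclidean_space"
  shows "ennreal (1 / 4 * measure lborel (ball (0::'a) (1 / 4)) * norm v)
    \<le> (\<integral>\<^sup>+\<omega>. ennreal \<bar>v \<bullet> \<omega>\<bar> * indicator (ball 0 1) \<omega> \<partial>lborel)"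
proof (cases "v = 0")
  case False
  define e where "e = (1 / norm v) *\<^sub>R v"
  have e: "norm e = 1" "v = norm v *\<^sub>R e" using False by (auto simp: e_def)
  let ?A = "ball ((1 / 2) *\<^sub>R e) (1 / 4)"
  have "ennreal (norm v / 4) * indicator ?A \<omega> \<le> ennreal \<bar>v \<bullet> \<omega>\<bar> * indicator (ball 0 1) \<omega>" for \<omega>
  proof (cases "\<omega> \<in> ?A")
    case True
    then have d: "norm (\<omega> - (1 / 2) *\<^sub>R e) < 1 / 4" by (simp add: dist_norm norm_minus_commute)
    then have "norm \<omega> < 1" using norm_triangle_ineq2[of \<omega> "(1 / 2) *\<^sub>R e"] e by simp
    moreover have "1 / 4 \<le> e \<bullet> \<omega>"
    proof -
      have "e \<bullet> \<omega> = e \<bullet> (\<omega> - (1 / 2) *\<^sub>R e) + 1 / 2" using e by (simp add: inner_diff_right dot_square_norm)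
      moreover have "\<bar>e \<bullet> (\<omega> - (1 / 2) *\<^sub>R e)\<bar> \<le> 1 / 4"
        using Cauchy_Schwarz_ineq2[of e "\<omega> - (1 / 2) *\<^sub>R e"] d e by simp
      ultimately show ?thesis by linarith
    qed
    then have "norm v * (1 / 4) \<le> norm v * (e \<bullet> \<omega>)" by (intro mult_left_mono) auto
    then have "norm v / 4 \<le> \<bar>v \<bullet> \<omega>\<bar>" using arg_cong[OF e(2), of "\<lambda>x. x \<bullet> \<omega>"] by simp
    ultimately show ?thesis using True by (simp add: ennreal_leI)
  qed simp
  then have "(\<integral>\<^sup>+\<omega>. ennreal (norm v / 4) * indicator ?A \<omega> \<partial>lborel)
      \<le> (\<integral>\<^sup>+\<omega>. ennreal \<bar>v \<bullet> \<omega>\<bar> * indicator (ball 0 1) \<omega> \<partial>lborel)"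
    by (intro nn_integral_mono)
  moreover have "(\<integral>\<^sup>+\<omega>. ennreal (norm v / 4) * indicator ?A \<omega> \<partial>lborel) = ennreal (norm v / 4) * emeasure lborel ?A"
    by (rule nn_integral_cmult_indicator) simp
  moreover have "emeasure lborel ?A = ennreal (measure lborel (ball (0::'a) (1 / 4)))"
    by (simp add: emeasure_ball measure_def)
  ultimately show ?thesis by (simp add: ennreal_mult[symmetric] mult_ac)
qed simp

section \<open>Approximate identities\<close>

definition rescale :: "('a::euclidean_space \<Rightarrow> real) \<Rightarrow> nat \<Rightarrow> 'a \<Rightarrow> real" where
  "rescale \<phi> k z = real (Suc k) ^ DIM('a) * \<phi> (real (Suc k) *\<^sub>R z)"

lemma rescale_support:
  assumes "\<And>x. \<phi> x \<noteq> 0 \<Longrightarrow> norm x < 1" "rescale \<phi> k z \<noteq> 0"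
  shows "norm z < 1 / real (Suc k)"
proof -
  have "norm (real (Suc k) *\<^sub>R z) < 1" using assms(1)[of "real (Suc k) *\<^sub>R z"] assms(2) by (simp add: rescale_def)
  then have "real (Suc k) * norm z < 1" unfolding norm_scaleR by simp
  then show ?thesis by (simp add: pos_less_divide_eq mult.commute del: of_nat_Suc)
qed

lemma nn_integral_rescale:
  fixes \<phi> :: "'a::euclidean_space \<Rightarrow> real"
  assumes [measurable]: "\<phi> \<in> borel_measurable borel" and I: "(\<integral>\<^sup>+x. ennreal (\<phi> x) \<partial>lborel) = 1"
  shows "(\<integral>\<^sup>+y. ennreal (rescale \<phi> k (y - a)) \<partial>lborel) = 1"
proof -
  let ?N = "real (Suc k)"
  have "1 = ennreal (\<bar>?N\<bar> ^ DIM('a)) * (\<integral>\<^sup>+y. ennreal (\<phi> (- (?N *\<^sub>R a) + ?N *\<^sub>R y)) \<partial>lborel)"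
    unfolding I[symmetric] by (rule nn_integral_lborel_affine) auto
  also have "\<dots> = (\<integral>\<^sup>+y. ennreal (\<bar>?N\<bar> ^ DIM('a)) * ennreal (\<phi> (- (?N *\<^sub>R a) + ?N *\<^sub>R y)) \<partial>lborel)"
    by (rule nn_integral_cmult[symmetric]) measurable
  also have "\<dots> = (\<integral>\<^sup>+y. ennreal (rescale \<phi> k (y - a)) \<partial>lborel)"
    by (intro nn_integral_cong) (simp add: rescale_def ennreal_mult' algebra_simps)
  finally show ?thesis ..
qed

lemma mollifier_limit:
  fixes \<phi> g :: "'a::euclidean_space \<Rightarrow> real"
  assumes \<Omega>: "open \<Omega>" and g: "continuous_on \<Omega> g" and a: "a \<in> \<Omega>"
    and c\<phi>: "continuous_on UNIV \<phi>" and \<phi>0: "\<And>x. 0 \<le> \<phi> x" and supp: "\<And>x. \<phi> x \<noteq> 0 \<Longrightarrow> norm x < 1"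
    and I: "(\<integral>\<^sup>+x. ennreal (\<phi> x) \<partial>lborel) = 1"
  shows "(\<lambda>k. \<integral>y. g y * rescale \<phi> k (y - a) \<partial>lebesgue_on \<Omega>) \<longlonglongrightarrow> g a"
proof (rule LIMSEQ_I)
  fix e :: real assume e: "0 < e"
  have [measurable]: "\<phi> \<in> borel_measurable borel" by (rule borel_measurable_continuous_onI[OF c\<phi>])
  obtain d1 where d1: "0 < d1" "cball a d1 \<subseteq> \<Omega>" using \<Omega> a open_contains_cball by blast
  obtain d2 where d2: "0 < d2" "\<And>y. y \<in> \<Omega> \<Longrightarrow> dist y a < d2 \<Longrightarrow> dist (g y) (g a) < e / 2"
    using g a e unfolding continuous_on_iff by (metis half_gt_zero)
  define d where "d = min d1 (d2 / 2)"
  have d: "0 < d" "cball a d \<subseteq> \<Omega>" "\<And>y. y \<in> cball a d \<Longrightarrow> \<bar>g y - g a\<bar> \<le> e / 2"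
  proof -
    show "0 < d" using d1 d2 by (simp add: d_def)
    show s: "cball a d \<subseteq> \<Omega>" using d1 by (auto simp: d_def)
    show "\<bar>g y - g a\<bar> \<le> e / 2" if "y \<in> cball a d" for y
    proof -
      have "dist y a < d2" using that d2(1) by (auto simp: d_def dist_commute)
      then have "dist (g y) (g a) < e / 2" using that s by (intro d2) auto
      then show ?thesis by (simp add: dist_real_def)
    qed
  qed
  obtain k0 :: nat where k0: "1 / d < real k0" using reals_Archimedean2 by blast
  show "\<exists>k0. \<forall>k\<ge>k0. norm ((\<integral>y. g y * rescale \<phi> k (y - a) \<partial>lebesgue_on \<Omega>) - g a) < e"
  proof (intro exI allI impI)
    fix k assume "k0 \<le> k"
    then have "1 / d < real (Suc k)" using k0 by linarith
    then have kd: "1 / real (Suc k) < d" using d(1) by (simp add: field_simps)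
    let ?\<psi> = "\<lambda>y. rescale \<phi> k (y - a)"
    have \<psi>0: "0 \<le> ?\<psi> y" for y using \<phi>0 by (simp add: rescale_def)
    have \<psi>S: "?\<psi> y = 0" if "y \<notin> cball a d" for y
    proof (rule ccontr)
      assume "?\<psi> y \<noteq> 0"
      then have "norm (y - a) < 1 / real (Suc k)" using rescale_support[of \<phi> k "y - a"] supp by blast
      then show False using that kd by (simp add: dist_norm norm_minus_commute)
    qed
    have c\<psi>: "continuous_on UNIV ?\<psi>"
      unfolding rescale_def by (intro continuous_intros continuous_on_compose2[OF c\<phi>]) auto
    have [measurable]: "?\<psi> \<in> borel_measurable borel" by (rule borel_measurable_continuous_onI[OF c\<psi>])
    have hb: "has_bochner_integral lborel ?\<psi> 1"
      by (rule has_bochner_integral_nn_integral)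
        (use \<psi>0 nn_integral_rescale[OF _ I, of k a] in auto)
    have i\<psi>: "integrable lborel ?\<psi>" "integral\<^sup>L lborel ?\<psi> = 1"
      using hb by (auto simp: has_bochner_integral_iff)
    let ?f = "\<lambda>y. indicator (cball a d) y *\<^sub>R (g y * ?\<psi> y)"
    have if': "integrable lborel ?f"
      by (intro borel_integrable_compact compact_cball continuous_intros
          continuous_on_subset[OF g d(2)] continuous_on_subset[OF c\<psi>]) auto
    have "(\<integral>y. g y * ?\<psi> y \<partial>lebesgue_on \<Omega>) = (\<integral>y. indicator \<Omega> y *\<^sub>R (g y * ?\<psi> y) \<partial>lebesgue)"
      using \<Omega> by (intro integral_restrict_space) auto
    also have "(\<lambda>y. indicator \<Omega> y *\<^sub>R (g y * ?\<psi> y)) = ?f"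
      using \<psi>S d(2) by (auto simp: fun_eq_iff indicator_def)
    also have "integral\<^sup>L lebesgue ?f = integral\<^sup>L lborel ?f"
      by (rule integral_completion) (use if' in \<open>auto simp: integrable_iff_bounded\<close>)
    finally have eq: "(\<integral>y. g y * ?\<psi> y \<partial>lebesgue_on \<Omega>) = integral\<^sup>L lborel ?f" .
    have b: "(g a - e / 2) * ?\<psi> y \<le> ?f y" "?f y \<le> (g a + e / 2) * ?\<psi> y" for y
    proof -
      have "(g a - e / 2) * ?\<psi> y \<le> ?f y \<and> ?f y \<le> (g a + e / 2) * ?\<psi> y"
      proof (cases "y \<in> cball a d")
        case True
        then have "g a - e / 2 \<le> g y" "g y \<le> g a + e / 2" using d(3)[of y] by linarith+
        then show ?thesis using True \<psi>0[of y] by (simp add: mult_right_mono)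
      qed (simp add: \<psi>S)
      then show "(g a - e / 2) * ?\<psi> y \<le> ?f y" "?f y \<le> (g a + e / 2) * ?\<psi> y" by auto
    qed
    have "(\<integral>y. (g a - e / 2) * ?\<psi> y \<partial>lborel) \<le> integral\<^sup>L lborel ?f"
      by (intro integral_mono integrable_mult_right i\<psi>(1) if' b)
    moreover have "integral\<^sup>L lborel ?f \<le> (\<integral>y. (g a + e / 2) * ?\<psi> y \<partial>lborel)"
      by (intro integral_mono integrable_mult_right i\<psi>(1) if' b)
    ultimately have "g a - e / 2 \<le> integral\<^sup>L lborel ?f" "integral\<^sup>L lborel ?f \<le> g a + e / 2"
      using i\<psi> by auto
    then show "norm ((\<integral>y. g y * rescale \<phi> k (y - a) \<partial>lebesgue_on \<Omega>) - g a) < e"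
      unfolding eq real_norm_def using e by linarith
  qed
qed

text \<open>The real sequence \<open>b\<close> is subtracted before passing to the limit, so that
  \<open>c\<close> need not converge and its lower limit, the quantity in Fatou's lemma,
  appears.\<close>

lemma ennreal_limit_le_add_liminf:
  fixes a b :: "nat \<Rightarrow> real" and c :: "nat \<Rightarrow> ennreal"
  assumes a: "a \<longlonglongrightarrow> A" and b: "b \<longlonglongrightarrow> B" and b0: "\<And>k. 0 \<le> b k"
    and le: "\<forall>\<^sub>F k in sequentially. ennreal (a k) \<le> ennreal (b k) + c k"
  shows "ennreal A \<le> ennreal B + liminf c"
proof -
  have "(\<lambda>k. ennreal (a k - b k)) \<longlonglongrightarrow> ennreal (A - B)"
    by (intro tendsto_ennrealI tendsto_diff a b)
  then have "ennreal (A - B) = liminf (\<lambda>k. ennreal (a k - b k))"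
    by (intro lim_imp_Liminf[symmetric]) auto
  also have "\<dots> \<le> liminf c"
  proof (rule Liminf_mono)
    show "\<forall>\<^sub>F k in sequentially. ennreal (a k - b k) \<le> c k"
      using le
    proof eventually_elim
      case (elim k)
      show ?case
      proof (cases "a k \<le> b k")
        case False
        then have "ennreal (b k) + ennreal (a k - b k) \<le> ennreal (b k) + c k"
          using elim b0[of k] by (subst ennreal_plus[symmetric]) auto
        then show ?thesis by (simp add: ennreal_add_left_cancel_le)
      qed (simp add: ennreal_neg)
    qed
  qed
  finally have le': "ennreal (A - B) \<le> liminf c" .
  have B0: "0 \<le> B" using b b0 by (intro LIMSEQ_le_const) auto
  have "ennreal A \<le> ennreal (B + max 0 (A - B))" by (intro ennreal_leI) auto
  also have "\<dots> = ennreal B + ennreal (A - B)" using B0 by (subst ennreal_plus) (auto simp: max_def ennreal_neg)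
  also have "\<dots> \<le> ennreal B + liminf c" by (intro add_left_mono le')
  finally show ?thesis .
qed

text \<open>The mollification is removed at the fixed point \<open>x\<close> for each direction, and
  Fatou's lemma then averages the lower limits over the unit ball. The mollified kernels only need a
  bound, not a limit, which is why no Lebesgue point of \<open>G\<close> occurs.\<close>

lemma sym_grad_pointwise_estimate:
  assumes n: "2 \<le> CARD('n::finite)"
  obtains C where "0 < C" and
    "\<And>(\<Omega> :: (real^'n) set) u G F x. open \<Omega> \<Longrightarrow> u \<in> Cb (closure \<Omega>) \<Longrightarrow> is_sym_grad \<Omega> u G \<Longrightarrow>
      F \<in> borel_measurable borel \<Longrightarrow> (\<And>y. 0 \<le> F y) \<Longrightarrow> (AE y in lebesgue_on \<Omega>. F y = norm (G y)) \<Longrightarrow> x \<in> \<Omega> \<Longrightarrow>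
      ennreal (norm (u x)) \<le> ennreal C *
        ((\<integral>\<^sup>+y. ennreal (F y) * ennreal (norm (x - y) powr - (real CARD('n) - 1)) \<partial>lborel)
        + (\<integral>\<^sup>+\<omega>. ennreal (norm (u (exit_point \<Omega> x \<omega>))) * indicator (ball 0 1 \<inter> escapes \<Omega> x) \<omega> \<partial>lborel))"
proof -
  define d where "d = real CARD('n) - 1"
  obtain \<phi> :: "real^'n \<Rightarrow> real" and M where Ck: "\<And>k. Ck k \<phi>" and \<phi>0: "\<And>x. 0 \<le> \<phi> x"
    and supp: "\<And>x. \<phi> x \<noteq> 0 \<Longrightarrow> norm x < 1" and \<phi>M: "\<And>x. \<phi> x \<le> M" and M: "0 < M"
    and I: "(\<integral>\<^sup>+x. ennreal (\<phi> x) \<partial>lborel) = 1"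
    by (rule smooth_bump_exists) blast
  have c\<phi>: "continuous_on UNIV \<phi>" by (rule Ck_continuous[OF Ck[of 0]])
  have m\<phi> [measurable]: "\<phi> \<in> borel_measurable borel" by (rule borel_measurable_continuous_onI[OF c\<phi>])
  let ?r = "rescale \<phi>"
  have mr [measurable]: "?r k \<in> borel_measurable borel" for k unfolding rescale_def by measurable
  have r0: "0 \<le> ?r k z" for k z using \<phi>0 by (simp add: rescale_def)
  have rM: "?r k z \<le> M * real (Suc k) ^ CARD('n)" for k z
    using \<phi>M[of "real (Suc k) *\<^sub>R z"] by (simp add: rescale_def mult.commute mult_left_mono)
  have Ckr: "Ck m (?r k)" for m k
    using Ck_mult[OF Ck_const[of m "real (Suc k) ^ CARD('n)"] Ck_affine[OF Ck, of m "real (Suc k)" 0]]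
    by (simp add: rescale_def[abs_def])
  have rsupp: "norm z < 1 / real (Suc k)" if "?r k z \<noteq> 0" for k z using rescale_support[of \<phi> k z] supp that by blast
  have Ir: "(\<integral>\<^sup>+x. ennreal (?r k x) \<partial>lborel) = 1" for k using nn_integral_rescale[OF m\<phi> I, of k 0] by simp
  have n': "2 \<le> DIM(real^'n)" using n by simp
  obtain C1 where C1: "0 < C1" and moll:
    "\<And>(\<phi> :: real^'n \<Rightarrow> real) N z. \<phi> \<in> borel_measurable borel \<Longrightarrow> (\<And>x. 0 \<le> \<phi> x) \<Longrightarrow> (\<And>x. \<phi> x \<le> M * N ^ CARD('n)) \<Longrightarrow>
      0 < N \<Longrightarrow> (\<And>x. \<phi> x \<noteq> 0 \<Longrightarrow> norm x < 1 / N) \<Longrightarrow> (\<integral>\<^sup>+x. ennreal (\<phi> x) \<partial>lborel) = 1 \<Longrightarrow> z \<noteq> 0 \<Longrightarrow>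
      (\<integral>\<^sup>+w. ennreal (norm w powr - d) * ennreal (\<phi> (z - w)) \<partial>lborel) \<le> ennreal (C1 * norm z powr - d)"
    using mollified_kernel_le[OF n' M] unfolding d_def by simp blast
  have kern: "(\<integral>\<^sup>+\<omega>. indicator (ball 0 1) \<omega> * ennreal ((norm \<omega>)\<^sup>2) * (\<integral>\<^sup>+t. indicator {0..} t * ennreal (?r k (z - t *\<^sub>R \<omega>)) \<partial>lborel) \<partial>lborel)
      \<le> ennreal (C1 * norm z powr - d)" if "z \<noteq> 0" for k and z :: "real^'n"
  proof -
    have "(\<integral>\<^sup>+\<omega>. indicator (ball 0 1) \<omega> * ennreal ((norm \<omega>)\<^sup>2) * (\<integral>\<^sup>+t. indicator {0..} t * ennreal (?r k (z - t *\<^sub>R \<omega>)) \<partial>lborel) \<partial>lborel)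
      \<le> (\<integral>\<^sup>+w. ennreal (norm w powr - d) * ennreal (?r k (z - w)) \<partial>lborel)"
      using nn_integral_cone_rays[of "\<lambda>w. ennreal (?r k (z - w))"] by (simp add: d_def)
    also have "\<dots> \<le> ennreal (C1 * norm z powr - d)"
      by (rule moll[where N="real (Suc k)"]) (use r0 rM rsupp Ir that mr in auto)
    finally show ?thesis .
  qed
  define c0 where "c0 = 1 / 4 * measure lborel (ball (0::real^'n) (1 / 4))"
  have c0: "0 < c0" by (simp add: c0_def content_ball_pos)
  \<comment> \<open>\<open>c0\<close> comes from recovering \<open>norm (u x)\<close> by averaging
    components; the maximum covers the coefficients 1 of the boundary term and \<open>C1\<close> of
    the potential.\<close>
  define C where "C = max 1 C1 / c0"
  have C: "0 < C" using c0 by (simp add: C_def)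
  have main: "ennreal (norm (u x)) \<le> ennreal C *
        ((\<integral>\<^sup>+y. ennreal (F y) * ennreal (norm (x - y) powr - d) \<partial>lborel)
        + (\<integral>\<^sup>+\<omega>. ennreal (norm (u (exit_point \<Omega> x \<omega>))) * indicator (ball 0 1 \<inter> escapes \<Omega> x) \<omega> \<partial>lborel))"
    if \<Omega>: "open \<Omega>" and u: "u \<in> Cb (closure \<Omega>)" and G: "is_sym_grad \<Omega> u G"
      and F: "F \<in> borel_measurable borel" and F0: "\<And>y. 0 \<le> F y"
      and FG: "AE y in lebesgue_on \<Omega>. F y = norm (G y)" and x: "x \<in> \<Omega>"
    for \<Omega> :: "(real^'n) set" and u G F x
  proof -
    note F [measurable]
    have cu': "continuous_on (closure \<Omega>) u" using u by (simp add: Cb_def)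
    then have cu: "continuous_on \<Omega> u" by (rule continuous_on_subset) (rule closure_subset)
    \<comment> \<open>Integrating over the whole half-line, instead of up to the end of a segment,
      makes the error \<open>L\<close> independent of the segment, so that its length can be varied
      afterwards.\<close>
    define W where "W k \<omega> = (\<integral>\<^sup>+t. indicator {0..} t * (\<integral>\<^sup>+y. ennreal (F y * ?r k (y - (x + t *\<^sub>R \<omega>))) \<partial>lborel) \<partial>lborel)" for k \<omega>
    define L where "L \<omega> = liminf (\<lambda>k. ennreal ((norm \<omega>)\<^sup>2) * W k \<omega>)" for \<omega>
    have [measurable]: "W k \<in> borel_measurable borel" for k
      unfolding W_def indicator_def by measurable
    have seg: "ennreal \<bar>u x \<bullet> \<omega>\<bar> \<le> ennreal \<bar>u (x + T *\<^sub>R \<omega>) \<bullet> \<omega>\<bar> + L \<omega>"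
      if T: "0 \<le> T" and ins: "\<And>t. 0 \<le> t \<Longrightarrow> t \<le> T \<Longrightarrow> x + t *\<^sub>R \<omega> \<in> \<Omega>" for \<omega> T
    proof -
      define h where "h k t = (\<integral>y. (u y \<bullet> \<omega>) * ?r k (y - (x + t *\<^sub>R \<omega>)) \<partial>lebesgue_on \<Omega>)" for k t
      have lim: "(\<lambda>k. \<bar>h k t\<bar>) \<longlonglongrightarrow> \<bar>u (x + t *\<^sub>R \<omega>) \<bullet> \<omega>\<bar>" if "0 \<le> t" "t \<le> T" for t
        unfolding h_def using that
        by (intro tendsto_rabs mollifier_limit[OF \<Omega> _ _ c\<phi> \<phi>0 supp I] continuous_intros cu ins)
      define S where "S = (\<lambda>t. x + t *\<^sub>R \<omega>) ` {0..T}"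
      have "compact S" unfolding S_def by (intro compact_continuous_image continuous_intros compact_Icc)
      moreover have "S \<subseteq> \<Omega>" using ins by (auto simp: S_def)
      ultimately obtain \<delta> where \<delta>: "0 < \<delta>" "(\<Union>y\<in>S. ball y \<delta>) \<subseteq> \<Omega>"
        using compact_subset_open_imp_ball_epsilon_subset[OF _ \<Omega>] by metis
      obtain k0 :: nat where k0: "1 / \<delta> < real k0" using reals_Archimedean2 by blast
      have "ennreal \<bar>u (x + 0 *\<^sub>R \<omega>) \<bullet> \<omega>\<bar> \<le> ennreal \<bar>u (x + T *\<^sub>R \<omega>) \<bullet> \<omega>\<bar> + L \<omega>"
        unfolding L_def
      proof (rule ennreal_limit_le_add_liminf[OF lim lim])
        show "\<forall>\<^sub>F k in sequentially. ennreal \<bar>h k 0\<bar> \<le> ennreal \<bar>h k T\<bar> + ennreal ((norm \<omega>)\<^sup>2) * W k \<omega>"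
          using eventually_ge_at_top[of k0]
        proof eventually_elim
          case (elim k)
          have "1 / \<delta> < real (Suc k)" using k0 elim by linarith
          then have k\<delta>: "1 / real (Suc k) < \<delta>" using \<delta>(1) by (simp add: field_simps)
          have sub: "cball (x + t *\<^sub>R \<omega>) (1 / real (Suc k)) \<subseteq> \<Omega>" if "0 \<le> t" "t \<le> T" for t
          proof -
            have "x + t *\<^sub>R \<omega> \<in> S" using that by (auto simp: S_def)
            then have "ball (x + t *\<^sub>R \<omega>) \<delta> \<subseteq> \<Omega>" using \<delta>(2) by blast
            moreover have "cball (x + t *\<^sub>R \<omega>) (1 / real (Suc k)) \<subseteq> ball (x + t *\<^sub>R \<omega>) \<delta>"
              using k\<delta> by auto
            ultimately show ?thesis by blast
          qed
          have "ennreal \<bar>h k 0\<bar> \<le> ennreal \<bar>h k T\<bar> + ennreal ((norm \<omega>)\<^sup>2) *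
              (\<integral>\<^sup>+t. indicator {0..T} t * (\<integral>\<^sup>+y. ennreal (F y * ?r k (y - (x + t *\<^sub>R \<omega>))) \<partial>lborel) \<partial>lborel)"
            unfolding h_def
            by (rule sym_grad_segment_estimate[OF \<Omega> cu G Ckr r0 rM _ T sub F FG]) (use rsupp in \<open>auto intro: less_imp_le\<close>)
          also have "\<dots> \<le> ennreal \<bar>h k T\<bar> + ennreal ((norm \<omega>)\<^sup>2) * W k \<omega>"
            unfolding W_def by (intro add_left_mono mult_left_mono nn_integral_mono mult_right_mono) (auto simp: indicator_def)
          finally show ?case .
        qed
      qed (use T in auto)
      then show ?thesis by simp
    qed
    have ray: "ennreal \<bar>u x \<bullet> \<omega>\<bar> \<le> ennreal (norm (u (exit_point \<Omega> x \<omega>))) * indicator (escapes \<Omega> x) \<omega> + L \<omega>"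
      if \<omega>: "norm \<omega> < 1" for \<omega>
    proof (cases "\<omega> \<in> escapes \<Omega> x")
      case True
      define \<tau> where "\<tau> = exit_time \<Omega> x \<omega>"
      note ep = exit_time_props[OF \<Omega> x True, folded \<tau>_def]
      \<comment> \<open>The segment estimate requires the closed segment to lie in \<Omega> and
        hence stops before \<tau>. Continuity of \<open>u\<close> on the closure carries it to the
        exit point.\<close>
      have le: "ennreal \<bar>u x \<bullet> \<omega>\<bar> \<le> ennreal \<bar>u (exit_point \<Omega> x \<omega>) \<bullet> \<omega>\<bar> + L \<omega>"
      proof (cases "L \<omega> = \<infinity>")
        case False
        then obtain l where l: "L \<omega> = ennreal l" "0 \<le> l" by (cases "L \<omega>") auto
        have ex: "exit_point \<Omega> x \<omega> = x + \<tau> *\<^sub>R \<omega>" by (simp add: exit_point_def \<tau>_def)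
        have "continuous_on {0..\<tau>} (\<lambda>t. x + t *\<^sub>R \<omega>)" by (intro continuous_intros)
        moreover have im: "(\<lambda>t. x + t *\<^sub>R \<omega>) ` {0..\<tau>} \<subseteq> closure \<Omega>"
        proof
          fix z assume "z \<in> (\<lambda>t. x + t *\<^sub>R \<omega>) ` {0..\<tau>}"
          then obtain t where t: "0 \<le> t" "t \<le> \<tau>" "z = x + t *\<^sub>R \<omega>" by auto
          show "z \<in> closure \<Omega>"
          proof (cases "t = \<tau>")
            case True
            then show ?thesis using t ep(5) ex by (simp add: frontier_def)
          next
            case False
            then show ?thesis using t ep(3)[of t] closure_subset by auto
          qed
        qed
        ultimately have "continuous_on {0..\<tau>} (\<lambda>t. u (x + t *\<^sub>R \<omega>))"
          by (rule continuous_on_compose2[OF cu'])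
        then have "continuous_on {0..\<tau>} (\<lambda>t. \<bar>u (x + t *\<^sub>R \<omega>) \<bullet> \<omega>\<bar> + l)" by (intro continuous_intros)
        then have "((\<lambda>t. \<bar>u (x + t *\<^sub>R \<omega>) \<bullet> \<omega>\<bar> + l) \<longlongrightarrow> \<bar>u (x + \<tau> *\<^sub>R \<omega>) \<bullet> \<omega>\<bar> + l) (at_left \<tau>)"
          by (rule continuous_on_Icc_at_leftD) (rule ep(1))
        moreover have "\<forall>\<^sub>F t in at_left \<tau>. \<bar>u x \<bullet> \<omega>\<bar> \<le> \<bar>u (x + t *\<^sub>R \<omega>) \<bullet> \<omega>\<bar> + l"
          using eventually_at_left_real[OF ep(1)]
        proof eventually_elim
          case (elim t)
          then have "ennreal \<bar>u x \<bullet> \<omega>\<bar> \<le> ennreal \<bar>u (x + t *\<^sub>R \<omega>) \<bullet> \<omega>\<bar> + L \<omega>"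
            by (intro seg) (auto intro: ep(3))
          then show ?case using l by (simp add: ennreal_plus[symmetric] del: ennreal_plus)
        qed
        ultimately have "\<bar>u x \<bullet> \<omega>\<bar> \<le> \<bar>u (x + \<tau> *\<^sub>R \<omega>) \<bullet> \<omega>\<bar> + l"
          by (intro tendsto_lowerbound) auto
        then show ?thesis
          using l by (simp add: ex ennreal_plus[symmetric] ennreal_leI del: ennreal_plus)
      qed simp
      have "\<bar>u (exit_point \<Omega> x \<omega>) \<bullet> \<omega>\<bar> \<le> norm (u (exit_point \<Omega> x \<omega>)) * norm \<omega>" by (rule Cauchy_Schwarz_ineq2)
      also have "\<dots> \<le> norm (u (exit_point \<Omega> x \<omega>))" using \<omega> by (intro mult_right_le_one_le) auto
      finally have "ennreal \<bar>u (exit_point \<Omega> x \<omega>) \<bullet> \<omega>\<bar> \<le> ennreal (norm (u (exit_point \<Omega> x \<omega>)))" by (rule ennreal_leI)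
      then show ?thesis using order_trans[OF le add_right_mono] True by simp
    next
      case False
      show ?thesis
      proof (cases "\<omega> = 0")
        case nz: False
        have ins: "x + t *\<^sub>R \<omega> \<in> \<Omega>" if "0 \<le> t" for t using False that by (auto simp: escapes_def)
        obtain R where R: "0 < R" "{y \<in> closure \<Omega>. u y \<noteq> 0} \<subseteq> ball 0 R"
          using u bounded_subset_ballD[of "{y \<in> closure \<Omega>. u y \<noteq> 0}" 0] by (auto simp: Cb_def)
        \<comment> \<open>Far enough along a ray that stays in \<Omega> to leave the bounded support
          of \<open>u\<close>; the end term vanishes there.\<close>
        define T where "T = (R + norm x) / norm \<omega>"
        have T: "0 \<le> T" using R by (simp add: T_def)
        have "norm (T *\<^sub>R \<omega>) = R + norm x" using nz R by (simp add: T_def)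
        then have "R \<le> norm (x + T *\<^sub>R \<omega>)" using norm_diff_ineq[of "T *\<^sub>R \<omega>" x] by (simp add: add.commute)
        moreover have "x + T *\<^sub>R \<omega> \<in> closure \<Omega>" using ins[OF T] closure_subset by blast
        ultimately have "u (x + T *\<^sub>R \<omega>) = 0" using R(2) by force
        then show ?thesis using seg[OF T ins] False by simp
      qed simp
    qed
    \<comment> \<open>\<open>u\<close> is arbitrary outside the closure and need not be Borel.
      \<open>v\<close> is, and it agrees with \<open>norm (u y)\<close> at exit points.\<close>
    define v where "v y = (if y \<in> closure \<Omega> then norm (u y) else 0)" for y
    have mv [measurable]: "v \<in> borel_measurable borel"
    proof -
      have "(\<lambda>y. indicator (closure \<Omega>) y *\<^sub>R norm (u y)) \<in> borel_measurable borel"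
        by (intro borel_measurable_continuous_on_indicator continuous_intros cu') auto
      moreover have "(\<lambda>y. indicator (closure \<Omega>) y *\<^sub>R norm (u y)) = v" by (auto simp: v_def indicator_def)
      ultimately show ?thesis by simp
    qed
    have esc [measurable]: "escapes \<Omega> x \<in> sets borel" by (rule borel_escapes[OF \<Omega>])
    have [measurable]: "exit_point \<Omega> x \<in> borel_measurable borel" by (rule borel_exit_point[OF \<Omega> x])
    have [measurable]: "ball (0 :: real^'n) 1 \<in> sets borel" by simp
    have uv: "ennreal (norm (u (exit_point \<Omega> x \<omega>))) * indicator (escapes \<Omega> x) \<omega>
        = ennreal (v (exit_point \<Omega> x \<omega>)) * indicator (escapes \<Omega> x) \<omega>" for \<omega>
      using exit_time_props(5)[OF \<Omega> x, of \<omega>] by (auto simp: v_def frontier_def indicator_def)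
    let ?B = "indicator (ball (0 :: real^'n) 1)"
    define bd where "bd = (\<integral>\<^sup>+\<omega>. ennreal (norm (u (exit_point \<Omega> x \<omega>))) * indicator (ball 0 1 \<inter> escapes \<Omega> x) \<omega> \<partial>lborel)"
    define vol where "vol = (\<integral>\<^sup>+y. ennreal (F y) * ennreal (norm (x - y) powr - d) \<partial>lborel)"
    \<comment> \<open>Exchanging integrals until \<open>y\<close> is outermost leaves, for each
      \<open>y\<close>, the averaged mollified kernel at \<open>z = y - x\<close>. The point
      \<open>y = x\<close>, excluded in \<open>kern\<close>, is a null set.\<close>
    have Wle: "(\<integral>\<^sup>+\<omega>. ?B \<omega> * (ennreal ((norm \<omega>)\<^sup>2) * W k \<omega>) \<partial>lborel) \<le> ennreal C1 * vol" for k
    proof -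
      have "(\<integral>\<^sup>+\<omega>. ?B \<omega> * (ennreal ((norm \<omega>)\<^sup>2) * W k \<omega>) \<partial>lborel)
          = (\<integral>\<^sup>+\<omega>. (\<integral>\<^sup>+y. ennreal (F y) * (?B \<omega> * ennreal ((norm \<omega>)\<^sup>2) *
              (\<integral>\<^sup>+t. indicator {0..} t * ennreal (?r k ((y - x) - t *\<^sub>R \<omega>)) \<partial>lborel)) \<partial>lborel) \<partial>lborel)"
      proof (intro nn_integral_cong)
        fix \<omega> :: "real^'n"
        have "W k \<omega> = (\<integral>\<^sup>+t. (\<integral>\<^sup>+y. ennreal (F y) * (indicator {0..} t * ennreal (?r k ((y - x) - t *\<^sub>R \<omega>))) \<partial>lborel) \<partial>lborel)"
          unfolding W_def
          by (intro nn_integral_cong, subst nn_integral_cmult[symmetric])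
            (auto intro!: nn_integral_cong simp: ennreal_mult F0 r0 mult_ac diff_diff_eq)
        also have "\<dots> = (\<integral>\<^sup>+y. (\<integral>\<^sup>+t. ennreal (F y) * (indicator {0..} t * ennreal (?r k ((y - x) - t *\<^sub>R \<omega>))) \<partial>lborel) \<partial>lborel)"
          unfolding indicator_def by (rule lborel_pair.Fubini') measurable
        also have "\<dots> = (\<integral>\<^sup>+y. ennreal (F y) * (\<integral>\<^sup>+t. indicator {0..} t * ennreal (?r k ((y - x) - t *\<^sub>R \<omega>)) \<partial>lborel) \<partial>lborel)"
          by (intro nn_integral_cong nn_integral_cmult) measurable
        finally have "?B \<omega> * (ennreal ((norm \<omega>)\<^sup>2) * W k \<omega>) = (?B \<omega> * ennreal ((norm \<omega>)\<^sup>2)) *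
            (\<integral>\<^sup>+y. ennreal (F y) * (\<integral>\<^sup>+t. indicator {0..} t * ennreal (?r k ((y - x) - t *\<^sub>R \<omega>)) \<partial>lborel) \<partial>lborel)"
          by (simp add: mult.assoc)
        also have "\<dots> = (\<integral>\<^sup>+y. (?B \<omega> * ennreal ((norm \<omega>)\<^sup>2)) *
            (ennreal (F y) * (\<integral>\<^sup>+t. indicator {0..} t * ennreal (?r k ((y - x) - t *\<^sub>R \<omega>)) \<partial>lborel)) \<partial>lborel)"
          unfolding indicator_def by (rule nn_integral_cmult[symmetric]) measurable
        also have "\<dots> = (\<integral>\<^sup>+y. ennreal (F y) * (?B \<omega> * ennreal ((norm \<omega>)\<^sup>2) *
              (\<integral>\<^sup>+t. indicator {0..} t * ennreal (?r k ((y - x) - t *\<^sub>R \<omega>)) \<partial>lborel)) \<partial>lborel)"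
          by (intro nn_integral_cong) (simp only: mult_ac)
        finally show "?B \<omega> * (ennreal ((norm \<omega>)\<^sup>2) * W k \<omega>) = \<dots>" .
      qed
      also have "\<dots> = (\<integral>\<^sup>+y. (\<integral>\<^sup>+\<omega>. ennreal (F y) * (?B \<omega> * ennreal ((norm \<omega>)\<^sup>2) *
              (\<integral>\<^sup>+t. indicator {0..} t * ennreal (?r k ((y - x) - t *\<^sub>R \<omega>)) \<partial>lborel)) \<partial>lborel) \<partial>lborel)"
        unfolding indicator_def by (rule lborel_pair.Fubini') measurable
      also have "\<dots> = (\<integral>\<^sup>+y. ennreal (F y) * (\<integral>\<^sup>+\<omega>. ?B \<omega> * ennreal ((norm \<omega>)\<^sup>2) *
              (\<integral>\<^sup>+t. indicator {0..} t * ennreal (?r k ((y - x) - t *\<^sub>R \<omega>)) \<partial>lborel) \<partial>lborel) \<partial>lborel)"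
        unfolding indicator_def by (intro nn_integral_cong nn_integral_cmult) measurable
      also have "\<dots> \<le> (\<integral>\<^sup>+y. ennreal C1 * (ennreal (F y) * ennreal (norm (x - y) powr - d)) \<partial>lborel)"
      proof (rule nn_integral_mono_AE)
        have "AE y in lborel. y \<noteq> x" by (rule AE_lborel_singleton)
        then show "AE y in lborel. ennreal (F y) * (\<integral>\<^sup>+\<omega>. ?B \<omega> * ennreal ((norm \<omega>)\<^sup>2) *
              (\<integral>\<^sup>+t. indicator {0..} t * ennreal (?r k ((y - x) - t *\<^sub>R \<omega>)) \<partial>lborel) \<partial>lborel)
            \<le> ennreal C1 * (ennreal (F y) * ennreal (norm (x - y) powr - d))"
        proof eventually_elim
          case (elim y)
          then have "ennreal (F y) * (\<integral>\<^sup>+\<omega>. ?B \<omega> * ennreal ((norm \<omega>)\<^sup>2) *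
              (\<integral>\<^sup>+t. indicator {0..} t * ennreal (?r k ((y - x) - t *\<^sub>R \<omega>)) \<partial>lborel) \<partial>lborel)
            \<le> ennreal (F y) * ennreal (C1 * norm (y - x) powr - d)"
            by (intro mult_left_mono kern) auto
          also have "\<dots> = ennreal C1 * (ennreal (F y) * ennreal (norm (x - y) powr - d))"
            using C1 by (simp add: ennreal_mult norm_minus_commute mult_ac)
          finally show ?case .
        qed
      qed
      also have "\<dots> = ennreal C1 * vol" unfolding vol_def by (rule nn_integral_cmult) measurable
      finally show ?thesis .
    qed
    have "ennreal (c0 * norm (u x)) \<le> (\<integral>\<^sup>+\<omega>. ennreal \<bar>u x \<bullet> \<omega>\<bar> * ?B \<omega> \<partial>lborel)"
      unfolding c0_def by (rule nn_integral_abs_inner_ge)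
    also have "\<dots> \<le> (\<integral>\<^sup>+\<omega>. ennreal (v (exit_point \<Omega> x \<omega>)) * indicator (escapes \<Omega> x) \<omega> * ?B \<omega> + ?B \<omega> * L \<omega> \<partial>lborel)"
    proof (intro nn_integral_mono)
      fix \<omega> :: "real^'n"
      show "ennreal \<bar>u x \<bullet> \<omega>\<bar> * ?B \<omega> \<le> ennreal (v (exit_point \<Omega> x \<omega>)) * indicator (escapes \<Omega> x) \<omega> * ?B \<omega> + ?B \<omega> * L \<omega>"
        using ray[of \<omega>] unfolding uv by (cases "norm \<omega> < 1") auto
    qed
    also have "\<dots> = (\<integral>\<^sup>+\<omega>. ennreal (v (exit_point \<Omega> x \<omega>)) * indicator (escapes \<Omega> x) \<omega> * ?B \<omega> \<partial>lborel) + (\<integral>\<^sup>+\<omega>. ?B \<omega> * L \<omega> \<partial>lborel)"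
      unfolding L_def by (rule nn_integral_add) measurable
    also have "(\<integral>\<^sup>+\<omega>. ennreal (v (exit_point \<Omega> x \<omega>)) * indicator (escapes \<Omega> x) \<omega> * ?B \<omega> \<partial>lborel) = bd"
      unfolding bd_def uv[symmetric] by (intro nn_integral_cong) (simp add: indicator_inter_arith mult_ac)
    also have "(\<integral>\<^sup>+\<omega>. ?B \<omega> * L \<omega> \<partial>lborel) \<le> (\<integral>\<^sup>+\<omega>. liminf (\<lambda>k. ?B \<omega> * (ennreal ((norm \<omega>)\<^sup>2) * W k \<omega>)) \<partial>lborel)"
      unfolding L_def by (intro nn_integral_mono) (auto simp: indicator_def)
    also have "\<dots> \<le> liminf (\<lambda>k. \<integral>\<^sup>+\<omega>. ?B \<omega> * (ennreal ((norm \<omega>)\<^sup>2) * W k \<omega>) \<partial>lborel)"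
      by (rule nn_integral_liminf) measurable
    also have "\<dots> \<le> liminf (\<lambda>k::nat. ennreal C1 * vol)"
      by (intro Liminf_mono always_eventually allI Wle)
    also have "\<dots> = ennreal C1 * vol" by (rule Liminf_const) simp
    finally have le: "ennreal (c0 * norm (u x)) \<le> bd + ennreal C1 * vol" by (simp add: add_left_mono)
    have "ennreal (norm (u x)) = ennreal (1 / c0) * ennreal (c0 * norm (u x))"
      using c0 by (simp add: ennreal_mult[symmetric])
    also have "\<dots> \<le> ennreal (1 / c0) * (bd + ennreal C1 * vol)"
      by (intro mult_left_mono le) auto
    also have "\<dots> \<le> ennreal (1 / c0) * (ennreal (max 1 C1) * bd + ennreal (max 1 C1) * vol)"
    proof (intro mult_left_mono add_mono)
      have "1 * bd \<le> ennreal (max 1 C1) * bd" by (intro mult_right_mono) (auto simp: ennreal_leI simp flip: ennreal_1)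
      then show "bd \<le> ennreal (max 1 C1) * bd" by simp
      show "ennreal C1 * vol \<le> ennreal (max 1 C1) * vol" by (intro mult_right_mono ennreal_leI) auto
    qed auto
    also have "\<dots> = ennreal C * (vol + bd)"
      unfolding C_def using c0
      by (simp add: distrib_left[symmetric] mult.assoc[symmetric] ennreal_mult[symmetric] add.commute)
    finally show ?thesis by (simp add: vol_def bd_def)
  qed
  show thesis
    by (rule that[OF C]) (rule main[unfolded d_def], blast+)
qed

section \<open>The Sobolev trace inequality\<close>

lemma Lp_norm_le:
  assumes "(\<integral>\<^sup>+x. ennreal (norm (f x) powr p) \<partial>M) \<le> ennreal K" "0 < p"
  shows "Lp_norm M p f \<le> ennreal (K powr (1 / p))"
proof (cases "0 \<le> K")
  case True
  define I where "I = (\<integral>\<^sup>+x. ennreal (norm (f x) powr p) \<partial>M)"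
  have I: "I < \<infinity>" unfolding I_def using assms(1) by (rule le_less_trans) simp
  have "enn2real I \<le> K" using assms(1) True by (auto simp: I_def[symmetric] intro: enn2real_leI)
  then have "enn2real I powr (1 / p) \<le> K powr (1 / p)" using assms(2) by (intro powr_mono2) auto
  then show ?thesis using I by (auto simp: Lp_norm_def I_def[symmetric] Let_def ennreal_leI)
next
  case False
  then have "(\<integral>\<^sup>+x. ennreal (norm (f x) powr p) \<partial>M) = 0" using assms(1) by (simp add: ennreal_neg)
  then show ?thesis using assms(2) by (simp add: Lp_norm_def)
qed

lemma Lp_norm_eqD:
  assumes "Lp_norm M p f = ennreal g" "0 \<le> g" "0 < p"
  shows "(\<integral>\<^sup>+x. ennreal (norm (f x) powr p) \<partial>M) = ennreal (g powr p)"
proof -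
  define I where "I = (\<integral>\<^sup>+x. ennreal (norm (f x) powr p) \<partial>M)"
  have fin: "I \<noteq> \<infinity>" using assms(1) by (auto simp: Lp_norm_def I_def[symmetric] Let_def split: if_splits)
  then have "ennreal (enn2real I powr (1 / p)) = ennreal g"
    using assms(1) by (simp add: Lp_norm_def I_def[symmetric] Let_def)
  then have "enn2real I powr (1 / p) = g" using assms(2) by simp
  then have "g powr p = enn2real I" using assms(3) by (auto simp: powr_powr)
  then show ?thesis using fin by (simp add: I_def[symmetric] less_top)
qed

text \<open>Integrability on compact subsets gives measurability there, and an open set is a
  countable union of compact sets.\<close>

lemma L1_loc_borel_measurable:
  fixes G :: "'a::euclidean_space \<Rightarrow> 'b::euclidean_space"
  assumes \<Omega>: "open \<Omega>" and G: "G \<in> L1_loc \<Omega>"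
  shows "G \<in> borel_measurable (lebesgue_on \<Omega>)"
proof -
  obtain K where K: "\<And>n::nat. compact (K n)" "\<And>n. K n \<subseteq> \<Omega>" "\<Union>(range K) = \<Omega>"
    using open_Union_compact_subsets[OF \<Omega>] by metis
  show ?thesis
  proof (rule measurable_piecewise_restrict[of "range K"])
    fix A assume "A \<in> range K"
    then obtain n where A: "A = K n" by auto
    have m: "K n \<in> sets lebesgue" using compact_imp_closed[OF K(1)] by auto
    then show "A \<inter> space (lebesgue_on \<Omega>) \<in> sets (lebesgue_on \<Omega>)"
      using \<Omega> K(2)[of n] by (auto simp: A sets_restrict_space image_iff intro!: bexI[of _ "K n"])
    have "restrict_space (lebesgue_on \<Omega>) A = lebesgue_on A"
      using \<Omega> m K(2)[of n] by (subst restrict_restrict_space) (auto simp: A Int_absorb1)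
    then show "G \<in> borel_measurable (restrict_space (lebesgue_on \<Omega>) A)"
      using G K(1,2) by (auto simp: A L1_loc_def intro: borel_measurable_integrable)
  qed (use K(3) in auto)
qed

text \<open>A ball that meets \<Omega> at \<open>x\<close> lies in the ball about \<open>x\<close>
  of twice the radius; this is the factor \<open>2 powr \<alpha>\<close>.\<close>

lemma upper_regular_distr:
  fixes \<mu> :: "'a::euclidean_space measure"
  assumes \<mu>: "sets \<mu> = sets (restrict_space borel \<Omega>)" and C: "0 < C" and \<alpha>: "0 < \<alpha>"
    and growth: "\<forall>x\<in>\<Omega>. \<forall>r>0. emeasure \<mu> (ball x r \<inter> \<Omega>) \<le> ennreal (C * r powr \<alpha>)"
  shows "upper_regular (C * 2 powr \<alpha>) \<alpha> (distr \<mu> borel (\<lambda>x. x))"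
proof -
  have sp: "space \<mu> = \<Omega>" using sets_eq_imp_space_eq[OF \<mu>] by (simp add: space_restrict_space)
  have id: "(\<lambda>x. x) \<in> measurable \<mu> borel"
    unfolding measurable_cong_sets[OF \<mu> refl] by (rule measurable_restrict_space1) simp
  have "emeasure (distr \<mu> borel (\<lambda>x. x)) (ball y r) \<le> ennreal (C * 2 powr \<alpha> * r powr \<alpha>)" if r: "0 < r" for y r
  proof -
    have eq: "emeasure (distr \<mu> borel (\<lambda>x. x)) (ball y r) = emeasure \<mu> (ball y r \<inter> \<Omega>)"
      using id by (subst emeasure_distr) (auto simp: sp)
    show ?thesis
    proof (cases "ball y r \<inter> \<Omega> = {}")
      case False
      then obtain x where x: "x \<in> \<Omega>" "dist y x < r" by auto
      have "ball y r \<subseteq> ball x (2 * r)"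
      proof
        fix z assume "z \<in> ball y r"
        then show "z \<in> ball x (2 * r)" using x(2) dist_triangle[of x z y] by (simp add: dist_commute)
      qed
      then have "emeasure \<mu> (ball y r \<inter> \<Omega>) \<le> emeasure \<mu> (ball x (2 * r) \<inter> \<Omega>)"
        by (intro emeasure_mono) (auto simp: \<mu> sets_restrict_space)
      also have "\<dots> \<le> ennreal (C * (2 * r) powr \<alpha>)" using growth x(1) r by auto
      also have "C * (2 * r) powr \<alpha> = C * 2 powr \<alpha> * r powr \<alpha>" using r by (simp add: powr_mult)
      finally show ?thesis by (simp add: eq)
    qed (simp add: eq)
  qed
  then show ?thesis by (simp add: upper_regular_def)
qed

text \<open>\<open>G\<close> is only Lebesgue measurable and arbitrary outside \<Omega>, while the
  exchange of integrals is carried out with Borel functions on the whole space. Extending its norm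
  by zero and correcting it on a null set makes this possible without changing any integral.\<close>

lemma borel_representative_norm:
  fixes G :: "'a::euclidean_space \<Rightarrow> 'b::euclidean_space"
  assumes \<Omega>: "open \<Omega>" and G: "G \<in> L1_loc \<Omega>"
  obtains F where "F \<in> borel_measurable borel" "\<And>y. 0 \<le> F y" "AE y in lebesgue_on \<Omega>. F y = norm (G y)"
    "\<And>p. (\<integral>\<^sup>+y. ennreal (F y powr p) \<partial>lborel) = (\<integral>\<^sup>+y. ennreal (norm (G y) powr p) \<partial>lebesgue_on \<Omega>)"
proof -
  have \<Omega>m: "\<Omega> \<in> sets lebesgue" using \<Omega> by auto
  define f where "f y = (if y \<in> \<Omega> then norm (G y) else 0)" for y
  have "(\<lambda>y. norm (G y)) \<in> borel_measurable (lebesgue_on \<Omega>)"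
    using L1_loc_borel_measurable[OF \<Omega> G] by measurable
  then have "f \<in> borel_measurable lebesgue"
    unfolding f_def using \<Omega>m by (simp add: borel_measurable_if)
  then obtain g where g: "g \<in> borel_measurable lborel" "AE y in lborel. f y = g y"
    using completion_ex_borel_measurable_real[of f lborel] by auto
  have ae: "AE y in lborel. f y = \<bar>g y\<bar>" using g(2)
  proof eventually_elim
    case (elim y)
    have "0 \<le> f y" by (simp add: f_def)
    then show ?case using elim by simp
  qed
  then have ae': "AE y in lebesgue. f y = \<bar>g y\<bar>" by (rule AE_completion)
  show thesis
  proof (rule that[of "\<lambda>y. \<bar>g y\<bar>"])
    show "(\<lambda>y. \<bar>g y\<bar>) \<in> borel_measurable borel" using g(1) by simp
    show "AE y in lebesgue_on \<Omega>. \<bar>g y\<bar> = norm (G y)"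
      using ae' \<Omega>m by (subst AE_restrict_space_iff) (auto simp: f_def elim: eventually_mono)
    show "(\<integral>\<^sup>+y. ennreal (\<bar>g y\<bar> powr p) \<partial>lborel) = (\<integral>\<^sup>+y. ennreal (norm (G y) powr p) \<partial>lebesgue_on \<Omega>)" for p
    proof -
      have "(\<integral>\<^sup>+y. ennreal (\<bar>g y\<bar> powr p) \<partial>lborel) = (\<integral>\<^sup>+y. ennreal (\<bar>g y\<bar> powr p) \<partial>lebesgue)"
        by (rule nn_integral_completion[symmetric])
      also have "\<dots> = (\<integral>\<^sup>+y. ennreal (norm (G y) powr p) * indicator \<Omega> y \<partial>lebesgue)"
      proof (rule nn_integral_cong_AE)
        show "AE y in lebesgue. ennreal (\<bar>g y\<bar> powr p) = ennreal (norm (G y) powr p) * indicator \<Omega> y"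
          using ae' by eventually_elim (auto simp: f_def split: if_splits)
      qed
      also have "\<dots> = (\<integral>\<^sup>+y. ennreal (norm (G y) powr p) \<partial>lebesgue_on \<Omega>)"
        using \<Omega>m by (subst nn_integral_restrict_space) auto
      finally show ?thesis .
    qed
  qed simp
qed

text \<open>The boundary datum is cut at \<open>t\<close> while it is still averaged over
  directions: the low part then costs at most \<open>t\<close> times the volume of the unit ball.
  The Hausdorff kernel, whose integral over the boundary may be infinite, receives the high part
  alone.\<close>

lemma sym_grad_level_estimate:
  assumes n: "2 \<le> CARD('n::finite)"
  obtains C where "0 < C" and
    "\<And>(\<Omega> :: (real^'n) set) u G F x t. open \<Omega> \<Longrightarrow> u \<in> Cb (closure \<Omega>) \<Longrightarrow> is_sym_grad \<Omega> u G \<Longrightarrow>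
      F \<in> borel_measurable borel \<Longrightarrow> (\<And>y. 0 \<le> F y) \<Longrightarrow> (AE y in lebesgue_on \<Omega>. F y = norm (G y)) \<Longrightarrow> x \<in> \<Omega> \<Longrightarrow> 0 < t \<Longrightarrow>
      ennreal (norm (u x)) \<le> ennreal C *
        ((\<integral>\<^sup>+y. ennreal (F y) * ennreal (norm (x - y) powr - (real CARD('n) - 1)) \<partial>lborel) + ennreal t +
         (\<integral>\<^sup>+y. ennreal (norm (u y) * indicator (frontier \<Omega>) y) * indicator {y. t < norm (u y) * indicator (frontier \<Omega>) y} y
            * ennreal (norm (x - y) powr - (real CARD('n) - 1)) \<partial>hausdorff_measure (real CARD('n) - 1)))"
proof -
  have n': "2 \<le> DIM(real^'n)" using n by simp
  define d where "d = real CARD('n) - 1"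
  obtain CP where CP: "0 < CP" and pw:
    "\<And>(\<Omega> :: (real^'n) set) u G F x. open \<Omega> \<Longrightarrow> u \<in> Cb (closure \<Omega>) \<Longrightarrow> is_sym_grad \<Omega> u G \<Longrightarrow>
      F \<in> borel_measurable borel \<Longrightarrow> (\<And>y. 0 \<le> F y) \<Longrightarrow> (AE y in lebesgue_on \<Omega>. F y = norm (G y)) \<Longrightarrow> x \<in> \<Omega> \<Longrightarrow>
      ennreal (norm (u x)) \<le> ennreal CP *
        ((\<integral>\<^sup>+y. ennreal (F y) * ennreal (norm (x - y) powr - d) \<partial>lborel)
        + (\<integral>\<^sup>+\<omega>. ennreal (norm (u (exit_point \<Omega> x \<omega>))) * indicator (ball 0 1 \<inter> escapes \<Omega> x) \<omega> \<partial>lborel))"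
    unfolding d_def by (rule sym_grad_pointwise_estimate[OF n]) blast
  obtain CB where CB: "0 < CB" and bdry:
    "\<And>(\<Omega>::(real^'n) set) x w. open \<Omega> \<Longrightarrow> x \<in> \<Omega> \<Longrightarrow> w \<in> borel_measurable borel \<Longrightarrow>
      (\<integral>\<^sup>+\<omega>. w (exit_point \<Omega> x \<omega>) * indicator (ball 0 1 \<inter> escapes \<Omega> x) \<omega> \<partial>lborel) \<le>
      ennreal CB * (\<integral>\<^sup>+y. w y * indicator (frontier \<Omega>) y * ennreal (norm (x - y) powr - d) \<partial>hausdorff_measure d)"
    using nn_integral_exit_le_hausdorff[OF n'] unfolding d_def by simp blast
  define b where "b = measure lborel (ball (0::real^'n) 1)"
  have b: "emeasure lborel (ball (0::real^'n) 1) = ennreal b" by (simp add: b_def emeasure_ball measure_def)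
  \<comment> \<open>A common coefficient for the potential (1), the level (\<open>b\<close>) and the
    high boundary part (\<open>CB\<close>).\<close>
  define c where "c = max 1 (max b CB)"
  have c: "1 \<le> c" "b \<le> c" "CB \<le> c" by (auto simp: c_def)
  have main: "ennreal (norm (u x)) \<le> ennreal (CP * c) *
        ((\<integral>\<^sup>+y. ennreal (F y) * ennreal (norm (x - y) powr - d) \<partial>lborel) + ennreal t +
         (\<integral>\<^sup>+y. ennreal (norm (u y) * indicator (frontier \<Omega>) y) * indicator {y. t < norm (u y) * indicator (frontier \<Omega>) y} y
            * ennreal (norm (x - y) powr - d) \<partial>hausdorff_measure d))"
    if \<Omega>: "open \<Omega>" and u: "u \<in> Cb (closure \<Omega>)" and G: "is_sym_grad \<Omega> u G"
      and F: "F \<in> borel_measurable borel" "\<And>y. 0 \<le> F y" "AE y in lebesgue_on \<Omega>. F y = norm (G y)"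
      and x: "x \<in> \<Omega>" and t: "0 < t"
    for \<Omega> :: "(real^'n) set" and u G F x t
  proof -
    define w where "w y = norm (u y) * indicator (frontier \<Omega>) y" for y
    have [measurable]: "w \<in> borel_measurable borel"
    proof -
      have "continuous_on (frontier \<Omega>) u"
        using u by (auto simp: Cb_def frontier_def intro: continuous_on_subset)
      then have "(\<lambda>y. indicator (frontier \<Omega>) y *\<^sub>R norm (u y)) \<in> borel_measurable borel"
        by (intro borel_measurable_continuous_on_indicator continuous_intros) auto
      then show ?thesis by (simp add: w_def[abs_def] mult.commute)
    qed
    have [measurable]: "exit_point \<Omega> x \<in> borel_measurable borel" by (rule borel_exit_point[OF \<Omega> x])
    have S [measurable]: "ball 0 1 \<inter> escapes \<Omega> x \<in> sets borel" using borel_escapes[OF \<Omega>] by auto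
    let ?S = "indicator (ball 0 1 \<inter> escapes \<Omega> x) :: real^'n \<Rightarrow> ennreal"
    let ?v = "\<lambda>y. ennreal (w y) * indicator {y. t < w y} y"
    let ?J = "\<integral>\<^sup>+y. ?v y * ennreal (norm (x - y) powr - d) \<partial>hausdorff_measure d"
    let ?V = "\<integral>\<^sup>+y. ennreal (F y) * ennreal (norm (x - y) powr - d) \<partial>lborel"
    have "(\<integral>\<^sup>+\<omega>. ennreal (norm (u (exit_point \<Omega> x \<omega>))) * ?S \<omega> \<partial>lborel)
        \<le> (\<integral>\<^sup>+\<omega>. ennreal t * ?S \<omega> + ?v (exit_point \<Omega> x \<omega>) * ?S \<omega> \<partial>lborel)"
    proof (intro nn_integral_mono)
      fix \<omega>
      show "ennreal (norm (u (exit_point \<Omega> x \<omega>))) * ?S \<omega> \<le> ennreal t * ?S \<omega> + ?v (exit_point \<Omega> x \<omega>) * ?S \<omega>"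
      proof (cases "\<omega> \<in> ball 0 1 \<inter> escapes \<Omega> x")
        case True
        then have "w (exit_point \<Omega> x \<omega>) = norm (u (exit_point \<Omega> x \<omega>))"
          using exit_time_props(5)[OF \<Omega> x, of \<omega>] by (simp add: w_def)
        then show ?thesis using True by (cases "t < w (exit_point \<Omega> x \<omega>)") (auto intro: ennreal_leI)
      qed simp
    qed
    also have "\<dots> = (\<integral>\<^sup>+\<omega>. ennreal t * ?S \<omega> \<partial>lborel) + (\<integral>\<^sup>+\<omega>. ?v (exit_point \<Omega> x \<omega>) * ?S \<omega> \<partial>lborel)"
      by (rule nn_integral_add) measurable
    also have "\<dots> \<le> ennreal t * ennreal b + ennreal CB * ?J"
    proof (rule add_mono)
      have "(\<integral>\<^sup>+\<omega>. ennreal t * ?S \<omega> \<partial>lborel) = ennreal t * emeasure lborel (ball 0 1 \<inter> escapes \<Omega> x)"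
        by (rule nn_integral_cmult_indicator) simp
      also have "\<dots> \<le> ennreal t * ennreal b"
        unfolding b[symmetric] by (intro mult_left_mono emeasure_mono) auto
      finally show "(\<integral>\<^sup>+\<omega>. ennreal t * ?S \<omega> \<partial>lborel) \<le> ennreal t * ennreal b" .
      have "(\<integral>\<^sup>+\<omega>. ?v (exit_point \<Omega> x \<omega>) * ?S \<omega> \<partial>lborel)
          \<le> ennreal CB * (\<integral>\<^sup>+y. ?v y * indicator (frontier \<Omega>) y * ennreal (norm (x - y) powr - d) \<partial>hausdorff_measure d)"
        by (rule bdry[OF \<Omega> x]) measurable
      also have "\<dots> \<le> ennreal CB * ?J"
        by (intro mult_left_mono nn_integral_mono mult_right_mono) (auto simp: indicator_def)
      finally show "(\<integral>\<^sup>+\<omega>. ?v (exit_point \<Omega> x \<omega>) * ?S \<omega> \<partial>lborel) \<le> ennreal CB * ?J" .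
    qed
    also have "\<dots> \<le> ennreal t * ennreal c + ennreal c * ?J"
      using c by (intro add_mono mult_left_mono mult_right_mono ennreal_leI) auto
    finally have bd: "(\<integral>\<^sup>+\<omega>. ennreal (norm (u (exit_point \<Omega> x \<omega>))) * ?S \<omega> \<partial>lborel) \<le> ennreal c * (ennreal t + ?J)"
      by (simp add: distrib_left mult.commute)
    have "1 * ?V \<le> ennreal c * ?V" using c by (intro mult_right_mono) (auto simp: ennreal_leI simp flip: ennreal_1)
    then have V: "?V \<le> ennreal c * ?V" by simp
    have "ennreal (norm (u x)) \<le> ennreal CP * (?V + (\<integral>\<^sup>+\<omega>. ennreal (norm (u (exit_point \<Omega> x \<omega>))) * ?S \<omega> \<partial>lborel))"
      by (rule pw[OF \<Omega> u G F x])
    also have "\<dots> \<le> ennreal CP * (ennreal c * ?V + ennreal c * (ennreal t + ?J))"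
      by (intro mult_left_mono add_mono V bd) auto
    also have "\<dots> = ennreal (CP * c) * (?V + ennreal t + ?J)"
      using CP c by (simp add: ennreal_mult distrib_left mult.assoc add.assoc)
    finally show ?thesis by (simp add: w_def)
  qed
  show thesis
  proof (rule that[of "CP * c"])
    show "0 < CP * c" using CP c by simp
  qed (rule main[unfolded d_def], blast+)
qed

text \<open>\<open>C\<close> is chosen before \<Omega>, \<mu> and \<open>u\<close>, which expresses
  on what it may depend. The inequality is stated for every \<open>G\<close> representing the
  symmetric gradient, so no representative has to be selected.\<close>

theorem theorem4p1:
  fixes p \<alpha> C\<^sub>\<mu> :: real
  assumes "2 \<le> CARD('n::finite)"
    and "real CARD('n) - 1 < \<alpha>" and "\<alpha> \<le> real CARD('n)"
    and "0 < C\<^sub>\<mu>"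
    and "1 < p" and "p < real CARD('n)"
  shows "\<exists>C::real. 0 < C \<and>
    (\<forall>(\<Omega> :: (real^'n) set) (\<mu> :: (real^'n) measure).
      open \<Omega> \<longrightarrow>
      sets \<mu> = sets (restrict_space borel \<Omega>) \<longrightarrow>
      (\<forall>x\<in>\<Omega>. \<forall>r>0. emeasure \<mu> (ball x r \<inter> \<Omega>) \<le> ennreal (C\<^sub>\<mu> * r powr \<alpha>)) \<longrightarrow>
      (\<forall>u \<in> E1p p \<Omega> \<inter> Cb (closure \<Omega>). \<forall>G. is_sym_grad \<Omega> u G \<longrightarrow>
        Lp_norm \<mu> (\<alpha> * p / (real CARD('n) - p)) u \<le>
          ennreal C * (Lp_norm (lebesgue_on \<Omega>) p G +
            Lp_norm (restrict_space (hausdorff_measure (real CARD('n) - 1)) (frontier \<Omega>))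
              (p * (real CARD('n) - 1) / (real CARD('n) - p)) u)))"
proof -
  define d where "d = real CARD('n) - 1"
  define q where "q = \<alpha> * p / (real CARD('n) - p)"
  define s where "s = p * d / (real CARD('n) - p)"
  let ?H = "hausdorff_measure d :: (real^'n) measure"
  have d: "1 \<le> d" using assms by (simp add: d_def)
  have \<alpha>: "0 < \<alpha>" using assms d by (simp add: d_def)
  have q: "0 < q" using assms \<alpha> by (simp add: q_def)
  have s: "0 < s" using assms d by (simp add: s_def)
  obtain C1 where C1: "0 < C1" and level:
    "\<And>(\<Omega> :: (real^'n) set) u G F x t. open \<Omega> \<Longrightarrow> u \<in> Cb (closure \<Omega>) \<Longrightarrow> is_sym_grad \<Omega> u G \<Longrightarrow>
      F \<in> borel_measurable borel \<Longrightarrow> (\<And>y. 0 \<le> F y) \<Longrightarrow> (AE y in lebesgue_on \<Omega>. F y = norm (G y)) \<Longrightarrow> x \<in> \<Omega> \<Longrightarrow> 0 < t \<Longrightarrow>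
      ennreal (norm (u x)) \<le> ennreal C1 *
        ((\<integral>\<^sup>+y. ennreal (F y) * ennreal (norm (x - y) powr - d) \<partial>lborel) + ennreal t +
         (\<integral>\<^sup>+y. ennreal (norm (u y) * indicator (frontier \<Omega>) y) * indicator {y. t < norm (u y) * indicator (frontier \<Omega>) y} y
            * ennreal (norm (x - y) powr - d) \<partial>?H))"
    unfolding d_def by (rule sym_grad_level_estimate[OF assms(1)]) blast
  define K where "K = C\<^sub>\<mu> * 2 powr \<alpha>"
  have dims: "2 \<le> DIM(real^'n)" "real DIM(real^'n) - 1 < \<alpha>" "0 \<le> K" "p < real DIM(real^'n)"
    using assms by (auto simp: K_def)
  obtain C2 where C2: "0 < C2" and strong:
    "\<And>(M :: (real^'n) measure) H F w v. upper_regular K \<alpha> M \<Longrightarrow> sets H = sets borel \<Longrightarrow>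
      F \<in> borel_measurable borel \<Longrightarrow> w \<in> borel_measurable borel \<Longrightarrow> v \<in> borel_measurable borel \<Longrightarrow>
      (\<And>y. 0 \<le> F y) \<Longrightarrow> (\<And>y. 0 \<le> w y) \<Longrightarrow> (\<And>y. 0 \<le> v y) \<Longrightarrow>
      (\<integral>\<^sup>+y. ennreal (F y powr p) \<partial>lborel) \<le> 1 \<Longrightarrow>
      (\<integral>\<^sup>+y. ennreal (w y powr s) \<partial>H) \<le> 1 \<Longrightarrow>
      bounded {x. v x \<noteq> 0} \<Longrightarrow>
      (\<And>x t. 0 < t \<Longrightarrow> ennreal (v x) \<le> ennreal C1 *
        ((\<integral>\<^sup>+y. ennreal (F y) * ennreal (norm (x - y) powr - d) \<partial>lborel) + ennreal t +
         (\<integral>\<^sup>+y. ennreal (w y) * indicator {y. t < w y} y * ennreal (norm (x - y) powr - d) \<partial>H))) \<Longrightarrow>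
      (\<integral>\<^sup>+x. ennreal (v x powr q) \<partial>M) \<le> ennreal C2"
    using potential_strong_bound[OF dims(1-3) assms(5) dims(4) C1] unfolding d_def s_def q_def
    by simp blast
  define C where "C = C2 powr (1 / q)"
  have C: "0 < C" using C2 by (simp add: C_def)
  have main: "Lp_norm \<mu> q u \<le> ennreal C * (Lp_norm (lebesgue_on \<Omega>) p G + Lp_norm (restrict_space ?H (frontier \<Omega>)) s u)"
    if \<Omega>: "open \<Omega>" and \<mu>: "sets \<mu> = sets (restrict_space borel \<Omega>)"
      and growth: "\<forall>x\<in>\<Omega>. \<forall>r>0. emeasure \<mu> (ball x r \<inter> \<Omega>) \<le> ennreal (C\<^sub>\<mu> * r powr \<alpha>)"
      and u: "u \<in> Cb (closure \<Omega>)" and G: "is_sym_grad \<Omega> u G"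
    for \<Omega> :: "(real^'n) set" and \<mu> u G
  proof (cases "Lp_norm (lebesgue_on \<Omega>) p G = \<infinity> \<or> Lp_norm (restrict_space ?H (frontier \<Omega>)) s u = \<infinity>")
    case True
    then show ?thesis using C by (auto simp: ennreal_mult_top)
  next
    case False
    then obtain g h where g: "Lp_norm (lebesgue_on \<Omega>) p G = ennreal g" "0 \<le> g"
      and h: "Lp_norm (restrict_space ?H (frontier \<Omega>)) s u = ennreal h" "0 \<le> h"
      by (metis ennreal_cases infinity_ennreal_def)
    \<comment> \<open>\<mu> extended by zero to a Borel measure on the whole space.\<close>
    define M where "M = distr \<mu> borel (\<lambda>x. x)"
    have M: "upper_regular K \<alpha> M"
      unfolding M_def K_def by (rule upper_regular_distr[OF \<mu> assms(4) \<alpha> growth])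
    have sp: "space \<mu> = \<Omega>" using sets_eq_imp_space_eq[OF \<mu>] by (simp add: space_restrict_space)
    have id: "(\<lambda>x. x) \<in> measurable \<mu> borel"
      unfolding measurable_cong_sets[OF \<mu> refl] by (rule measurable_restrict_space1) simp
    have cu: "continuous_on (closure \<Omega>) u" using u by (simp add: Cb_def)
    have GL: "G \<in> L1_loc \<Omega>" using G unfolding is_sym_grad_def by blast
    obtain F where F: "F \<in> borel_measurable borel" "\<And>y. 0 \<le> F y" "AE y in lebesgue_on \<Omega>. F y = norm (G y)"
      and FG: "\<And>p. (\<integral>\<^sup>+y. ennreal (F y powr p) \<partial>lborel) = (\<integral>\<^sup>+y. ennreal (norm (G y) powr p) \<partial>lebesgue_on \<Omega>)"
      by (rule borel_representative_norm[OF \<Omega> GL]) blast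
    note F(1) [measurable]
    define w where "w y = norm (u y) * indicator (frontier \<Omega>) y" for y
    define v where "v y = norm (u y) * indicator \<Omega> y" for y
    have w [measurable]: "w \<in> borel_measurable borel"
    proof -
      have "continuous_on (frontier \<Omega>) u"
        using cu by (auto simp: frontier_def intro: continuous_on_subset)
      then have "(\<lambda>y. indicator (frontier \<Omega>) y *\<^sub>R norm (u y)) \<in> borel_measurable borel"
        by (intro borel_measurable_continuous_on_indicator continuous_intros) auto
      then show ?thesis by (simp add: w_def[abs_def] mult.commute)
    qed
    have v [measurable]: "v \<in> borel_measurable borel"
    proof -
      have "continuous_on \<Omega> u" by (rule continuous_on_subset[OF cu closure_subset])
      then have "(\<lambda>y. indicator \<Omega> y *\<^sub>R norm (u y)) \<in> borel_measurable borel"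
        using \<Omega> by (intro borel_measurable_continuous_on_indicator continuous_intros) auto
      then show ?thesis by (simp add: v_def[abs_def] mult.commute)
    qed
    have bdd: "bounded {x. v x \<noteq> 0}"
    proof (rule bounded_subset)
      show "bounded {x \<in> closure \<Omega>. u x \<noteq> 0}" using u by (simp add: Cb_def)
      show "{x. v x \<noteq> 0} \<subseteq> {x \<in> closure \<Omega>. u x \<noteq> 0}"
        using closure_subset[of \<Omega>] by (auto simp: v_def indicator_def split: if_splits)
    qed
    have Fp: "(\<integral>\<^sup>+y. ennreal (F y powr p) \<partial>lborel) = ennreal (g powr p)"
      unfolding FG using g assms(5) by (intro Lp_norm_eqD) auto
    have ws: "(\<integral>\<^sup>+y. ennreal (w y powr s) \<partial>?H) = ennreal (h powr s)"
    proof -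
      have "(\<integral>\<^sup>+y. ennreal (w y powr s) \<partial>?H) = (\<integral>\<^sup>+y. ennreal (norm (u y) powr s) * indicator (frontier \<Omega>) y \<partial>?H)"
        by (intro nn_integral_cong) (auto simp: w_def indicator_def)
      also have "\<dots> = (\<integral>\<^sup>+y. ennreal (norm (u y) powr s) \<partial>restrict_space ?H (frontier \<Omega>))"
        by (subst nn_integral_restrict_space) auto
      also have "\<dots> = ennreal (h powr s)" using h s by (intro Lp_norm_eqD) auto
      finally show ?thesis .
    qed
    \<comment> \<open>Homogeneity: dividing \<open>F\<close>, \<open>w\<close> and \<open>v\<close>
      by a common \<open>D\<close> above both norms gives data of norm at most 1. The pointwise
      bound survives the division because it is available at every level, here at
      \<open>t * D\<close>.\<close>
    have bound: "Lp_norm \<mu> q u \<le> ennreal (C * D)" if D: "g \<le> D" "h \<le> D" "0 < D" for D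
    proof -
      have scale: "ennreal (1 / D) * ennreal (a * D) = ennreal a" for a
        using D by (simp add: ennreal_mult'[symmetric])
      have scF: "(\<integral>\<^sup>+y. ennreal ((f y / D) powr e) \<partial>N) \<le> 1"
        if f: "f \<in> borel_measurable N" "\<And>y. 0 \<le> f y" and le: "(\<integral>\<^sup>+y. ennreal (f y powr e) \<partial>N) = ennreal (k powr e)"
          and k: "0 \<le> k" "k \<le> D" "0 < e" for f :: "real^'n \<Rightarrow> real" and N e k
      proof -
        have "(\<integral>\<^sup>+y. ennreal ((f y / D) powr e) \<partial>N) = (\<integral>\<^sup>+y. ennreal (1 / D powr e) * ennreal (f y powr e) \<partial>N)"
          using D f by (intro nn_integral_cong) (simp add: powr_divide ennreal_mult[symmetric])
        also have "\<dots> = ennreal (1 / D powr e) * ennreal (k powr e)"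
          using f by (subst nn_integral_cmult) (auto simp: le)
        also have "\<dots> = ennreal (k powr e / D powr e)" by (simp add: ennreal_mult[symmetric])
        also have "\<dots> \<le> ennreal 1"
          using k D by (intro ennreal_leI) (auto simp: divide_le_eq intro!: powr_mono2)
        finally show ?thesis by simp
      qed
      have "(\<integral>\<^sup>+x. ennreal ((v x / D) powr q) \<partial>M) \<le> ennreal C2"
      proof (rule strong[OF M, of ?H "\<lambda>y. F y / D" "\<lambda>y. w y / D" "\<lambda>y. v y / D"])
        show "(\<integral>\<^sup>+y. ennreal ((F y / D) powr p) \<partial>lborel) \<le> 1"
          by (rule scF[OF _ F(2) Fp g(2) D(1)]) (use assms(5) in auto)
        show "(\<integral>\<^sup>+y. ennreal ((w y / D) powr s) \<partial>?H) \<le> 1"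
        proof (rule scF[OF _ _ ws h(2) D(2) s])
          show "w \<in> borel_measurable ?H" by measurable
        qed (simp add: w_def)
        show "bounded {x. v x / D \<noteq> 0}" using bdd D by simp
        fix x :: "real^'n" and t :: real assume t: "0 < t"
        let ?k = "\<lambda>y. ennreal (norm (x - y) powr - d)"
        show "ennreal (v x / D) \<le> ennreal C1 * ((\<integral>\<^sup>+y. ennreal (F y / D) * ?k y \<partial>lborel) + ennreal t +
            (\<integral>\<^sup>+y. ennreal (w y / D) * indicator {y. t < w y / D} y * ?k y \<partial>?H))"
        proof (cases "x \<in> \<Omega>")
          case True
          let ?V = "\<integral>\<^sup>+y. ennreal (F y) * ?k y \<partial>lborel"
          let ?J = "\<integral>\<^sup>+y. ennreal (w y) * indicator {y. t * D < w y} y * ?k y \<partial>?H"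
          have "ennreal (v x) \<le> ennreal C1 * (?V + ennreal (t * D) + ?J)"
            using level[OF \<Omega> u G F True, of "t * D"] t D True by (simp add: v_def w_def)
          then have "ennreal (1 / D) * ennreal (v x) \<le> ennreal (1 / D) * (ennreal C1 * (?V + ennreal (t * D) + ?J))"
            by (rule mult_left_mono) auto
          also have "\<dots> = ennreal C1 * (ennreal (1 / D) * ?V + ennreal (1 / D) * ennreal (t * D) + ennreal (1 / D) * ?J)"
            by (simp only: distrib_left mult_ac)
          also have "ennreal (1 / D) * ?V = (\<integral>\<^sup>+y. ennreal (F y / D) * ?k y \<partial>lborel)"
          proof -
            have "ennreal (1 / D) * ?V = (\<integral>\<^sup>+y. ennreal (1 / D) * (ennreal (F y) * ?k y) \<partial>lborel)"
              by (rule nn_integral_cmult[symmetric]) measurable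
            also have "\<dots> = (\<integral>\<^sup>+y. ennreal (F y / D) * ?k y \<partial>lborel)"
              using D F(2) by (intro nn_integral_cong) (simp add: mult.assoc[symmetric] ennreal_mult[symmetric])
            finally show ?thesis .
          qed
          also have "ennreal (1 / D) * ?J = (\<integral>\<^sup>+y. ennreal (w y / D) * indicator {y. t < w y / D} y * ?k y \<partial>?H)"
          proof -
            have "ennreal (1 / D) * ?J = (\<integral>\<^sup>+y. ennreal (1 / D) * (ennreal (w y) * indicator {y. t * D < w y} y * ?k y) \<partial>?H)"
              by (rule nn_integral_cmult[symmetric]) measurable
            also have "\<dots> = (\<integral>\<^sup>+y. ennreal (w y / D) * indicator {y. t < w y / D} y * ?k y \<partial>?H)"
            proof (intro nn_integral_cong)
              fix y
              have "indicator {y. t * D < w y} y = (indicator {y. t < w y / D} y :: ennreal)"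
                using D by (simp add: indicator_def pos_less_divide_eq)
              moreover have "ennreal (1 / D) * ennreal (w y) = ennreal (w y / D)"
                using D by (simp add: ennreal_mult[symmetric] w_def)
              ultimately show "ennreal (1 / D) * (ennreal (w y) * indicator {y. t * D < w y} y * ?k y)
                  = ennreal (w y / D) * indicator {y. t < w y / D} y * ?k y"
                by (simp add: mult.assoc[symmetric])
            qed
            finally show ?thesis .
          qed
          also have "ennreal (1 / D) * ennreal (v x) = ennreal (v x / D)"
            using D by (simp add: ennreal_mult[symmetric] v_def)
          finally show ?thesis by (simp add: scale)
        qed (simp add: v_def)
      next
        show "(\<lambda>y. w y / D) \<in> borel_measurable borel" "(\<lambda>y. v y / D) \<in> borel_measurable borel"
          by measurable
        show "0 \<le> w y / D" "0 \<le> v y / D" for y using D by (simp_all add: w_def v_def)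
      qed (use D F(2) in auto)
      then have "ennreal (D powr q) * (\<integral>\<^sup>+x. ennreal ((v x / D) powr q) \<partial>M) \<le> ennreal (D powr q) * ennreal C2"
        by (rule mult_left_mono) auto
      also have "ennreal (D powr q) * (\<integral>\<^sup>+x. ennreal ((v x / D) powr q) \<partial>M)
          = (\<integral>\<^sup>+x. ennreal (D powr q) * ennreal ((v x / D) powr q) \<partial>M)"
        by (rule nn_integral_cmult[symmetric]) (simp add: M_def)
      also have "\<dots> = (\<integral>\<^sup>+x. ennreal (v x powr q) \<partial>M)"
        using D by (intro nn_integral_cong) (simp add: ennreal_mult[symmetric] powr_divide v_def)
      also have "\<dots> = (\<integral>\<^sup>+x. ennreal (norm (u x) powr q) \<partial>\<mu>)"
      proof -
        have "(\<integral>\<^sup>+x. ennreal (v x powr q) \<partial>M) = (\<integral>\<^sup>+x. ennreal (v x powr q) \<partial>\<mu>)"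
          unfolding M_def by (rule nn_integral_distr[OF id]) measurable
        also have "\<dots> = (\<integral>\<^sup>+x. ennreal (norm (u x) powr q) \<partial>\<mu>)"
          by (intro nn_integral_cong) (simp add: sp v_def)
        finally show ?thesis .
      qed
      also have "ennreal (D powr q) * ennreal C2 = ennreal (D powr q * C2)"
        using C2 by (simp add: ennreal_mult)
      finally have "Lp_norm \<mu> q u \<le> ennreal ((D powr q * C2) powr (1 / q))"
        by (rule Lp_norm_le[OF _ q])
      also have "(D powr q * C2) powr (1 / q) = C * D"
        using D C2 q by (simp add: C_def powr_mult powr_powr)
      finally show ?thesis .
    qed
    have "Lp_norm \<mu> q u \<le> ennreal (C * (g + h))"
    proof (rule ennreal_le_epsilon)
      fix e :: real assume e: "0 < e"
      \<comment> \<open>\<open>D\<close> must be positive while \<open>g + h\<close> may be 0; the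
        extra \<open>e / C\<close> contributes exactly \<open>e\<close> after multiplication by
        \<open>C\<close>.\<close>
      have "Lp_norm \<mu> q u \<le> ennreal (C * (g + h + e / C))"
        using g h e C by (intro bound) (auto intro: add_nonneg_pos)
      also have "C * (g + h + e / C) = C * (g + h) + e" using C by (simp add: distrib_left)
      also have "ennreal \<dots> = ennreal (C * (g + h)) + ennreal e"
        using C g h e by (intro ennreal_plus) auto
      finally show "Lp_norm \<mu> q u \<le> ennreal (C * (g + h)) + ennreal e" .
    qed
    also have "\<dots> = ennreal C * (ennreal g + ennreal h)" using C g h by (simp add: ennreal_mult)
    finally show ?thesis by (simp add: g h)
  qed
  show ?thesis
    using C main unfolding q_def s_def d_def by blast
qed

end
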